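(* For all integers $n\geq 3$, $$C^{-}(n)\subseteq \mathrm{Graph}_{\mathrm{depth},\dim}(n)\subseteq C^{+}(n),$$ where $$C^{-}(n)=\{(1,n-1)\}\cup\left\{(a,b)\in\mathbb{N}^2 \;\middle|\; a\leq b,\ 1\leq a\leq \left\lfloor \tfrac{n}{2}\right\rfloor,\ 1\leq b\leq n-2\right\}$$ and $$C^{+}(n)=\{(a,b)\in\mathbb{N}^2 \mid 1\leq a\leq b\leq n-1\}.$$
   Context: Let $K$ be a field. For a finite simple graph $G$ with vertex set $\{x_1,\ldots,x_n\}$, let $R=K[x_1,\ldots,x_n]$ and let $I(G)=(x_ix_j \mid \{x_i,x_j\}\in E(G))\subseteq R$ be its edge ideal. $\mathrm{depth}(R/I(G))$ is the length of a longest regular sequence and $\dim R/I(G)$ is the Krull dimension. $\mathrm{Graph}(n)$ is the set of all finite simple connected graphs with $n$ vertices, and $\mathrm{Graph}_{\mathrm{depth},\dim}(n)=\{(\mathrm{depth}(R/I(G)),\dim R/I(G)) \mid G\in\mathrm{Graph}(n)\}$. *)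

theory Defs
  imports
    "HOL-Algebra.Algebra"
    "HOL-Library.Poly_Mapping"
    "HOL-Library.Extended_Nat"
    "Graph_Theory.Graph_Theory"
begin

section \<open>Polynomial rings in finitely many variables\<close>

text \<open>
  A polynomial over \<open>'k\<close> in variables indexed by natural numbers is a finitely supported map from
  monomials (finitely supported exponent vectors) to coefficients, with the convolution product
  of \<open>HOL-Library.Poly_Mapping\<close>. The ring \<open>K[x\<^sub>1,\<dots>,x\<^sub>n]\<close> consists of those polynomials in which
  only the variables \<open>x\<^sub>1,\<dots>,x\<^sub>n\<close> occur.
\<close>

type_synonym 'k mpoly = "(nat \<Rightarrow>\<^sub>0 nat) \<Rightarrow>\<^sub>0 'k"

definition polynomial_ring :: "'k::field itself \<Rightarrow> nat \<Rightarrow> 'k mpoly ring" where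
  "polynomial_ring K n =
    \<lparr>carrier = {p. \<forall>m \<in> Poly_Mapping.keys p. Poly_Mapping.keys m \<subseteq> {1..n}},
     monoid.mult = (*), one = 1, ring.zero = 0, add = (+)\<rparr>"

definition variable :: "nat \<Rightarrow> 'k::field mpoly" where
  "variable i = Poly_Mapping.single (Poly_Mapping.single i 1) 1"

lemma polynomial_ring_cring: "cring (polynomial_ring K n)"
proof -
  have add: "p + q \<in> carrier (polynomial_ring K n)"
    if "p \<in> carrier (polynomial_ring K n)" "q \<in> carrier (polynomial_ring K n)" for p q
    using that Poly_Mapping.keys_add[of p q] by (auto simp: polynomial_ring_def)
  have mult: "p * q \<in> carrier (polynomial_ring K n)"
    if p: "p \<in> carrier (polynomial_ring K n)" and q: "q \<in> carrier (polynomial_ring K n)" for p q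
  proof -
    have "Poly_Mapping.keys m \<subseteq> {1..n}" if "m \<in> Poly_Mapping.keys (p * q)" for m
    proof -
      obtain a b where "m = a + b" "a \<in> Poly_Mapping.keys p" "b \<in> Poly_Mapping.keys q"
        using \<open>m \<in> Poly_Mapping.keys (p * q)\<close> Poly_Mapping.keys_mult[of p q] by auto
      moreover have "Poly_Mapping.keys (a + b) \<subseteq> Poly_Mapping.keys a \<union> Poly_Mapping.keys b"
        by (rule Poly_Mapping.keys_add)
      ultimately show ?thesis
        using p q by (auto simp: polynomial_ring_def)
    qed
    then show ?thesis by (simp add: polynomial_ring_def)
  qed
  have uminus: "- p \<in> carrier (polynomial_ring K n)"
    if "p \<in> carrier (polynomial_ring K n)" for p
    using that by (auto simp: polynomial_ring_def in_keys_iff)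
  have zero: "0 \<in> carrier (polynomial_ring K n)" and one: "1 \<in> carrier (polynomial_ring K n)"
    by (simp_all add: polynomial_ring_def)
  have sel: "monoid.mult (polynomial_ring K n) = (*)" "add (polynomial_ring K n) = (+)"
    "one (polynomial_ring K n) = 1" "ring.zero (polynomial_ring K n) = 0"
    by (simp_all add: polynomial_ring_def)
  show ?thesis
  proof (rule cringI)
    show "abelian_group (polynomial_ring K n)"
      by (rule abelian_groupI; (unfold sel)?)
        (simp_all add: add zero add.assoc add.commute, use uminus in \<open>force\<close>)
    show "Group.comm_monoid (polynomial_ring K n)"
      by (rule comm_monoidI; (unfold sel)?) (simp_all add: mult one mult.assoc mult.commute)
  qed (simp add: sel distrib_right)
qed

lemma variable_closed:
  assumes "i \<in> {1..n}"
  shows "variable i \<in> carrier (polynomial_ring K n)"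
  using assms by (auto simp: polynomial_ring_def variable_def)


section \<open>Krull dimension and depth\<close>

text \<open>
  Suprema are taken in \<^typ>\<open>enat\<close>, so an unbounded set of lengths gives \<open>\<infinity>\<close>. For the zero ring
  both invariants are \<open>0\<close> here, as the supremum of the empty set.
\<close>

definition krull_dim :: "('a, 'b) ring_scheme \<Rightarrow> enat" where
  "krull_dim A =
    (SUP k \<in> {k. \<exists>P :: nat \<Rightarrow> 'a set.
                  (\<forall>i \<le> k. primeideal (P i) A) \<and> (\<forall>i < k. P i \<subset> P (Suc i))}. enat k)"

definition nonzerodivisor :: "('a, 'b) ring_scheme \<Rightarrow> 'a \<Rightarrow> bool" where
  "nonzerodivisor A f \<longleftrightarrow>
    f \<in> carrier A \<and> (\<forall>g \<in> carrier A. f \<otimes>\<^bsub>A\<^esub> g = \<zero>\<^bsub>A\<^esub> \<longrightarrow> g = \<zero>\<^bsub>A\<^esub>)"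

definition regular_sequence :: "('a, 'b) ring_scheme \<Rightarrow> 'a list \<Rightarrow> bool" where
  "regular_sequence A fs \<longleftrightarrow>
    set fs \<subseteq> carrier A \<and>
    (\<forall>i < length fs.
      let J = Idl\<^bsub>A\<^esub> (set (take i fs)) in nonzerodivisor (A Quot J) (J +>\<^bsub>A\<^esub> (fs ! i))) \<and>
    Idl\<^bsub>A\<^esub> (set fs) \<noteq> carrier A"

text \<open>
  Depth is always relative to an ideal \<open>M\<close> that contains the elements of the regular sequence.
  For a standard graded algebra, \<open>M\<close> is the maximal ideal generated by the variables; without this
  restriction the lengths of the regular sequences would measure the dimension, not the depth.
\<close>

definition depth :: "('a, 'b) ring_scheme \<Rightarrow> 'a set \<Rightarrow> enat" where
  "depth A M = (SUP fs \<in> {fs. regular_sequence A fs \<and> set fs \<subseteq> M}. enat (length fs))"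


section \<open>Edge ideals\<close>

text \<open>
  Finite simple graphs are the symmetric, loop-free digraphs of the locale \<^locale>\<open>pair_graph\<close>:
  an edge \<open>{u, v}\<close> is represented by the two arcs \<open>(u, v)\<close> and \<open>(v, u)\<close>. Fixing the vertex set
  \<open>{1..n}\<close> loses no isomorphism class.
\<close>

definition connected_graphs :: "nat \<Rightarrow> nat pair_pre_digraph set" where
  "connected_graphs n =
    {G. pair_graph G \<and> pverts G = {1..n} \<and> Digraph_Component.connected (with_proj G)}"

definition edge_ideal :: "'k::field itself \<Rightarrow> nat \<Rightarrow> nat pair_pre_digraph \<Rightarrow> 'k mpoly set" where
  "edge_ideal K n G =
    Idl\<^bsub>polynomial_ring K n\<^esub> {variable u * variable v | u v. (u, v) \<in> parcs G}"

definition edge_ring :: "'k::field itself \<Rightarrow> nat \<Rightarrow> nat pair_pre_digraph \<Rightarrow> 'k mpoly set ring"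
  where "edge_ring K n G = polynomial_ring K n Quot edge_ideal K n G"

definition edge_ring_maximal_ideal ::
    "'k::field itself \<Rightarrow> nat \<Rightarrow> nat pair_pre_digraph \<Rightarrow> 'k mpoly set set" where
  "edge_ring_maximal_ideal K n G =
    Idl\<^bsub>edge_ring K n G\<^esub>
      ((\<lambda>i. edge_ideal K n G +>\<^bsub>polynomial_ring K n\<^esub> variable i) ` {1..n})"

definition graph_depth_dim :: "'k::field itself \<Rightarrow> nat \<Rightarrow> (enat \<times> enat) set" where
  "graph_depth_dim K n =
    (\<lambda>G. (depth (edge_ring K n G) (edge_ring_maximal_ideal K n G), krull_dim (edge_ring K n G)))
      ` connected_graphs n"

definition C_minus :: "nat \<Rightarrow> (nat \<times> nat) set" where
  "C_minus n =
    {(1, n - 1)} \<union> {(a, b). a \<le> b \<and> 1 \<le> a \<and> a \<le> n div 2 \<and> 1 \<le> b \<and> b \<le> n - 2}"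

definition C_plus :: "nat \<Rightarrow> (nat \<times> nat) set" where
  "C_plus n = {(a, b). 1 \<le> a \<and> a \<le> b \<and> b \<le> n - 1}"

end

theory Submission
  imports Defs
begin

text \<open>
  Write \<open>A = R/I(G)\<close>. The primes of \<open>A\<close> are governed by the independent vertex sets \<open>W\<close> of \<open>G\<close>:
  setting all variables outside \<open>W\<close> to \<open>0\<close> maps \<open>A\<close> onto the domain \<open>K[W]\<close>, and every prime of \<open>R\<close>
  above \<open>I(G)\<close> contains all variables outside a suitable \<open>W\<close>. Two facts about \<open>K[W]\<close> do most of the
  work: more than \<open>card W\<close> polynomials in it satisfy a polynomial relation over \<open>K\<close>, which is proved
  by counting monomials (\<open>polynomial_relation\<close>), and it is a domain.

  \<^item> \<^bold>\<open>Dimension.\<close> \<open>dim A\<close> is the largest size of an independent set. In a longer chain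
  of primes, elements picked from the successive differences would satisfy a relation modulo the
  smallest prime, and such a relation can be peeled off along the chain until a unit lies in a prime
  (\<open>krull_dim_le\<close>). The primes generated by variables give the other inequality.

  \<^item> \<^bold>\<open>Upper bound for the depth.\<close> If \<open>W\<close> is a maximal independent set, then \<open>depth A \<le> card W\<close>
  (\<open>depth_le\<close>). Namely, the product \<open>u\<close> of the variables in \<open>W\<close> is nonzero in \<open>A\<close> and is killed by all
  variables outside \<open>W\<close>. If a regular sequence \<open>f\<close> were longer than \<open>card W\<close>, a relation \<open>F\<close> between the
  restrictions of its entries to \<open>K[W]\<close> would give \<open>F(f) u = 0\<close> in \<open>A\<close>. A regular sequence is quasi-regular:
  the associated graded ring of \<open>A\<close> for the ideal \<open>(f)\<close> is a polynomial ring over \<open>A/(f)\<close>, so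
  multiplication by the initial form of \<open>F\<close>, whose coefficients lie in \<open>K\<close>, is injective there. Hence
  \<open>u\<close> lies in all powers of \<open>(f)\<close> (\<open>annihilator_of_relation\<close>), which the degree of \<open>u\<close> forbids. The
  entries of the sequence may be inhomogeneous here.

  \<^item> \<^bold>\<open>Lower bound for the depth.\<close> If the vertices \<open>s\<^sub>1,\<dots>,s\<^sub>a\<close> have closed neighbourhoods inside
  pairwise disjoint sets \<open>V\<^sub>1,\<dots>,V\<^sub>a\<close>, then the sums of the variables in the \<open>V\<^sub>i\<close> form a regular sequence
  (\<open>weakly_regular_packing\<close>). One filters \<open>A\<close> by the exact sequences that belong to \<open>I(G) : x\<close> and
  \<open>I(G) + (x)\<close> for vertices \<open>x\<close>, until only rings \<open>K[W]\<close> are left in which \<open>W\<close> meets every \<open>V\<^sub>i\<close>.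

  For every connected graph this yields \<open>1 \<le> depth A \<le> dim A \<le> n - 1\<close>. For prescribed \<open>(a, b)\<close> there is
  a graph with a vertex \<open>c\<close> such that \<open>c\<close> and its \<open>a - 1\<close> non-neighbours form a maximal independent set,
  the largest independent sets have size \<open>b\<close>, and the lower bound applies with \<open>a\<close> classes after
  splitting at \<open>c\<close>. The inequality \<open>2a \<le> n\<close> leaves enough neighbours of \<open>c\<close> to form these classes.
\<close>

section \<open>Ideals and regular sequences relative to a subring\<close>

text \<open>
  All computations take place in the type of polynomials in countably many variables. The rings
  \<open>K[x\<^sub>1,\<dots>,x\<^sub>n]\<close> are subrings \<open>S\<close> of this type, so ideals of a subring of a commutative ring are
  treated as plain sets; quotient rings only appear when the definitions of depth and dimension
  are unfolded.
\<close>

locale unital_subring =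
  fixes S :: "'a::comm_ring_1 set"
  assumes one_mem: "1 \<in> S"
    and minus_one_mem: "- 1 \<in> S"
    and add_mem: "x \<in> S \<Longrightarrow> y \<in> S \<Longrightarrow> x + y \<in> S"
    and mult_mem: "x \<in> S \<Longrightarrow> y \<in> S \<Longrightarrow> x * y \<in> S"
begin

lemma uminus_mem: "x \<in> S \<Longrightarrow> - x \<in> S"
  using mult_mem[OF minus_one_mem] by force

lemma zero_mem: "0 \<in> S"
  using add_mem[OF one_mem minus_one_mem] by simp

lemma diff_mem: "x \<in> S \<Longrightarrow> y \<in> S \<Longrightarrow> x - y \<in> S"
  using add_mem[of x "- y"] uminus_mem by simp

lemma power_mem: "x \<in> S \<Longrightarrow> x ^ k \<in> S"
  by (induction k) (auto simp: one_mem mult_mem)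

lemma sum_mem: "(\<And>x. x \<in> A \<Longrightarrow> h x \<in> S) \<Longrightarrow> sum h A \<in> S"
  by (induction A rule: infinite_finite_induct) (auto simp: zero_mem add_mem)

definition ideal_of :: "'a set \<Rightarrow> bool" where
  "ideal_of L \<longleftrightarrow> L \<subseteq> S \<and> 0 \<in> L \<and> (\<forall>x\<in>L. \<forall>y\<in>L. x + y \<in> L) \<and> (\<forall>s\<in>S. \<forall>x\<in>L. s * x \<in> L)"

definition adjoin :: "'a set \<Rightarrow> 'a \<Rightarrow> 'a set" where
  "adjoin L f = {l + f * s | l s. l \<in> L \<and> s \<in> S}"

definition colon :: "'a set \<Rightarrow> 'a \<Rightarrow> 'a set" where
  "colon L x = {g \<in> S. x * g \<in> L}"

lemma ideal_of_subset: "ideal_of L \<Longrightarrow> L \<subseteq> S"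
  by (simp add: ideal_of_def)

lemma ideal_ofD:
  assumes "ideal_of L"
  shows "0 \<in> L" "x \<in> L \<Longrightarrow> y \<in> L \<Longrightarrow> x + y \<in> L"
    "s \<in> S \<Longrightarrow> x \<in> L \<Longrightarrow> s * x \<in> L" "s \<in> S \<Longrightarrow> x \<in> L \<Longrightarrow> x * s \<in> L"
  using assms unfolding ideal_of_def by (blast, blast, blast, metis mult.commute)

lemma ideal_of_uminus: "ideal_of L \<Longrightarrow> x \<in> L \<Longrightarrow> - x \<in> L"
  using ideal_ofD(3)[of L "- 1" x] minus_one_mem by simp

lemma ideal_of_diff: "ideal_of L \<Longrightarrow> x \<in> L \<Longrightarrow> y \<in> L \<Longrightarrow> x - y \<in> L"
  using ideal_ofD(2)[of L x "- y"] ideal_of_uminus by simp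

lemma ideal_of_sum: "ideal_of L \<Longrightarrow> (\<And>x. x \<in> A \<Longrightarrow> h x \<in> L) \<Longrightarrow> sum h A \<in> L"
  by (induction A rule: infinite_finite_induct) (auto simp: ideal_ofD)

lemma ideal_of_self: "ideal_of S"
  unfolding ideal_of_def using zero_mem add_mem mult_mem by auto

lemma ideal_of_adjoin:
  assumes "ideal_of L" "f \<in> S"
  shows "ideal_of (adjoin L f)"
  unfolding ideal_of_def
proof (intro conjI ballI subsetI)
  show "0 \<in> adjoin L f"
    unfolding adjoin_def using ideal_ofD(1)[OF assms(1)] zero_mem by force
next
  fix x y assume "x \<in> adjoin L f" "y \<in> adjoin L f"
  then obtain l s l' s' where "x = l + f * s" "y = l' + f * s'" "l \<in> L" "s \<in> S" "l' \<in> L" "s' \<in> S"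
    unfolding adjoin_def by auto
  then have "x + y = (l + l') + f * (s + s')" "l + l' \<in> L" "s + s' \<in> S"
    using ideal_ofD[OF assms(1)] add_mem by (auto simp: algebra_simps)
  then show "x + y \<in> adjoin L f" unfolding adjoin_def by blast
next
  fix x y assume "x \<in> S" "y \<in> adjoin L f"
  then obtain l s where "y = l + f * s" "l \<in> L" "s \<in> S"
    unfolding adjoin_def by auto
  then have "x * y = x * l + f * (x * s)" "x * l \<in> L" "x * s \<in> S"
    using ideal_ofD(3)[OF assms(1)] mult_mem \<open>x \<in> S\<close>
    by (simp_all add: distrib_left mult.left_commute)
  then show "x * y \<in> adjoin L f" unfolding adjoin_def by blast
next
  fix x assume "x \<in> adjoin L f"
  then show "x \<in> S"
    using assms(2) add_mem mult_mem ideal_of_subset[OF assms(1)] unfolding adjoin_def by blast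
qed

lemma subset_adjoin: "L \<subseteq> adjoin L f"
  unfolding adjoin_def using zero_mem by force

lemma mem_adjoin: "ideal_of L \<Longrightarrow> f \<in> adjoin L f"
  unfolding adjoin_def using one_mem ideal_ofD(1) by force

lemma adjoinI: "l \<in> L \<Longrightarrow> s \<in> S \<Longrightarrow> l + f * s \<in> adjoin L f"
  unfolding adjoin_def by blast

lemma adjoin_subset: "ideal_of T \<Longrightarrow> L \<subseteq> T \<Longrightarrow> f \<in> T \<Longrightarrow> adjoin L f \<subseteq> T"
  unfolding adjoin_def using ideal_ofD(2,4)[of T] by blast

lemma adjoin_commute: "adjoin (adjoin L f) g = adjoin (adjoin L g) f"
proof -
  have "adjoin (adjoin L f) g \<subseteq> adjoin (adjoin L g) f" for f g
  proof
    fix x assume "x \<in> adjoin (adjoin L f) g"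
    then obtain l s t where "x = (l + f * s) + g * t" "l \<in> L" "s \<in> S" "t \<in> S"
      unfolding adjoin_def by auto
    then have "x = (l + g * t) + f * s" by (simp add: algebra_simps)
    then show "x \<in> adjoin (adjoin L g) f"
      using \<open>l \<in> L\<close> \<open>s \<in> S\<close> \<open>t \<in> S\<close> by (simp add: adjoinI)
  qed
  then show ?thesis by blast
qed

primrec adjoin_list :: "'a set \<Rightarrow> 'a list \<Rightarrow> 'a set" where
  "adjoin_list L [] = L"
| "adjoin_list L (f # fs) = adjoin_list (adjoin L f) fs"

text \<open>
  Properness of the ideal that the sequence generates is left out here: it would not be inherited by
  the outer terms of a short exact sequence.
\<close>

primrec weakly_regular :: "'a set \<Rightarrow> 'a list \<Rightarrow> bool" where
  "weakly_regular L [] \<longleftrightarrow> True"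
| "weakly_regular L (f # fs) \<longleftrightarrow> (\<forall>g\<in>S. f * g \<in> L \<longrightarrow> g \<in> L) \<and> weakly_regular (adjoin L f) fs"

lemma adjoin_list_append: "adjoin_list L (fs @ gs) = adjoin_list (adjoin_list L fs) gs"
  by (induction fs arbitrary: L) auto

lemma ideal_of_adjoin_list: "ideal_of L \<Longrightarrow> set fs \<subseteq> S \<Longrightarrow> ideal_of (adjoin_list L fs)"
  by (induction fs arbitrary: L) (auto simp: ideal_of_adjoin)

lemma subset_adjoin_list: "L \<subseteq> adjoin_list L fs"
  by (induction fs arbitrary: L) (use subset_adjoin in fastforce)+

lemma set_subset_adjoin_list: "ideal_of L \<Longrightarrow> set fs \<subseteq> S \<Longrightarrow> set fs \<subseteq> adjoin_list L fs"
proof (induction fs arbitrary: L)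
  case (Cons f fs)
  then have "ideal_of (adjoin L f)" by (simp add: ideal_of_adjoin)
  then have "set fs \<subseteq> adjoin_list (adjoin L f) fs"
    using Cons.IH Cons.prems by simp
  moreover have "f \<in> adjoin_list (adjoin L f) fs"
    using mem_adjoin[OF Cons.prems(1)] subset_adjoin_list by blast
  ultimately show ?case by simp
qed simp

lemma adjoin_list_subset:
  "ideal_of T \<Longrightarrow> L \<subseteq> T \<Longrightarrow> set fs \<subseteq> T \<Longrightarrow> adjoin_list L fs \<subseteq> T"
  by (induction fs arbitrary: L) (simp_all add: adjoin_subset)

lemma weakly_regular_iff_nth:
  "weakly_regular L fs \<longleftrightarrow>
    (\<forall>i < length fs. \<forall>g\<in>S. fs ! i * g \<in> adjoin_list L (take i fs) \<longrightarrow> g \<in> adjoin_list L (take i fs))"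
proof (induction fs arbitrary: L)
  case (Cons f fs)
  show ?case by (simp add: Cons All_less_Suc2)
qed simp

text \<open>
  The short exact sequence \<open>0 \<rightarrow> S/(L : x) \<rightarrow> S/L \<rightarrow> S/(L + xS) \<rightarrow> 0\<close>: weak regularity of a
  sequence is stable under extensions of modules, because the snake lemma keeps the
  sequence exact after dividing by the first element.
\<close>

lemma weakly_regular_colon_adjoin:
  assumes "ideal_of L" "x \<in> S" "set fs \<subseteq> S"
    and "weakly_regular (colon L x) fs" "weakly_regular (adjoin L x) fs"
  shows "weakly_regular L fs"
  using assms
proof (induction fs arbitrary: L)
  case (Cons f fs)
  note L = ideal_ofD[OF \<open>ideal_of L\<close>]
  have f: "f \<in> S" using Cons.prems by simp
  have colon_reg: "h \<in> colon L x" if "h \<in> S" "f * h \<in> colon L x" for h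
    using Cons.prems(4) that unfolding weakly_regular.simps by blast
  have adjoin_reg: "h \<in> adjoin L x" if "h \<in> S" "f * h \<in> adjoin L x" for h
    using Cons.prems(5) that unfolding weakly_regular.simps by blast
  have "g \<in> L" if g: "g \<in> S" "f * g \<in> L" for g
  proof -
    have "g \<in> adjoin L x" using adjoin_reg[OF g(1)] g(2) subset_adjoin by blast
    then obtain l h where lh: "g = l + x * h" "l \<in> L" "h \<in> S" unfolding adjoin_def by auto
    have "x * (f * h) = f * g - f * l" by (simp add: lh algebra_simps)
    also have "\<dots> \<in> L" using g lh f L ideal_of_diff[OF \<open>ideal_of L\<close>] by simp
    finally have "f * h \<in> colon L x" using lh f mult_mem by (simp add: colon_def)
    then have "h \<in> colon L x" by (rule colon_reg[OF lh(3)])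
    then show ?thesis using lh L by (simp add: colon_def)
  qed
  moreover have "colon (adjoin L f) x = adjoin (colon L x) f"
  proof
    show "colon (adjoin L f) x \<subseteq> adjoin (colon L x) f"
    proof
      fix g assume "g \<in> colon (adjoin L f) x"
      then obtain l h where lh: "x * g = l + f * h" "l \<in> L" "h \<in> S" "g \<in> S"
        unfolding adjoin_def colon_def by auto
      have "f * h = - l + x * g" using lh(1) by (simp add: algebra_simps)
      also have "\<dots> \<in> adjoin L x"
        using lh ideal_of_uminus[OF \<open>ideal_of L\<close>] by (intro adjoinI) auto
      finally have "h \<in> adjoin L x" by (rule adjoin_reg[OF lh(3)])
      then obtain l' k where k: "h = l' + x * k" "l' \<in> L" "k \<in> S" unfolding adjoin_def by auto
      have "x * (g - f * k) = l + f * l'" using lh(1) k(1) by (simp add: algebra_simps)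
      then have "g - f * k \<in> colon L x"
        using lh k f L mult_mem diff_mem by (simp add: colon_def)
      then show "g \<in> adjoin (colon L x) f" using adjoinI[of "g - f * k" _ k f] k by simp
    qed
    show "adjoin (colon L x) f \<subseteq> colon (adjoin L f) x"
    proof
      fix g assume "g \<in> adjoin (colon L x) f"
      then obtain l h where lh: "g = l + f * h" "l \<in> S" "x * l \<in> L" "h \<in> S"
        unfolding adjoin_def colon_def by auto
      have "x * g = x * l + f * (x * h)" by (simp add: lh algebra_simps)
      then show "g \<in> colon (adjoin L f) x"
        using lh f Cons.prems(2) by (simp add: colon_def adjoinI mult_mem add_mem)
    qed
  qed
  moreover have "adjoin (adjoin L x) f = adjoin (adjoin L f) x"
    by (rule adjoin_commute)
  ultimately have "weakly_regular (colon (adjoin L f) x) fs" "weakly_regular (adjoin (adjoin L f) x) fs"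
    using Cons.prems(4,5) unfolding weakly_regular.simps by metis+
  then have "weakly_regular (adjoin L f) fs"
    using Cons.IH[of "adjoin L f"] ideal_of_adjoin[OF \<open>ideal_of L\<close> f] Cons.prems(2,3) by simp
  then show ?case
    unfolding weakly_regular.simps using \<open>\<And>g. g \<in> S \<Longrightarrow> f * g \<in> L \<Longrightarrow> g \<in> L\<close> by blast
qed simp

end

section \<open>Regular sequences are quasi-regular\<close>

text \<open>
  Quasi-regularity says that a homogeneous form in the elements \<open>f\<^sub>0,\<dots>,f\<^bsub>i-1\<^esub>\<close> of a regular sequence has
  small value only if its coefficients are small. Coefficients never appear below. Instead, ideals of
  values are attached to ideals \<open>T\<close> of admissible coefficients, and the statement about coefficients
  becomes a statement about how such an ideal splits along the last element.
\<close>

locale element_sequence = unital_subring S for S :: "'a::comm_ring_1 set" +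
  fixes L :: "'a set" and f :: "nat \<Rightarrow> 'a"
  assumes base_ideal: "ideal_of L" and seq_mem: "f i \<in> S"
begin

primrec J :: "nat \<Rightarrow> 'a set" where
  "J 0 = L"
| "J (Suc i) = adjoin (J i) (f i)"

text \<open>
  The values at \<open>f\<^sub>0,\<dots>,f\<^bsub>i-1\<^esub>\<close> of the forms of degree \<open>s\<close> with coefficients in \<open>T\<close>, enlarged by \<open>L\<close>.
  The recursion separates the part free of the last variable from a multiple of the last variable.
  For \<open>T = S\<close> this is the ideal \<open>L + (f\<^sub>0,\<dots>,f\<^bsub>i-1\<^esub>)\<^sup>s\<close>.
\<close>

fun forms :: "nat \<Rightarrow> nat \<Rightarrow> 'a set \<Rightarrow> 'a set" where
  "forms 0 0 T = T"
| "forms 0 (Suc s) T = L"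
| "forms (Suc i) 0 T = T"
| "forms (Suc i) (Suc s) T = {v + f i * w | v w. v \<in> forms i (Suc s) T \<and> w \<in> forms (Suc i) s T}"

abbreviation N :: "nat \<Rightarrow> nat \<Rightarrow> 'a set" where
  "N i s \<equiv> forms i s S"

lemma forms_zero [simp]: "forms i 0 T = T"
  by (cases i) auto

lemma forms_SucI: "v \<in> forms i (Suc s) T \<Longrightarrow> w \<in> forms (Suc i) s T \<Longrightarrow> v + f i * w \<in> forms (Suc i) (Suc s) T"
  by auto

lemma forms_SucE:
  assumes "x \<in> forms (Suc i) (Suc s) T"
  obtains v w where "x = v + f i * w" "v \<in> forms i (Suc s) T" "w \<in> forms (Suc i) s T"
  using assms by auto

lemma ideal_of_J: "ideal_of (J i)"
  by (induction i) (auto simp: base_ideal ideal_of_adjoin seq_mem)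

lemma J_mono_Suc: "J i \<subseteq> J (Suc i)"
  by (simp add: subset_adjoin)

lemma base_subset_J: "L \<subseteq> J i"
  by (induction i) (use J_mono_Suc in auto)

lemma J_subset: "J i \<subseteq> S"
  using ideal_of_J ideal_of_subset by blast

lemma base_subset: "L \<subseteq> S"
  using base_ideal ideal_of_subset by blast

lemma seq_mem_J: "f i \<in> J (Suc i)"
  by (simp add: mem_adjoin ideal_of_J)

lemma ideal_of_forms: "ideal_of T \<Longrightarrow> ideal_of (forms i s T)"
proof (induction i s T rule: forms.induct)
  case (4 i s T)
  note I = 4(1)[OF 4(3)] 4(2)[OF 4(3)]
  show ?case unfolding ideal_of_def
  proof (intro conjI ballI)
    show "forms (Suc i) (Suc s) T \<subseteq> S"
    proof
      fix x assume "x \<in> forms (Suc i) (Suc s) T"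
      then obtain v w where "x = v + f i * w" "v \<in> forms i (Suc s) T" "w \<in> forms (Suc i) s T"
        by (elim forms_SucE)
      then show "x \<in> S"
        using ideal_of_subset[OF I(1)] ideal_of_subset[OF I(2)]
          add_mem[OF _ mult_mem[OF seq_mem]] by blast
    qed
    show "0 \<in> forms (Suc i) (Suc s) T"
      using forms_SucI[OF ideal_ofD(1)[OF I(1)] ideal_ofD(1)[OF I(2)]] by simp
  next
    fix x y assume "x \<in> forms (Suc i) (Suc s) T" "y \<in> forms (Suc i) (Suc s) T"
    then obtain v w v' w' where *: "x = v + f i * w" "v \<in> forms i (Suc s) T" "w \<in> forms (Suc i) s T"
      "y = v' + f i * w'" "v' \<in> forms i (Suc s) T" "w' \<in> forms (Suc i) s T"
      by (elim forms_SucE)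
    have "x + y = (v + v') + f i * (w + w')" by (simp add: * algebra_simps)
    then show "x + y \<in> forms (Suc i) (Suc s) T"
      using forms_SucI[OF ideal_ofD(2)[OF I(1)] ideal_ofD(2)[OF I(2)]] * by metis
  next
    fix a x assume "a \<in> S" "x \<in> forms (Suc i) (Suc s) T"
    then obtain v w where *: "x = v + f i * w" "v \<in> forms i (Suc s) T" "w \<in> forms (Suc i) s T"
      by (elim forms_SucE)
    have "a * x = a * v + f i * (a * w)" by (simp add: * algebra_simps)
    then show "a * x \<in> forms (Suc i) (Suc s) T"
      using forms_SucI[OF ideal_ofD(3)[OF I(1)] ideal_ofD(3)[OF I(2)]] * \<open>a \<in> S\<close> by metis
  qed
qed (auto simp: base_ideal)

lemma forms_mono: "T \<subseteq> T' \<Longrightarrow> forms i s T \<subseteq> forms i s T'"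
proof (induction i s T rule: forms.induct)
  case (4 i s T)
  then show ?case by (auto intro!: forms_SucI elim!: forms_SucE simp del: forms.simps)
qed auto

lemma base_subset_forms: "L \<subseteq> T \<Longrightarrow> L \<subseteq> forms i s T"
proof (induction i s T rule: forms.induct)
  case (4 i s T)
  show ?case
  proof
    fix x assume "x \<in> L"
    then have "x + f i * 0 \<in> forms (Suc i) (Suc s) T"
      using 4 ideal_ofD(1)[OF base_ideal] by (intro forms_SucI) auto
    then show "x \<in> forms (Suc i) (Suc s) T" by simp
  qed
qed auto

lemma ideal_of_N: "ideal_of (N i s)"
  by (simp add: ideal_of_forms ideal_of_self)

lemma N_subset: "N i s \<subseteq> S"
  by (simp add: ideal_of_N ideal_of_subset)

lemma forms_Suc_mono: "ideal_of T \<Longrightarrow> forms i s T \<subseteq> forms (Suc i) s T"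
proof (cases s)
  case (Suc s')
  assume "ideal_of T"
  show ?thesis
  proof
    fix x assume "x \<in> forms i s T"
    then have "x + f i * 0 \<in> forms (Suc i) (Suc s') T"
      using Suc ideal_ofD(1)[OF ideal_of_forms[OF \<open>ideal_of T\<close>]] by (intro forms_SucI) auto
    then show "x \<in> forms (Suc i) s T" using Suc by simp
  qed
qed simp

lemma coefficient_mult_form:
  "ideal_of T \<Longrightarrow> x \<in> T \<Longrightarrow> g \<in> N i s \<Longrightarrow> x * g \<in> forms i s T"
proof (induction i s T arbitrary: g rule: forms.induct)
  case (4 i s T)
  obtain v w where *: "g = v + f i * w" "v \<in> N i (Suc s)" "w \<in> N (Suc i) s"
    using 4(5) by (elim forms_SucE)
  have "x * g = x * v + f i * (x * w)" by (simp add: * algebra_simps)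
  then show ?case
    using forms_SucI[OF 4(1)[OF 4(3,4) *(2)] 4(2)[OF 4(3,4) *(3)]] by simp
next
  case (2 s T)
  then show ?case using base_ideal ideal_ofD(3) ideal_of_subset by (metis forms.simps(2) subsetD)
qed (simp_all add: ideal_ofD(4))

lemma form_mult_form:
  "ideal_of T \<Longrightarrow> L \<subseteq> T \<Longrightarrow> g \<in> N i s \<Longrightarrow> h \<in> forms i t T \<Longrightarrow> g * h \<in> forms i (s + t) T"
proof (induction "i + s + t" arbitrary: i s t g h rule: less_induct)
  case less
  note T = \<open>ideal_of T\<close>
  have hS: "h \<in> S" using ideal_of_subset[OF ideal_of_forms[OF T]] less.prems(4) by blast
  have gS: "g \<in> S" using N_subset less.prems(3) by blast
  show ?case
  proof (cases s)
    case 0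
    then show ?thesis using ideal_ofD(3)[OF ideal_of_forms[OF T]] gS less.prems(4) by simp
  next
    case (Suc s')
    show ?thesis
    proof (cases t)
      case 0
      then show ?thesis using coefficient_mult_form[OF T, of h g i s] less.prems by (simp add: mult.commute)
    next
      case (Suc t')
      show ?thesis
      proof (cases i)
        case 0
        then show ?thesis
          using less.prems(3) ideal_ofD(4)[OF base_ideal hS, of g] \<open>s = Suc s'\<close> by simp
      next
        case (Suc k)
        obtain v w where g: "g = v + f k * w" "v \<in> N k s" "w \<in> N i s'"
          using less.prems(3) unfolding \<open>i = Suc k\<close> \<open>s = Suc s'\<close> by (elim forms_SucE)
        obtain v' w' where h: "h = v' + f k * w'" "v' \<in> forms k t T" "w' \<in> forms i t' T"
          using less.prems(4) unfolding \<open>i = Suc k\<close> \<open>t = Suc t'\<close> by (elim forms_SucE)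
        have "v * v' \<in> forms k (s + t) T"
          using less.hyps[of k s t v v'] T less.prems(2) g h \<open>i = Suc k\<close> by simp
        moreover have "w * h \<in> forms i (s' + t) T"
          using less.hyps[of i s' t w h] T less.prems g h \<open>s = Suc s'\<close> by simp
        moreover have "v \<in> N i s"
          using forms_Suc_mono[OF ideal_of_self] g(2) \<open>i = Suc k\<close> by blast
        then have "v * w' \<in> forms i (s + t') T"
          using less.hyps[of i s t' v w'] T less.prems(2) h \<open>t = Suc t'\<close> by simp
        ultimately have "v * v' + f k * (v * w' + w * h) \<in> forms i (s + t) T"
          using ideal_ofD(2)[OF ideal_of_forms[OF T], of "v * w'" i "s + t'" "w * h"] Suc
            \<open>s = Suc s'\<close> \<open>t = Suc t'\<close> by (auto intro: forms_SucI simp del: forms.simps)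
        moreover have "g * h = v * v' + f k * (v * w' + w * h)"
          by (simp add: g h algebra_simps)
        ultimately show ?thesis by simp
      qed
    qed
  qed
qed

lemma seq_mult_forms:
  assumes "ideal_of T" "w \<in> forms (Suc i) s T"
  shows "f i * w \<in> forms (Suc i) (Suc s) T"
  using forms_SucI[OF ideal_ofD(1)[OF ideal_of_forms[OF assms(1)]] assms(2)] by simp

lemma forms_adjoin:
  assumes "ideal_of T" "g \<in> S"
  shows "x \<in> forms i s (adjoin T g) \<Longrightarrow> \<exists>a\<in>forms i s T. \<exists>b\<in>N i s. x = a + g * b"
proof (induction i s T arbitrary: x rule: forms.induct)
  case (4 i s T)
  obtain v w where x: "x = v + f i * w" "v \<in> forms i (Suc s) (adjoin T g)" "w \<in> forms (Suc i) s (adjoin T g)"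
    using 4(3) by (elim forms_SucE)
  obtain a b where ab: "a \<in> forms i (Suc s) T" "b \<in> N i (Suc s)" "v = a + g * b"
    using 4(1)[OF x(2)] by blast
  obtain a' b' where ab': "a' \<in> forms (Suc i) s T" "b' \<in> N (Suc i) s" "w = a' + g * b'"
    using 4(2)[OF x(3)] by blast
  have "x = (a + f i * a') + g * (b + f i * b')"
    by (simp add: x ab ab' algebra_simps)
  then show ?case using forms_SucI ab ab' by blast
next
  case (1 T)
  then show ?case by (auto simp: adjoin_def)
next
  case (2 s T)
  then show ?case using ideal_ofD(1)[OF base_ideal] by force
next
  case (3 i T)
  then show ?case by (auto simp: adjoin_def)
qed

text \<open>
  A form of degree \<open>s + 1\<close> is a form of degree \<open>s\<close> whose coefficients are linear forms, that is, elements
  of the ideal of the sequence. Moving one factor \<open>f\<^bsub>k\<^esub>\<close> from a coefficient to the form is where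
  \<open>forms_adjoin\<close> enters.
\<close>

lemma N_Suc: "N i (Suc s) = forms i s (J i)"
proof (induction "i + s" arbitrary: i s rule: less_induct)
  case less
  show ?case
  proof (cases i)
    case 0
    then show ?thesis by (cases s) auto
  next
    case (Suc k)
    have k: "N k (Suc t) = forms k t (J k)" if "t \<le> s" for t
      using less.hyps[of k t] Suc that by simp
    show ?thesis
    proof (cases s)
      case 0
      have "N k (Suc 0) = J k" using k[of 0] by simp
      then show ?thesis using \<open>i = Suc k\<close> 0 by (auto simp: adjoin_def)
    next
      case (Suc t)
      have IH: "N i (Suc t) = forms i t (J i)"
        using less.hyps[of i t] Suc by simp
      have Jk: "J k \<subseteq> J i" using J_mono_Suc \<open>i = Suc k\<close> by simp
      show ?thesis
      proof
        show "N i (Suc s) \<subseteq> forms i s (J i)"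
        proof
          fix x assume "x \<in> N i (Suc s)"
          then obtain v w where x: "x = v + f k * w" "v \<in> N k (Suc s)" "w \<in> N i s"
            unfolding \<open>i = Suc k\<close> by (elim forms_SucE)
          then have "v \<in> forms k s (J i)" "w \<in> forms i t (J i)"
            using k[of s] forms_mono[OF Jk] IH Suc by auto
          then show "x \<in> forms i s (J i)"
            using forms_SucI x \<open>i = Suc k\<close> Suc by metis
        qed
      next
        show "forms i s (J i) \<subseteq> N i (Suc s)"
        proof
          fix x assume "x \<in> forms i s (J i)"
          then obtain v w where x: "x = v + f k * w" "v \<in> forms k s (J i)" "w \<in> forms i t (J i)"
            unfolding \<open>i = Suc k\<close> Suc by (elim forms_SucE)
          obtain a b where ab: "a \<in> forms k s (J k)" "b \<in> N k s" "v = a + f k * b"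
            using forms_adjoin[OF ideal_of_J seq_mem, of v k s k k] x(2) \<open>i = Suc k\<close> by auto
          have "b \<in> N i s" using forms_Suc_mono[OF ideal_of_self] ab(2) \<open>i = Suc k\<close> by blast
          moreover have "w \<in> N i s" using x(3) IH Suc by simp
          ultimately have "b + w \<in> N i s" using ideal_ofD(2)[OF ideal_of_N] by simp
          moreover have "a \<in> N k (Suc s)" using ab(1) k[of s] by simp
          moreover have "x = a + f k * (b + w)" using x ab by (simp add: algebra_simps)
          ultimately show "x \<in> N i (Suc s)" using forms_SucI \<open>i = Suc k\<close> by metis
        qed
      qed
    qed
  qed
qed

lemma N_antimono_Suc: "N i (Suc s) \<subseteq> N i s"
  unfolding N_Suc by (rule forms_mono[OF J_subset])

definition regular_at :: "nat \<Rightarrow> bool" where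
  "regular_at i \<longleftrightarrow> (\<forall>g\<in>S. f i * g \<in> J i \<longrightarrow> g \<in> J i)"

definition power_regular_at :: "nat \<Rightarrow> bool" where
  "power_regular_at i \<longleftrightarrow> (\<forall>s. \<forall>g\<in>S. f i * g \<in> N i s \<longrightarrow> g \<in> N i s)"

text \<open>
  The key step of Rees' proof of quasi-regularity: the splitting of a form along its last variable is
  unique up to coefficients in \<open>T\<close>. Two splittings differ by some \<open>d\<close> with \<open>f\<^sub>i d\<close> in the \<open>(s+1)\<close>-st power of
  the ideal of the previous elements; as \<open>f\<^sub>i\<close> is regular modulo this power, \<open>d\<close> lies in it too, so \<open>d\<close>
  is a form of degree \<open>s\<close> with coefficients in \<open>J i\<close> and \<open>f\<^sub>i d\<close> is one of degree \<open>s + 1\<close> with coefficients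
  in \<open>T\<close>.
\<close>

lemma forms_split:
  assumes reg: "power_regular_at i"
    and T: "ideal_of T" "J (Suc i) \<subseteq> T"
    and vw: "v \<in> N i (Suc s)" "w \<in> N (Suc i) s" "v + f i * w \<in> forms (Suc i) (Suc s) T"
  shows "v \<in> forms i (Suc s) T" "w \<in> forms (Suc i) s T"
proof -
  have TS: "T \<subseteq> S" using T(1) ideal_of_subset by blast
  obtain v' w' where v'w': "v + f i * w = v' + f i * w'" "v' \<in> forms i (Suc s) T" "w' \<in> forms (Suc i) s T"
    using vw(3) by (elim forms_SucE)
  have "v' \<in> N i (Suc s)" "w' \<in> N (Suc i) s"
    using v'w' forms_mono[OF TS] by blast+
  have "f i * (w' - w) = (v' + f i * w') - f i * w - v'" by (simp add: algebra_simps)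
  then have diff: "f i * (w' - w) = v - v'" by (simp add: v'w'(1)[symmetric])
  have "v - v' \<in> N i (Suc s)"
    using vw(1) \<open>v' \<in> N i (Suc s)\<close> by (intro ideal_of_diff[OF ideal_of_N])
  moreover have "w' - w \<in> S"
    using vw(2) \<open>w' \<in> N (Suc i) s\<close> N_subset diff_mem by blast
  ultimately have d: "w' - w \<in> N i (Suc s)"
    using reg unfolding power_regular_at_def diff[symmetric] by blast
  have "J i \<subseteq> T" using T(2) J_mono_Suc by blast
  then have "w' - w \<in> forms (Suc i) s T"
    using d forms_mono[of "J i" T] forms_Suc_mono[OF T(1)] unfolding N_Suc by blast
  then have "w' - (w' - w) \<in> forms (Suc i) s T"
    by (rule ideal_of_diff[OF ideal_of_forms[OF T(1)] v'w'(3)])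
  then show "w \<in> forms (Suc i) s T" by (simp only: diff_diff_eq2 add_diff_cancel_left')
  have "f i \<in> T" using T(2) seq_mem_J by blast
  then have "f i * (w' - w) \<in> forms i (Suc s) T"
    by (rule coefficient_mult_form[OF T(1) _ d])
  then have "v' + f i * (w' - w) \<in> forms i (Suc s) T"
    by (rule ideal_ofD(2)[OF ideal_of_forms[OF T(1)] v'w'(2)])
  then show "v \<in> forms i (Suc s) T" by (simp only: diff add_diff_cancel_left' diff_add_cancel add.commute[of v'])
qed

text \<open>
  A scalar \<open>x\<close> multiplies a form coefficientwise, so if \<open>x\<close> is regular modulo \<open>T\<close> it can be cancelled in
  each coefficient; \<open>forms_split\<close> reaches the coefficients one variable at a time.
\<close>

lemma cancel_regular_coefficient:
  assumes "\<And>j. j < i \<Longrightarrow> power_regular_at j"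
    and "ideal_of T" "J i \<subseteq> T" "x \<in> S" "\<And>g. g \<in> S \<Longrightarrow> x * g \<in> T \<Longrightarrow> g \<in> T"
    and "g \<in> N i s" "x * g \<in> forms i s T"
  shows "g \<in> forms i s T"
  using assms
proof (induction "i + s" arbitrary: i s g rule: less_induct)
  case less
  show ?case
  proof (cases s)
    case 0
    then show ?thesis using less.prems(5)[of g] less.prems(6,7) by simp
  next
    case (Suc t)
    show ?thesis
    proof (cases i)
      case 0
      then show ?thesis using less.prems(6) Suc by simp
    next
      case (Suc k)
      have Jk: "J k \<subseteq> T" "J (Suc k) \<subseteq> T" using less.prems(3) J_mono_Suc Suc by blast+
      obtain v w where g: "g = v + f k * w" "v \<in> N k (Suc t)" "w \<in> N (Suc k) t"
        using less.prems(6) unfolding \<open>i = Suc k\<close> \<open>s = Suc t\<close> by (elim forms_SucE)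
      have xg: "x * g = x * v + f k * (x * w)" by (simp add: g algebra_simps)
      have xv: "x * v \<in> N k (Suc t)" and xw: "x * w \<in> N (Suc k) t"
        using g less.prems(4) by (auto intro: ideal_ofD(3)[OF ideal_of_N] simp del: forms.simps)
      have mem: "x * v + f k * (x * w) \<in> forms (Suc k) (Suc t) T"
        using less.prems(7) xg \<open>i = Suc k\<close> \<open>s = Suc t\<close> by metis
      have rk: "power_regular_at k" using less.prems(1) Suc by simp
      have *: "x * v \<in> forms k (Suc t) T" "x * w \<in> forms (Suc k) t T"
        by (rule forms_split[OF rk less.prems(2) Jk(2) xv xw mem])+
      have "v \<in> forms k (Suc t) T"
        by (rule less.hyps[OF _ _ less.prems(2) Jk(1) less.prems(4) less.prems(5) g(2) *(1)])
          (use \<open>i = Suc k\<close> \<open>s = Suc t\<close> less.prems(1) in simp_all)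
      moreover have "w \<in> forms (Suc k) t T"
        by (rule less.hyps[OF _ _ less.prems(2) Jk(2) less.prems(4) less.prems(5) g(3) *(2)])
          (use \<open>i = Suc k\<close> \<open>s = Suc t\<close> less.prems(1) in simp_all)
      ultimately show ?thesis
        using forms_SucI g \<open>i = Suc k\<close> \<open>s = Suc t\<close> by metis
    qed
  qed
qed

text \<open>
  Regularity of \<open>f\<^sub>i\<close> modulo the ideal \<open>(f\<^sub>0,\<dots>,f\<^bsub>i-1\<^esub>) + L\<close> lifts to all powers: by \<open>N_Suc\<close> the next power consists of
  forms with coefficients in \<open>J i\<close>, and there \<open>f\<^sub>i\<close> can be cancelled as a scalar.
\<close>

lemma power_regular_at_if_regular:
  assumes "\<And>j. j \<le> i \<Longrightarrow> regular_at j"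
  shows "power_regular_at i"
  using assms
proof (induction i rule: less_induct)
  case (less i)
  have prev: "power_regular_at j" if "j < i" for j
    using less.IH[OF that] less.prems that by simp
  have "g \<in> N i s" if "g \<in> S" "f i * g \<in> N i s" for g s
    using that
  proof (induction s arbitrary: g)
    case (Suc s)
    have "f i * g \<in> N i s" using Suc.prems(2) N_antimono_Suc by blast
    then have g: "g \<in> N i s" by (rule Suc.IH[OF Suc.prems(1)])
    have fg: "f i * g \<in> forms i s (J i)" using Suc.prems(2) unfolding N_Suc .
    have "g \<in> forms i s (J i)"
    proof (rule cancel_regular_coefficient[OF prev ideal_of_J order_refl seq_mem _ g fg])
      show "h \<in> J i" if "h \<in> S" "f i * h \<in> J i" for h
        using less.prems[of i] that unfolding regular_at_def by blast
    qed
    then show ?case unfolding N_Suc .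
  qed simp
  then show ?case unfolding power_regular_at_def by blast
qed

end

section \<open>Polynomial relations\<close>

text \<open>
  An exponent list of length \<open>i\<close> stands for a monomial in \<open>f\<^sub>0,\<dots>,f\<^bsub>i-1\<^esub>\<close>. The head is the exponent of the
  last element \<open>f\<^bsub>i-1\<^esub>\<close>, so that recursion on the list removes the last variable.
\<close>

primrec monomial_value :: "(nat \<Rightarrow> 'a::comm_monoid_mult) \<Rightarrow> nat list \<Rightarrow> 'a" where
  "monomial_value f [] = 1"
| "monomial_value f (e # es) = f (length es) ^ e * monomial_value f es"

text \<open>
  A nonzero polynomial is \<open>X\<^sup>e (F\<^sub>0 + X F\<^sub>1)\<close> with \<open>X\<close> the last variable and \<open>F\<^sub>0\<close> a nonzero polynomial in
  the remaining ones. Here \<open>e\<close> is the least exponent of \<open>X\<close> that occurs.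
\<close>

lemma relation_split:
  fixes f :: "nat \<Rightarrow> 'a::comm_ring_1"
  assumes "finite M" "M \<noteq> {}" "\<And>m. m \<in> M \<Longrightarrow> length m = Suc i"
  obtains e where "{es. e # es \<in> M} \<noteq> {}"
    and "(\<Sum>m\<in>M. c m * monomial_value f m) =
      f i ^ e * ((\<Sum>es | e # es \<in> M. c (e # es) * monomial_value f es) +
        f i * (\<Sum>m | m \<in> M \<and> e < hd m. c m * monomial_value f ((hd m - Suc e) # tl m)))"
    and "\<And>m. m \<in> M \<Longrightarrow> e \<le> hd m"
proof -
  define e where "e = Min (hd ` M)"
  have e: "e \<le> hd m" if "m \<in> M" for m
    using that assms(1) by (simp add: e_def)
  have "e \<in> hd ` M" unfolding e_def using assms(1,2) by (intro Min_in) auto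
  then obtain m where m: "m \<in> M" "hd m = e" by blast
  have "m = e # tl m" using m assms(3)[of m] by (cases m) auto
  then have ne: "{es. e # es \<in> M} \<noteq> {}" using m by (metis empty_iff mem_Collect_eq)
  let ?A = "{m \<in> M. hd m = e}" and ?B = "{m \<in> M. e < hd m}"
  have A: "?A = (#) e ` {es. e # es \<in> M}"
  proof -
    have "x \<in> (#) e ` {es. e # es \<in> M}" if "x \<in> ?A" for x
      using that assms(3)[of x] by (cases x) auto
    then show ?thesis by auto
  qed
  have "(\<Sum>m\<in>M. c m * monomial_value f m) = (\<Sum>m\<in>?A. c m * monomial_value f m) + (\<Sum>m\<in>?B. c m * monomial_value f m)"
    using assms(1) e by (subst sum.union_disjoint[symmetric]) (auto intro!: sum.cong simp: order.strict_iff_order)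
  also have "(\<Sum>m\<in>?A. c m * monomial_value f m) = (\<Sum>es | e # es \<in> M. c (e # es) * monomial_value f (e # es))"
    unfolding A by (subst sum.reindex) (auto simp: inj_on_def)
  also have "\<dots> = (\<Sum>es | e # es \<in> M. f i ^ e * (c (e # es) * monomial_value f es))"
    using assms(3) by (intro sum.cong) (force simp: mult_ac)+
  also have "(\<Sum>m\<in>?B. c m * monomial_value f m) =
    (\<Sum>m\<in>?B. f i ^ e * (f i * (c m * monomial_value f ((hd m - Suc e) # tl m))))"
  proof (intro sum.cong refl)
    fix m assume m: "m \<in> ?B"
    then obtain h es where [simp]: "m = h # es" using assms(3)[of m] by (cases m) auto
    have h: "h = e + Suc (h - Suc e)" using m by simp
    have [simp]: "length es = i" using m assms(3)[of m] by simp
    have "f i ^ h = f i ^ e * (f i * f i ^ (h - Suc e))"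
      by (subst h) (simp add: power_add)
    then show "c m * monomial_value f m = f i ^ e * (f i * (c m * monomial_value f ((hd m - Suc e) # tl m)))"
      by (simp add: mult_ac)
  qed
  finally show thesis
    using that[OF ne _ e] by (simp add: sum_distrib_left distrib_left)
qed

section \<open>Annihilators of polynomial relations between the elements of a regular sequence\<close>

context element_sequence
begin

lemma monomial_value_mem: "monomial_value f es \<in> S"
  by (induction es) (auto simp: one_mem mult_mem power_mem seq_mem)

lemma monomial_value_mem_N: "monomial_value f es \<in> N (length es) (sum_list es)"
proof (induction es)
  case (Cons e es)
  have "f (length es) ^ e * monomial_value f es \<in> N (Suc (length es)) (e + sum_list es)"
  proof (induction e)
    case 0
    then show ?case using Cons.IH forms_Suc_mono[OF ideal_of_self] by auto
  next
    case (Suc e)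
    then show ?case
      using seq_mult_forms[OF ideal_of_self] by (simp add: mult.assoc del: forms.simps)
  qed
  then show ?case by (simp del: forms.simps)
qed (simp add: one_mem)

text \<open>
  The initial form of \<open>z\<close> has degree \<open>t\<close> and is a nonzerodivisor on the associated graded ring, uniformly
  in the ideal \<open>T\<close> of coefficients that are divided out.
\<close>

definition cancels :: "nat \<Rightarrow> nat \<Rightarrow> 'a \<Rightarrow> bool" where
  "cancels i t z \<longleftrightarrow> z \<in> N i t \<and>
    (\<forall>s T u. ideal_of T \<longrightarrow> J i \<subseteq> T \<longrightarrow> u \<in> N i s \<longrightarrow> z * u \<in> forms i (s + t) T \<longrightarrow> u \<in> forms i s T)"

lemma cancelsD:
  assumes "cancels i t z"
  shows "z \<in> N i t"
    "ideal_of T \<Longrightarrow> J i \<subseteq> T \<Longrightarrow> u \<in> N i s \<Longrightarrow> z * u \<in> forms i (s + t) T \<Longrightarrow> u \<in> forms i s T"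
  using assms unfolding cancels_def by blast+

lemma cancels_unit:
  assumes "c \<in> S" "d \<in> S" "d * c = 1"
  shows "cancels i 0 c"
  unfolding cancels_def
proof (intro conjI allI impI)
  fix s T u assume "ideal_of T" "c * u \<in> forms i (s + 0) T"
  then have "d * (c * u) \<in> forms i s T" using ideal_ofD(3)[OF ideal_of_forms] assms(2) by simp
  then show "u \<in> forms i s T" using assms(3) by (simp add: mult.assoc[symmetric])
qed (simp add: assms(1))

lemma cancels_add_higher:
  assumes "cancels i t z" "y \<in> N i (Suc t)"
  shows "cancels i t (z + y)"
  unfolding cancels_def
proof (intro conjI allI impI)
  show "z + y \<in> N i t"
    using cancelsD(1)[OF assms(1)] assms(2) N_antimono_Suc by (blast intro: ideal_ofD(2)[OF ideal_of_N])
  fix s T u assume T: "ideal_of T" "J i \<subseteq> T" and u: "u \<in> N i s" "(z + y) * u \<in> forms i (s + t) T"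
  have "y * u \<in> N i (Suc (s + t))"
    using form_mult_form[OF ideal_of_self base_subset assms(2) u(1)] by (simp add: add.commute)
  then have "y * u \<in> forms i (s + t) T" unfolding N_Suc using forms_mono[OF T(2)] by blast
  then have "(z + y) * u - y * u \<in> forms i (s + t) T"
    by (rule ideal_of_diff[OF ideal_of_forms[OF T(1)] u(2)])
  then have "z * u \<in> forms i (s + t) T" by (simp add: distrib_right)
  then show "u \<in> forms i s T" using cancelsD(2)[OF assms(1) T u(1)] by blast
qed

lemma forms_cancel_seq:
  assumes "power_regular_at i" "ideal_of T" "J (Suc i) \<subseteq> T" "u \<in> N (Suc i) s"
    and "f i * u \<in> forms (Suc i) (Suc s) T"
  shows "u \<in> forms (Suc i) s T"
  using forms_split(2)[OF assms(1-3) ideal_ofD(1)[OF ideal_of_N] assms(4)] assms(5) by simp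

lemma cancels_seq_mult:
  assumes "power_regular_at i" "cancels (Suc i) t z"
  shows "cancels (Suc i) (Suc t) (f i * z)"
  unfolding cancels_def
proof (intro conjI allI impI)
  show "f i * z \<in> N (Suc i) (Suc t)"
    by (rule seq_mult_forms[OF ideal_of_self cancelsD(1)[OF assms(2)]])
  fix s T u assume T: "ideal_of T" "J (Suc i) \<subseteq> T" and u: "u \<in> N (Suc i) s"
    and fzu: "f i * z * u \<in> forms (Suc i) (s + Suc t) T"
  have "z * u \<in> N (Suc i) (s + t)"
    using form_mult_form[OF ideal_of_self base_subset cancelsD(1)[OF assms(2)] u] by (simp add: add.commute)
  moreover have "f i * (z * u) \<in> forms (Suc i) (Suc (s + t)) T" using fzu by (simp add: mult.assoc)
  ultimately have "z * u \<in> forms (Suc i) (s + t) T" by (rule forms_cancel_seq[OF assms(1) T])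
  then show "u \<in> forms (Suc i) s T" by (rule cancelsD(2)[OF assms(2) T u])
qed

lemma cancels_seq_power_mult:
  assumes "power_regular_at i" "cancels (Suc i) t z"
  shows "cancels (Suc i) (t + e) (f i ^ e * z)"
proof (induction e)
  case (Suc e)
  then show ?case using cancels_seq_mult[OF assms(1) Suc] by (simp add: mult.assoc)
qed (simp add: assms(2))

text \<open>
  A polynomial in the last variable with a cancellable constant term is cancellable. Comparing the parts free of \<open>f\<^sub>i\<close> first
  shows that the part \<open>v\<close> of \<open>u\<close> free of \<open>f\<^sub>i\<close> has coefficients in \<open>T\<close>; after subtracting it, a factor \<open>f\<^sub>i\<close>
  cancels and the degree of the remaining part \<open>w\<close> is smaller.
\<close>

lemma cancels_add_seq_mult:
  assumes reg: "power_regular_at i" and z: "cancels i t z"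
    and y: "y \<in> S" "t = 0 \<Longrightarrow> y = 0" "\<And>t'. t = Suc t' \<Longrightarrow> y \<in> N (Suc i) t'"
  shows "cancels (Suc i) t (z + f i * y)"
proof -
  have zN: "z \<in> N i t" by (rule cancelsD(1)[OF z])
  have zN': "z \<in> N (Suc i) t" using zN forms_Suc_mono[OF ideal_of_self] by blast
  have fy: "f i * y \<in> N (Suc i) t"
  proof (cases t)
    case (Suc t')
    then show ?thesis using seq_mult_forms[OF ideal_of_self y(3)] by simp
  qed (use y(1) seq_mem mult_mem in simp)
  have zy: "z + f i * y \<in> N (Suc i) t"
    by (rule ideal_ofD(2)[OF ideal_of_N zN' fy])
  have "u \<in> forms (Suc i) s T"
    if T: "ideal_of T" "J (Suc i) \<subseteq> T" and u: "u \<in> N (Suc i) s"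
      and zyu: "(z + f i * y) * u \<in> forms (Suc i) (s + t) T" for s T u
    using u zyu
  proof (induction s arbitrary: u)
    case 0
    have JT: "J i \<subseteq> T" using T(2) J_mono_Suc by blast
    have uS: "u \<in> S" using 0 by simp
    have "z * u \<in> forms i t T"
    proof (cases t)
      case 0
      then show ?thesis using y(2) \<open>(z + f i * y) * u \<in> forms (Suc i) (0 + t) T\<close> by simp
    next
      case (Suc t')
      have "z * u \<in> N i (Suc t')" using ideal_ofD(4)[OF ideal_of_N uS zN] Suc by simp
      moreover have "y * u \<in> N (Suc i) t'" using ideal_ofD(4)[OF ideal_of_N uS y(3)[OF Suc]] .
      moreover have "z * u + f i * (y * u) \<in> forms (Suc i) (Suc t') T"
        using 0(2) Suc by (simp add: distrib_right mult.assoc del: forms.simps)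
      ultimately show ?thesis using forms_split(1)[OF reg T] Suc by metis
    qed
    then show ?case using cancelsD(2)[OF z T(1) JT, of u 0] uS by simp
  next
    case (Suc s)
    have JT: "J i \<subseteq> T" using T(2) J_mono_Suc by blast
    obtain v w where u: "u = v + f i * w" "v \<in> N i (Suc s)" "w \<in> N (Suc i) s"
      using Suc.prems(1) by (elim forms_SucE)
    have uN: "u \<in> N (Suc i) (Suc s)" by (rule Suc.prems(1))
    have zv: "z * v \<in> N i (Suc (s + t))"
      using form_mult_form[OF ideal_of_self base_subset zN u(2)] by (simp add: add.commute)
    have zw: "z * w \<in> N (Suc i) (s + t)"
      using form_mult_form[OF ideal_of_self base_subset zN' u(3)] by (simp add: add.commute)
    have yu: "y * u \<in> N (Suc i) (s + t)"
    proof (cases t)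
      case 0
      then show ?thesis using y(2) ideal_ofD(1)[OF ideal_of_N] by simp
    next
      case (Suc t')
      then show ?thesis
        using form_mult_form[OF ideal_of_self base_subset y(3)[OF Suc] uN] by (simp add: add.commute)
    qed
    have "z * v + f i * (z * w + y * u) = (z + f i * y) * u" by (simp add: u algebra_simps)
    then have mem: "z * v + f i * (z * w + y * u) \<in> forms (Suc i) (Suc (s + t)) T"
      using Suc.prems(2) by simp
    have "z * v \<in> forms i (Suc (s + t)) T"
      by (rule forms_split(1)[OF reg T zv ideal_ofD(2)[OF ideal_of_N zw yu] mem])
    then have v: "v \<in> forms i (Suc s) T"
      using cancelsD(2)[OF z T(1) JT u(2)] by simp
    then have "v \<in> forms (Suc i) (Suc s) T" using forms_Suc_mono[OF T(1)] by blast
    then have "(z + f i * y) * v \<in> forms (Suc i) (t + Suc s) T"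
      using form_mult_form[OF T(1) _ zy] T(2) base_subset_J by blast
    then have "(z + f i * y) * u - (z + f i * y) * v \<in> forms (Suc i) (Suc s + t) T"
      using ideal_of_diff[OF ideal_of_forms[OF T(1)] Suc.prems(2)] by (simp add: add.commute)
    moreover have "(z + f i * y) * u - (z + f i * y) * v = f i * ((z + f i * y) * w)"
      by (simp add: u algebra_simps)
    ultimately have fzw: "f i * ((z + f i * y) * w) \<in> forms (Suc i) (Suc (s + t)) T" by simp
    have zyw: "(z + f i * y) * w \<in> N (Suc i) (s + t)"
      using form_mult_form[OF ideal_of_self base_subset zy u(3)] by (simp add: add.commute)
    have "(z + f i * y) * w \<in> forms (Suc i) (s + t) T"
      by (rule forms_cancel_seq[OF reg T zyw fzw])
    then have "w \<in> forms (Suc i) s T" by (rule Suc.IH[OF u(3)])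
    then show ?case using forms_SucI[OF v] u(1) by simp
  qed
  then show ?thesis unfolding cancels_def using zy by blast
qed

text \<open>
  A nonzero form with unit coefficients is cancellable: by \<open>relation_split\<close> it is built from a unit by
  the operations \<open>cancels_add_seq_mult\<close> and \<open>cancels_seq_power_mult\<close>.
\<close>

lemma cancels_homogeneous:
  assumes "\<And>j. j < i \<Longrightarrow> power_regular_at j"
    and "finite M" "M \<noteq> {}" "\<And>m. m \<in> M \<Longrightarrow> length m = i \<and> sum_list m = t"
    and "\<And>m. m \<in> M \<Longrightarrow> c m \<in> S \<and> (\<exists>d\<in>S. d * c m = 1)"
  shows "cancels i t (\<Sum>m\<in>M. c m * monomial_value f m)"
  using assms
proof (induction i arbitrary: M c t)
  case 0
  have "M = {[]}" using 0(3,4) by fastforce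
  moreover have "t = 0" using 0(3,4) \<open>M = {[]}\<close> by force
  ultimately show ?case using 0(5) by (auto intro: cancels_unit)
next
  case (Suc i)
  have len: "length m = Suc i" "sum_list m = t" if "m \<in> M" for m using Suc.prems(4) that by auto
  obtain e where ne: "{es. e # es \<in> M} \<noteq> {}"
    and eq: "(\<Sum>m\<in>M. c m * monomial_value f m) =
      f i ^ e * ((\<Sum>es | e # es \<in> M. c (e # es) * monomial_value f es) +
        f i * (\<Sum>m | m \<in> M \<and> e < hd m. c m * monomial_value f ((hd m - Suc e) # tl m)))"
    and e_le: "\<And>m. m \<in> M \<Longrightarrow> e \<le> hd m"
    using relation_split[OF Suc.prems(2,3) len(1)] by blast
  have reg: "power_regular_at i" using Suc.prems(1) by simp
  have et: "e \<le> t" using ne len by fastforce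
  let ?y = "\<Sum>m | m \<in> M \<and> e < hd m. c m * monomial_value f ((hd m - Suc e) # tl m)"
  have lead: "cancels i (t - e) (\<Sum>es | e # es \<in> M. c (e # es) * monomial_value f es)"
  proof (rule Suc.IH)
    have "finite ((#) e -` M)" using Suc.prems(2) by (intro finite_vimageI) auto
    then show "finite {es. e # es \<in> M}" by (simp add: vimage_def)
    show "length m = i \<and> sum_list m = t - e" if "m \<in> {es. e # es \<in> M}" for m
      using len[of "e # m"] that by auto
  qed (use Suc.prems(1,5) ne in auto)
  have y: "?y \<in> N (Suc i) t'" if "t - e = Suc t'" for t'
  proof (rule ideal_of_sum[OF ideal_of_N])
    fix m assume "m \<in> {m. m \<in> M \<and> e < hd m}"
    then obtain h es where m: "m = h # es" "e < h" "m \<in> M" using len(1)[of m] by (cases m) auto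
    then have "length es = i" "h - Suc e + sum_list es = t'" using len[of m] that by auto
    then have "monomial_value f ((h - Suc e) # es) \<in> N (Suc i) t'"
      using monomial_value_mem_N[of "(h - Suc e) # es"] by (simp del: forms.simps monomial_value.simps)
    then show "c m * monomial_value f ((hd m - Suc e) # tl m) \<in> N (Suc i) t'"
      using ideal_ofD(3)[OF ideal_of_N] Suc.prems(5)[OF m(3)] m(1) by simp
  qed
  have y0: "?y = 0" if "t - e = 0"
  proof (rule sum.neutral, intro ballI)
    fix m assume "m \<in> {m. m \<in> M \<and> e < hd m}"
    then obtain h es where "m = h # es" "e < h" "m \<in> M" using len(1)[of m] by (cases m) auto
    then show "c m * monomial_value f ((hd m - Suc e) # tl m) = 0" using len(2)[of m] that by simp
  qed
  have "?y \<in> S"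
    using Suc.prems(5) by (auto intro!: sum_mem mult_mem monomial_value_mem simp del: monomial_value.simps)
  then have "cancels (Suc i) (t - e) ((\<Sum>es | e # es \<in> M. c (e # es) * monomial_value f es) + f i * ?y)"
    by (rule cancels_add_seq_mult[OF reg lead]) (fact y0 y)+
  from cancels_seq_power_mult[OF reg this, of e] show ?case
    using eq et by simp
qed

text \<open>
  An element that is killed by a nonzero polynomial in a regular sequence lies in all powers of the
  ideal of the sequence: the lowest homogeneous part of the polynomial is cancellable, which raises
  the order of \<open>u\<close> by one at a time.
\<close>

lemma annihilator_of_relation:
  assumes reg: "\<And>j. j < r \<Longrightarrow> regular_at j"
    and M: "finite M" "M \<noteq> {}" "\<And>m. m \<in> M \<Longrightarrow> length m = r"
    and c: "\<And>m. m \<in> M \<Longrightarrow> c m \<in> S \<and> (\<exists>d\<in>S. d * c m = 1)"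
    and u: "u \<in> S" "(\<Sum>m\<in>M. c m * monomial_value f m) * u \<in> L"
  shows "u \<in> N r s"
proof -
  have preg: "power_regular_at j" if "j < r" for j
    using reg that by (intro power_regular_at_if_regular) auto
  define t where "t = Min (sum_list ` M)"
  have "t \<in> sum_list ` M" unfolding t_def using M by (intro Min_in) auto
  then have ne: "{m \<in> M. sum_list m = t} \<noteq> {}" by auto
  have low: "cancels r t (\<Sum>m | m \<in> M \<and> sum_list m = t. c m * monomial_value f m)"
    by (rule cancels_homogeneous) (use preg M ne c in auto)
  \<comment> \<open>the parts of higher degree do not affect the initial form\<close>
  have high: "(\<Sum>m | m \<in> M \<and> sum_list m \<noteq> t. c m * monomial_value f m) \<in> N r (Suc t)"
  proof (rule ideal_of_sum[OF ideal_of_N])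
    fix m assume m: "m \<in> {m. m \<in> M \<and> sum_list m \<noteq> t}"
    then have "t \<le> sum_list m" unfolding t_def using M by auto
    then have "Suc t \<le> sum_list m" using m by simp
    then have "N r (sum_list m) \<subseteq> N r (Suc t)"
      by (rule lift_Suc_antimono_le[of "N r", OF N_antimono_Suc])
    then have "monomial_value f m \<in> N r (Suc t)" using monomial_value_mem_N[of m] M(3)[of m] m by auto
    then show "c m * monomial_value f m \<in> N r (Suc t)" using ideal_ofD(3)[OF ideal_of_N] c m by blast
  qed
  have "(\<Sum>m\<in>M. c m * monomial_value f m) =
    (\<Sum>m | m \<in> M \<and> sum_list m = t. c m * monomial_value f m) + (\<Sum>m | m \<in> M \<and> sum_list m \<noteq> t. c m * monomial_value f m)"
    using M(1) by (subst sum.union_disjoint[symmetric]) (auto intro!: sum.cong)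
  then have z: "cancels r t (\<Sum>m\<in>M. c m * monomial_value f m)"
    using cancels_add_higher[OF low high] by simp
  show ?thesis
  proof (induction s)
    case (Suc s)
    have "L \<subseteq> forms r (s + t) (J r)" by (rule base_subset_forms[OF base_subset_J])
    then have "u \<in> forms r s (J r)"
      using cancelsD(2)[OF z ideal_of_J order_refl Suc] u(2) by blast
    then show ?case unfolding N_Suc .
  qed (simp add: u(1))
qed

end

section \<open>Polynomial relations and chains of primes\<close>

context unital_subring
begin

definition prime_of :: "'a set \<Rightarrow> bool" where
  "prime_of P \<longleftrightarrow> ideal_of P \<and> 1 \<notin> P \<and> (\<forall>x\<in>S. \<forall>y\<in>S. x * y \<in> P \<longrightarrow> x \<in> P \<or> y \<in> P)"

lemma prime_of_power:
  "prime_of P \<Longrightarrow> x \<in> S \<Longrightarrow> x ^ e \<in> P \<Longrightarrow> x \<in> P"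
proof (induction e)
  case (Suc e)
  then have "x \<in> P \<or> x ^ e \<in> P" unfolding prime_of_def using power_mem by auto
  then show ?case using Suc by auto
qed (auto simp: prime_of_def)

text \<open>
  Elements chosen from the differences of a chain of primes are algebraically independent modulo the
  smallest one. In \<open>f\<^bsub>i\<^esub>\<^sup>e (F\<^sub>0 + f\<^bsub>i\<^esub> F\<^sub>1)\<close> the power of \<open>f\<^bsub>i\<^esub>\<close> lies outside the prime \<open>Q (i + 1)\<close>, and the
  summand with \<open>F\<^sub>1\<close> vanishes modulo the larger prime \<open>Q i\<close>, so \<open>F\<^sub>0\<close> would lie in \<open>Q i\<close>. The chain is
  indexed downwards because \<open>relation_split\<close> removes the last variable first.
\<close>

lemma relation_not_in_prime_chain:
  assumes Q: "\<And>j. j \<le> i \<Longrightarrow> prime_of (Q j)" "\<And>j. j < i \<Longrightarrow> Q (Suc j) \<subseteq> Q j"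
    and f: "\<And>j. f j \<in> S" "\<And>j. j < i \<Longrightarrow> f j \<in> Q j" "\<And>j. j < i \<Longrightarrow> f j \<notin> Q (Suc j)"
    and M: "finite M" "M \<noteq> {}" "\<And>m. m \<in> M \<Longrightarrow> length m = i"
    and c: "\<And>m. m \<in> M \<Longrightarrow> c m \<in> S \<and> (\<exists>d\<in>S. d * c m = 1)"
  shows "(\<Sum>m\<in>M. c m * monomial_value f m) \<notin> Q i"
  using assms
proof (induction i arbitrary: M c)
  case 0
  have "m = []" if "m \<in> M" for m using 0(8)[OF that] by simp
  then have "M = {[]}" using 0(7) by blast
  obtain d where d: "d \<in> S" "d * c [] = 1" using 0(9)[of "[]"] \<open>M = {[]}\<close> by blast
  have Q: "ideal_of (Q 0)" "1 \<notin> Q 0" using 0(1)[of 0] unfolding prime_of_def by simp_all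
  have "c [] \<notin> Q 0" using ideal_ofD(3)[OF Q(1) d(1), of "c []"] d(2) Q(2) by auto
  then show ?case using \<open>M = {[]}\<close> by simp
next
  case (Suc i)
  have len: "length m = Suc i" if "m \<in> M" for m using Suc.prems(8) that by auto
  obtain e where ne: "{es. e # es \<in> M} \<noteq> {}"
    and eq: "(\<Sum>m\<in>M. c m * monomial_value f m) =
      f i ^ e * ((\<Sum>es | e # es \<in> M. c (e # es) * monomial_value f es) +
        f i * (\<Sum>m | m \<in> M \<and> e < hd m. c m * monomial_value f ((hd m - Suc e) # tl m)))"
    by (rule relation_split[OF Suc.prems(6,7) len, where f = f and c = c])
  let ?x = "\<Sum>es | e # es \<in> M. c (e # es) * monomial_value f es"
  let ?y = "\<Sum>m | m \<in> M \<and> e < hd m. c m * monomial_value f ((hd m - Suc e) # tl m)"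
  have mv: "monomial_value f es \<in> S" for es
    by (induction es) (auto simp: one_mem mult_mem power_mem Suc.prems(3))
  have x: "?x \<in> S" using Suc.prems(9) by (auto intro!: sum_mem mult_mem mv)
  have y: "?y \<in> S" using Suc.prems(9) by (auto intro!: sum_mem mult_mem mv simp del: monomial_value.simps)
  have lead: "?x \<notin> Q i"
  proof (rule Suc.IH)
    have "finite ((#) e -` M)" using Suc.prems(6) by (intro finite_vimageI) auto
    then show "finite {es. e # es \<in> M}" by (simp add: vimage_def)
    show "length m = i" if "m \<in> {es. e # es \<in> M}" for m
      using len[of "e # m"] that by auto
    show "c (e # m) \<in> S \<and> (\<exists>d\<in>S. d * c (e # m) = 1)" if "m \<in> {es. e # es \<in> M}" for m
      using Suc.prems(9) that by simp
  qed (use ne in \<open>simp_all add: Suc.prems(1-5)\<close>)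
  have prime: "prime_of (Q (Suc i))" "ideal_of (Q i)"
    using Suc.prems(1) unfolding prime_of_def by auto
  show ?case
  proof
    assume "(\<Sum>m\<in>M. c m * monomial_value f m) \<in> Q (Suc i)"
    then have "f i ^ e * (?x + f i * ?y) \<in> Q (Suc i)" using eq by simp
    moreover have "f i ^ e \<notin> Q (Suc i)"
      using prime_of_power[OF prime(1)] Suc.prems(3) Suc.prems(5)[of i] by blast
    moreover have "?x + f i * ?y \<in> S" using x y Suc.prems(3) by (intro add_mem mult_mem)
    ultimately have "?x + f i * ?y \<in> Q (Suc i)"
      using prime(1) power_mem[OF Suc.prems(3)] unfolding prime_of_def by blast
    then have "?x + f i * ?y \<in> Q i" using Suc.prems(2)[of i] by blast
    moreover have "f i * ?y \<in> Q i" using ideal_ofD(4)[OF prime(2) y] Suc.prems(4) by simp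
    ultimately have "?x + f i * ?y - f i * ?y \<in> Q i" by (rule ideal_of_diff[OF prime(2)])
    then show False using lead by simp
  qed
qed

end

section \<open>Polynomials supported on a set of variables\<close>

definition polys_in :: "nat set \<Rightarrow> 'k::field mpoly set" where
  "polys_in A = {p. \<forall>m \<in> Poly_Mapping.keys p. Poly_Mapping.keys m \<subseteq> A}"

abbreviation Mon :: "(nat \<Rightarrow>\<^sub>0 nat) \<Rightarrow> 'k::field \<Rightarrow> 'k mpoly" where
  "Mon m c \<equiv> Poly_Mapping.single m c"

abbreviation Const :: "'k::field \<Rightarrow> 'k mpoly" where
  "Const c \<equiv> Mon 0 c"

lemma keys_add_nat: "Poly_Mapping.keys (m + m') = Poly_Mapping.keys m \<union> Poly_Mapping.keys (m' :: nat \<Rightarrow>\<^sub>0 nat)"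
  by (auto simp: in_keys_iff lookup_add)

lemma sum_monom: "p = (\<Sum>m\<in>Poly_Mapping.keys p. Mon m (Poly_Mapping.lookup p m))"
  by (rule poly_mapping_eqI) (auto simp: lookup_sum lookup_single when_def in_keys_iff)

lemma keys_mult_obtain:
  assumes "m \<in> Poly_Mapping.keys (p * q)"
  obtains a b where "m = a + b" "a \<in> Poly_Mapping.keys p" "b \<in> Poly_Mapping.keys q"
  using assms keys_mult[of p q] by auto

lemma constant_mult: "Const (a * b) = Const a * Const b"
  by (simp add: mult_single)

lemma unital_subring_polys_in: "unital_subring (polys_in A :: 'k::field mpoly set)"
proof
  show "- 1 \<in> (polys_in A :: 'k mpoly set)"
    by (simp add: polys_in_def)
next
  fix x y :: "'k mpoly" assume xy: "x \<in> polys_in A" "y \<in> polys_in A"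
  show "x + y \<in> polys_in A" using xy keys_add[of x y] by (auto simp: polys_in_def)
  have "Poly_Mapping.keys m \<subseteq> A" if m: "m \<in> Poly_Mapping.keys (x * y)" for m
  proof -
    obtain a b where "m = a + b" "a \<in> Poly_Mapping.keys x" "b \<in> Poly_Mapping.keys y"
      by (rule keys_mult_obtain[OF m])
    then show ?thesis using xy by (simp add: polys_in_def keys_add_nat)
  qed
  then show "x * y \<in> polys_in A" by (simp add: polys_in_def)
qed (simp add: polys_in_def)

interpretation polys: unital_subring "polys_in A :: 'k::field mpoly set" for A
  by (rule unital_subring_polys_in)

lemma constant_mem: "Const c \<in> polys_in A"
  by (simp add: polys_in_def)

lemma variable_mem: "v \<in> A \<Longrightarrow> variable v \<in> polys_in A"
  by (simp add: polys_in_def variable_def)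

lemma monom_eq_prod:
  fixes c :: "'k::field"
  shows "Mon m c = Const c * (\<Prod>v\<in>Poly_Mapping.keys m. variable v ^ Poly_Mapping.lookup m v)"
proof -
  have pow: "variable v ^ k = Mon (Poly_Mapping.single v k) (1::'k)" for v k
    by (induction k) (simp_all add: variable_def mult_single single_add[symmetric])
  have "(\<Prod>v\<in>B. variable v ^ Poly_Mapping.lookup m v) =
    Mon (\<Sum>v\<in>B. Poly_Mapping.single v (Poly_Mapping.lookup m v)) (1::'k)" if "finite B" for B
    using that by (induction B) (simp_all add: pow mult_single)
  moreover have "(\<Sum>v\<in>Poly_Mapping.keys m. Poly_Mapping.single v (Poly_Mapping.lookup m v)) = m"
    by (rule poly_mapping_eqI) (auto simp: lookup_sum lookup_single when_def in_keys_iff)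
  ultimately show ?thesis by (simp add: mult_single)
qed

lemma polys_in_induct [consumes 1, case_names Const Var add mult]:
  fixes p :: "'k::field mpoly"
  assumes "p \<in> polys_in A"
    and const: "\<And>c. P (Const c)" and var: "\<And>v. v \<in> A \<Longrightarrow> P (variable v)"
    and add: "\<And>p q. p \<in> polys_in A \<Longrightarrow> q \<in> polys_in A \<Longrightarrow> P p \<Longrightarrow> P q \<Longrightarrow> P (p + q)"
    and mult: "\<And>p q. p \<in> polys_in A \<Longrightarrow> q \<in> polys_in A \<Longrightarrow> P p \<Longrightarrow> P q \<Longrightarrow> P (p * q)"
  shows "P p"
proof -
  define Q where "Q p \<longleftrightarrow> p \<in> polys_in A \<and> P p" for p
  have Q_mult: "Q (p * q)" if "Q p" "Q q" for p q
    using that mult polys.mult_mem unfolding Q_def by blast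
  have Q_add: "Q (p + q)" if "Q p" "Q q" for p q
    using that add polys.add_mem unfolding Q_def by blast
  have Q_const: "Q (Const c)" for c using const constant_mem unfolding Q_def by blast
  have Q_one: "Q 1" and Q_zero: "Q 0" using Q_const[of 1] Q_const[of 0] by simp_all
  have pow: "Q (variable v ^ k)" if "v \<in> A" for v k
  proof (induction k)
    case (Suc k)
    have "Q (variable v)" using that variable_mem var unfolding Q_def by blast
    then show ?case using Suc by (simp add: Q_mult)
  qed (simp add: Q_one)
  have prod: "Q (\<Prod>v\<in>B. variable v ^ k v)" if "finite B" "B \<subseteq> A" for B k
    using that by (induction B) (simp_all add: Q_one Q_mult pow)
  have mon: "Q (Mon m c)" if "Poly_Mapping.keys m \<subseteq> A" for m c
    unfolding monom_eq_prod[of m c] by (intro Q_mult Q_const prod finite_keys that)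
  have "Q (\<Sum>m\<in>B. Mon m (h m))"
    if "finite B" "\<And>m. m \<in> B \<Longrightarrow> Poly_Mapping.keys m \<subseteq> A" for B h
    using that by (induction B) (simp_all add: Q_zero Q_add mon)
  then have "Q (\<Sum>m\<in>Poly_Mapping.keys p. Mon m (Poly_Mapping.lookup p m))"
    using assms(1) unfolding polys_in_def by simp
  then have "Q p" by (simp only: sum_monom[symmetric])
  then show ?thesis by (simp add: Q_def)
qed

subsection \<open>Substitution\<close>

text \<open>
  The universal property of the polynomial ring: \<open>subst \<sigma>\<close> is the \<open>K\<close>-algebra homomorphism that sends
  the variable \<open>v\<close> to \<open>\<sigma> v\<close>.
\<close>

definition subst_monom :: "(nat \<Rightarrow> 'k::field mpoly) \<Rightarrow> (nat \<Rightarrow>\<^sub>0 nat) \<Rightarrow> 'k mpoly" where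
  "subst_monom \<sigma> m = (\<Prod>v\<in>Poly_Mapping.keys m. \<sigma> v ^ Poly_Mapping.lookup m v)"

definition subst :: "(nat \<Rightarrow> 'k::field mpoly) \<Rightarrow> 'k mpoly \<Rightarrow> 'k mpoly" where
  "subst \<sigma> p = (\<Sum>m\<in>Poly_Mapping.keys p. Const (Poly_Mapping.lookup p m) * subst_monom \<sigma> m)"

lemma subst_monom_add: "subst_monom \<sigma> (m + m') = subst_monom \<sigma> m * subst_monom \<sigma> m'"
proof -
  have super: "subst_monom \<sigma> k = (\<Prod>v\<in>B. \<sigma> v ^ Poly_Mapping.lookup k v)"
    if "finite B" "Poly_Mapping.keys k \<subseteq> B" for k B
    unfolding subst_monom_def using that by (intro prod.mono_neutral_left) (auto simp: in_keys_iff)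
  let ?B = "Poly_Mapping.keys m \<union> Poly_Mapping.keys m'"
  show ?thesis
    using super[of ?B "m + m'"] super[of ?B m] super[of ?B m']
    by (simp add: keys_add_nat lookup_add power_add prod.distrib)
qed

lemma subst_superset:
  assumes "finite B" "Poly_Mapping.keys p \<subseteq> B"
  shows "subst \<sigma> p = (\<Sum>m\<in>B. Const (Poly_Mapping.lookup p m) * subst_monom \<sigma> m)"
  unfolding subst_def using assms by (intro sum.mono_neutral_left) (auto simp: in_keys_iff)

lemma subst_add: "subst \<sigma> (p + q) = subst \<sigma> p + subst \<sigma> q"
proof -
  let ?B = "Poly_Mapping.keys p \<union> Poly_Mapping.keys q"
  show ?thesis
    using subst_superset[of ?B p \<sigma>] subst_superset[of ?B q \<sigma>] subst_superset[of ?B "p + q" \<sigma>] keys_add[of p q]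
    by (simp add: lookup_add single_add distrib_right sum.distrib)
qed

lemma subst_zero [simp]: "subst \<sigma> 0 = 0"
  by (simp add: subst_def)

lemma subst_sum: "subst \<sigma> (sum h A) = (\<Sum>x\<in>A. subst \<sigma> (h x))"
  by (induction A rule: infinite_finite_induct) (auto simp: subst_add)

lemma subst_monom_eq: "subst \<sigma> (Mon m c) = Const c * subst_monom \<sigma> m"
  by (cases "c = 0") (auto simp: subst_def)

lemma subst_mult: "subst \<sigma> (p * q) = subst \<sigma> p * subst \<sigma> q"
proof -
  let ?p = "\<lambda>m. Mon m (Poly_Mapping.lookup p m)" and ?q = "\<lambda>m. Mon m (Poly_Mapping.lookup q m)"
  have "subst \<sigma> (p * q) = subst \<sigma> ((\<Sum>m\<in>Poly_Mapping.keys p. ?p m) * (\<Sum>m\<in>Poly_Mapping.keys q. ?q m))"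
    by (simp only: sum_monom[symmetric])
  also have "\<dots> = (\<Sum>m\<in>Poly_Mapping.keys p. \<Sum>m'\<in>Poly_Mapping.keys q. subst \<sigma> (?p m * ?q m'))"
    by (simp add: sum_product subst_sum)
  also have "\<dots> = (\<Sum>m\<in>Poly_Mapping.keys p. \<Sum>m'\<in>Poly_Mapping.keys q. subst \<sigma> (?p m) * subst \<sigma> (?q m'))"
    unfolding mult_single unfolding subst_monom_eq subst_monom_add unfolding constant_mult
    by (simp only: mult_ac)
  also have "\<dots> = (\<Sum>m\<in>Poly_Mapping.keys p. subst \<sigma> (?p m)) * (\<Sum>m\<in>Poly_Mapping.keys q. subst \<sigma> (?q m))"
    by (simp add: sum_product)
  also have "\<dots> = subst \<sigma> p * subst \<sigma> q"
    by (simp only: subst_sum[symmetric] sum_monom[symmetric])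
  finally show ?thesis .
qed

lemma subst_constant [simp]: "subst \<sigma> (Const c) = Const c"
  by (simp add: subst_monom_eq subst_monom_def)

lemma subst_one [simp]: "subst \<sigma> 1 = 1"
  using subst_constant[of \<sigma> 1] by (simp del: subst_constant)

lemma subst_variable [simp]: "subst \<sigma> (variable v) = \<sigma> v"
  by (simp add: variable_def subst_monom_eq subst_monom_def)

lemma subst_power: "subst \<sigma> (p ^ k) = subst \<sigma> p ^ k"
  by (induction k) (simp_all add: subst_mult)

lemma subst_monomial_value: "subst \<sigma> (monomial_value f es) = monomial_value (\<lambda>i. subst \<sigma> (f i)) es"
  by (induction es) (simp_all add: subst_mult subst_power)

text \<open>
  A substitution that moves every variable by an element of \<open>T\<close> is the identity modulo \<open>T\<close>; this identifies
  kernels of substitutions with ideals given by generators.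
\<close>

lemma minus_subst_mem:
  assumes "p \<in> polys_in A" and T: "polys.ideal_of A T"
    and mem: "\<And>v. v \<in> A \<Longrightarrow> variable v - \<sigma> v \<in> T" and S: "\<And>v. v \<in> A \<Longrightarrow> \<sigma> v \<in> polys_in A"
  shows "p - subst \<sigma> p \<in> T"
proof -
  have "subst \<sigma> p \<in> polys_in A \<and> p - subst \<sigma> p \<in> T"
    using assms(1)
  proof (induction p rule: polys_in_induct)
    case (Const c)
    then show ?case using polys.ideal_ofD(1)[OF T] by (simp add: constant_mem)
  next
    case (Var v)
    then show ?case using mem S by simp
  next
    case (add p q)
    have eq: "p + q - subst \<sigma> (p + q) = (p - subst \<sigma> p) + (q - subst \<sigma> q)" by (simp add: subst_add)
    have "p + q - subst \<sigma> (p + q) \<in> T"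
      unfolding eq using add by (intro polys.ideal_ofD(2)[OF T]) auto
    then show ?case using add by (simp add: subst_add polys.add_mem)
  next
    case (mult p q)
    have eq: "p * q - subst \<sigma> (p * q) = p * (q - subst \<sigma> q) + (p - subst \<sigma> p) * subst \<sigma> q"
      by (simp add: subst_mult algebra_simps)
    have "p * q - subst \<sigma> (p * q) \<in> T"
      unfolding eq using mult
      by (intro polys.ideal_ofD(2)[OF T] polys.ideal_ofD(3)[OF T] polys.ideal_ofD(4)[OF T]) auto
    then show ?case using mult by (simp add: subst_mult polys.mult_mem)
  qed
  then show ?thesis by simp
qed

definition restrict_vars :: "nat set \<Rightarrow> 'k::field mpoly \<Rightarrow> 'k mpoly" where
  "restrict_vars W = subst (\<lambda>v. if v \<in> W then variable v else 0)"

lemma lookup_restrict_vars: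
  fixes p :: "'k::field mpoly"
  shows "Poly_Mapping.lookup (restrict_vars W p) m = (if Poly_Mapping.keys m \<subseteq> W then Poly_Mapping.lookup p m else 0)"
proof -
  let ?\<sigma> = "\<lambda>v. if v \<in> W then variable v else (0 :: 'k mpoly)"
  have sm: "Const c * subst_monom ?\<sigma> m = (if Poly_Mapping.keys m \<subseteq> W then Mon m c else 0)" for m c
  proof (cases "Poly_Mapping.keys m \<subseteq> W")
    case True
    then have "subst_monom ?\<sigma> m = (\<Prod>v\<in>Poly_Mapping.keys m. variable v ^ Poly_Mapping.lookup m v)"
      unfolding subst_monom_def by (intro prod.cong) auto
    then show ?thesis using True monom_eq_prod[of m c] by simp
  next
    case False
    then obtain v where "v \<in> Poly_Mapping.keys m" "v \<notin> W" by auto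
    then have "subst_monom ?\<sigma> m = 0"
      unfolding subst_monom_def by (auto simp: in_keys_iff power_0_left intro!: bexI[of _ v])
    then show ?thesis using False by simp
  qed
  have eq: "restrict_vars W p =
    (\<Sum>m\<in>Poly_Mapping.keys p. if Poly_Mapping.keys m \<subseteq> W then Mon m (Poly_Mapping.lookup p m) else 0)"
    unfolding restrict_vars_def subst_def sm ..
  have coeff: "Poly_Mapping.lookup (if Poly_Mapping.keys m' \<subseteq> W then Mon m' (Poly_Mapping.lookup p m') else 0) m =
    (if m' = m then (if Poly_Mapping.keys m \<subseteq> W then Poly_Mapping.lookup p m else 0) else 0)" for m'
    by (cases "m' = m") (simp_all add: lookup_single_not_eq)
  have "Poly_Mapping.lookup (restrict_vars W p) m =
    (\<Sum>m'\<in>Poly_Mapping.keys p. if m' = m then (if Poly_Mapping.keys m \<subseteq> W then Poly_Mapping.lookup p m else 0) else 0)"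
    unfolding eq lookup_sum coeff ..
  also have "\<dots> = (if m \<in> Poly_Mapping.keys p then (if Poly_Mapping.keys m \<subseteq> W then Poly_Mapping.lookup p m else 0) else 0)"
    by (rule sum.delta[OF finite_keys])
  finally show ?thesis by (simp add: in_keys_iff)
qed

lemma restrict_vars_eq_0_iff:
  "restrict_vars W p = 0 \<longleftrightarrow> (\<forall>m\<in>Poly_Mapping.keys p. \<not> Poly_Mapping.keys m \<subseteq> W)"
proof -
  have "restrict_vars W p = 0 \<longleftrightarrow> (\<forall>m. Poly_Mapping.lookup (restrict_vars W p) m = 0)"
    by (auto intro: poly_mapping_eqI)
  also have "\<dots> \<longleftrightarrow> (\<forall>m. Poly_Mapping.keys m \<subseteq> W \<longrightarrow> Poly_Mapping.lookup p m = 0)"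
    unfolding lookup_restrict_vars by (simp split: if_split)
  also have "\<dots> \<longleftrightarrow> (\<forall>m\<in>Poly_Mapping.keys p. \<not> Poly_Mapping.keys m \<subseteq> W)"
    using in_keys_iff[where s = p] by metis
  finally show ?thesis .
qed

lemma restrict_vars_mem: "restrict_vars W p \<in> polys_in W"
proof -
  have "Poly_Mapping.keys m \<subseteq> W" if "m \<in> Poly_Mapping.keys (restrict_vars W p)" for m
  proof (rule ccontr)
    assume "\<not> Poly_Mapping.keys m \<subseteq> W"
    then have "Poly_Mapping.lookup (restrict_vars W p) m = 0" by (simp only: lookup_restrict_vars if_False)
    then show False using that by blast
  qed
  then show ?thesis by (simp add: polys_in_def)
qed

section \<open>Algebraic dependence of too many polynomials\<close>

definition exponents_le :: "nat \<Rightarrow> 'k::field mpoly \<Rightarrow> bool" where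
  "exponents_le B p \<longleftrightarrow> (\<forall>m\<in>Poly_Mapping.keys p. \<forall>v. Poly_Mapping.lookup m v \<le> B)"

lemma exponents_le_one: "exponents_le 0 1"
  by (simp add: exponents_le_def)

lemma exponents_le_mono: "exponents_le B p \<Longrightarrow> B \<le> B' \<Longrightarrow> exponents_le B' p"
  unfolding exponents_le_def by (meson order_trans)

lemma exponents_le_mult:
  assumes "exponents_le B p" "exponents_le B' q"
  shows "exponents_le (B + B') (p * q)"
  unfolding exponents_le_def
proof (intro ballI allI)
  fix m v assume m: "m \<in> Poly_Mapping.keys (p * q)"
  obtain a b where "m = a + b" "a \<in> Poly_Mapping.keys p" "b \<in> Poly_Mapping.keys q"
    by (rule keys_mult_obtain[OF m])
  then show "Poly_Mapping.lookup m v \<le> B + B'"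
    using assms unfolding exponents_le_def by (simp add: lookup_add add_mono)
qed

lemma exponents_le_power: "exponents_le B p \<Longrightarrow> exponents_le (k * B) (p ^ k)"
  by (induction k) (simp_all add: exponents_le_one exponents_le_mult)

lemma ex_exponents_le: "\<exists>B. exponents_le B p"
proof -
  define B where "B = Max (insert 0 (\<Union>m\<in>Poly_Mapping.keys p. Poly_Mapping.lookup m ` Poly_Mapping.keys m))"
  have "Poly_Mapping.lookup m v \<le> B" if "m \<in> Poly_Mapping.keys p" for m v
  proof (cases "v \<in> Poly_Mapping.keys m")
    case True
    then show ?thesis unfolding B_def using that by (intro Max_ge) auto
  next
    case False
    then show ?thesis by (simp add: not_in_keys_iff_lookup_eq_zero)
  qed
  then show ?thesis unfolding exponents_le_def by blast
qed

lemma card_bounded_exponents: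
  fixes B :: nat
  assumes "finite W"
  defines "E \<equiv> {m :: nat \<Rightarrow>\<^sub>0 nat. Poly_Mapping.keys m \<subseteq> W \<and> (\<forall>v. Poly_Mapping.lookup m v \<le> B)}"
  shows "finite E" "card E \<le> Suc B ^ card W"
proof -
  have fin: "finite (W \<rightarrow>\<^sub>E {..B})" using assms by (intro finite_PiE) auto
  have inj: "inj_on (\<lambda>m. restrict (Poly_Mapping.lookup m) W) E"
  proof (rule inj_onI)
    fix m m' assume m: "m \<in> E" "m' \<in> E"
      and eq: "restrict (Poly_Mapping.lookup m) W = restrict (Poly_Mapping.lookup m') W"
    show "m = m'"
    proof (rule poly_mapping_eqI)
      fix v show "Poly_Mapping.lookup m v = Poly_Mapping.lookup m' v"
      proof (cases "v \<in> W")
        case True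
        then show ?thesis using fun_cong[OF eq, of v] by simp
      next
        case False
        then have "v \<notin> Poly_Mapping.keys m" "v \<notin> Poly_Mapping.keys m'"
          using m unfolding E_def by auto
        then show ?thesis by (simp add: not_in_keys_iff_lookup_eq_zero)
      qed
    qed
  qed
  have im: "(\<lambda>m. restrict (Poly_Mapping.lookup m) W) ` E \<subseteq> W \<rightarrow>\<^sub>E {..B}"
    unfolding E_def by auto
  show "finite E" using finite_subset[OF im fin] inj by (simp add: finite_image_iff)
  have "card E \<le> card (W \<rightarrow>\<^sub>E {..B})" by (rule card_inj_on_le[OF inj im fin])
  then show "card E \<le> Suc B ^ card W" using assms(1) by (simp add: card_PiE)
qed

text \<open>
  The number of monomials in \<open>r\<close> letters with exponents below \<open>N\<close> exceeds, for suitable \<open>N\<close>, the number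
  of monomials in \<open>w < r\<close> variables with exponents at most \<open>D * N\<close>.
\<close>

lemma exponential_growth:
  fixes D r w :: nat
  assumes "w < r"
  obtains N where "Suc (D * N) ^ w < N ^ r"
proof
  define N where "N = Suc (Suc D ^ w)"
  have "Suc (D * N) \<le> Suc D * N" by (simp add: N_def)
  then have "Suc (D * N) ^ w \<le> (Suc D * N) ^ w" by (rule power_mono) simp
  also have "\<dots> = Suc D ^ w * N ^ w" by (rule power_mult_distrib)
  also have "\<dots> < N * N ^ w" unfolding N_def by (intro mult_strict_right_mono) auto
  also have "\<dots> = N ^ Suc w" by simp
  also have "\<dots> \<le> N ^ r" using assms by (intro power_increasing) (auto simp: N_def)
  finally show "Suc (D * N) ^ w < N ^ r" .
qed

text \<open>
  All products of powers of the \<open>f\<^sub>i\<close> with exponents below \<open>N\<close> lie in the span of the monomials in \<open>W\<close> with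
  exponents at most \<open>D * N\<close>. For large \<open>N\<close> there are more products than monomials, so either two
  products coincide or they are linearly dependent.
\<close>

lemma polynomial_relation:
  fixes f :: "nat \<Rightarrow> 'k::field mpoly"
  assumes W: "finite W" "card W < r" and f: "\<And>i. i < r \<Longrightarrow> f i \<in> polys_in W"
  obtains M c where "finite M" "M \<noteq> {}" "\<And>m. m \<in> M \<Longrightarrow> length m = r" "\<And>m. m \<in> M \<Longrightarrow> c m \<noteq> 0"
    "(\<Sum>m\<in>M. Const (c m) * monomial_value f m) = 0"
proof -
  define b where "b i = (SOME B. exponents_le B (f i))" for i
  have b: "exponents_le (b i) (f i)" for i unfolding b_def by (rule someI_ex[OF ex_exponents_le])
  \<comment> \<open>products of powers below \<open>N\<close> have exponents at most \<open>D * N\<close>\<close>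
  define D where "D = (\<Sum>i<r. b i)"
  obtain N where N: "Suc (D * N) ^ card W < N ^ r" using exponential_growth[OF W(2)] .
  define E where "E = {m. set m \<subseteq> {..<N} \<and> length m = r}"
  have E: "finite E" "card E = N ^ r"
    unfolding E_def by (simp_all add: finite_lists_length_eq card_lists_length_eq)
  have val: "monomial_value f m \<in> polys_in W \<and> exponents_le ((\<Sum>i<length m. b i) * N) (monomial_value f m)"
    if "length m \<le> r" "set m \<subseteq> {..<N}" for m
    using that
  proof (induction m)
    case (Cons e m)
    let ?i = "length m"
    have "exponents_le (e * b ?i) (f ?i ^ e)" by (rule exponents_le_power[OF b])
    then have "exponents_le (N * b ?i) (f ?i ^ e)"
      by (rule exponents_le_mono) (use Cons.prems in simp)
    then have "exponents_le (N * b ?i + (\<Sum>i<?i. b i) * N) (monomial_value f (e # m))"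
      using Cons by (simp add: exponents_le_mult)
    moreover have "N * b ?i + (\<Sum>i<?i. b i) * N = (\<Sum>i<length (e # m). b i) * N"
      by (simp add: algebra_simps)
    moreover have "monomial_value f (e # m) \<in> polys_in W"
      using Cons f[of ?i] by (simp add: polys.mult_mem polys.power_mem)
    ultimately show ?case by simp
  qed (simp add: polys.one_mem exponents_le_one)
  define mons where "mons = {m :: nat \<Rightarrow>\<^sub>0 nat. Poly_Mapping.keys m \<subseteq> W \<and> (\<forall>v. Poly_Mapping.lookup m v \<le> D * N)}"
  have mons: "finite mons" "card mons \<le> Suc (D * N) ^ card W"
    unfolding mons_def by (rule card_bounded_exponents[OF W(1)])+
  interpret vs: vector_space "\<lambda>c p. Const c * p :: 'k mpoly"
    by unfold_locales
      (simp_all add: distrib_left distrib_right single_add mult.assoc[symmetric] mult_single)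
  let ?B = "(\<lambda>m. Mon m (1::'k)) ` mons"
  have span: "monomial_value f m \<in> vs.span ?B" if "m \<in> E" for m
  proof -
    let ?p = "monomial_value f m"
    have p: "?p \<in> polys_in W" "exponents_le (D * N) ?p"
      using val[of m] that unfolding E_def D_def by auto
    have "(\<Sum>k\<in>Poly_Mapping.keys ?p. Mon k (Poly_Mapping.lookup ?p k)) \<in> vs.span ?B"
    proof (rule vs.span_sum)
      fix k assume "k \<in> Poly_Mapping.keys ?p"
      then have "k \<in> mons" using p unfolding mons_def polys_in_def exponents_le_def by blast
      then have "Const (Poly_Mapping.lookup ?p k) * Mon k 1 \<in> vs.span ?B"
        by (intro vs.span_scale vs.span_base) simp
      then show "Mon k (Poly_Mapping.lookup ?p k) \<in> vs.span ?B" by (simp add: mult_single)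
    qed
    then show ?thesis by (simp only: sum_monom[symmetric])
  qed
  show thesis
  proof (cases "inj_on (monomial_value f) E")
    case False
    then obtain m m' where m: "m \<in> E" "m' \<in> E" "m \<noteq> m'" "monomial_value f m = monomial_value f m'"
      unfolding inj_on_def by blast
    show thesis
    proof (rule that)
      show "(\<Sum>k\<in>{m, m'}. Const (if k = m then 1 else - 1) * monomial_value f k) = 0"
        using m by (simp add: single_uminus)
    qed (use m in \<open>auto simp: E_def\<close>)
  next
    case True
    have "vs.dependent (monomial_value f ` E)"
    proof (rule ccontr)
      assume "vs.independent (monomial_value f ` E)"
      then have "card (monomial_value f ` E) \<le> card ?B"
        using vs.independent_span_bound[of ?B] span mons(1) by blast
      also have "\<dots> \<le> card mons" by (rule card_image_le[OF mons(1)])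
      also have "\<dots> < N ^ r" using mons(2) N by simp
      finally show False using card_image[OF True] E(2) by simp
    qed
    then obtain t u where t: "finite t" "t \<subseteq> monomial_value f ` E" "\<exists>p\<in>t. u p \<noteq> 0"
      "(\<Sum>p\<in>t. Const (u p) * p) = 0"
      unfolding vs.dependent_explicit by blast
    define M where "M = {m \<in> E. monomial_value f m \<in> t \<and> u (monomial_value f m) \<noteq> 0}"
    have M: "monomial_value f ` M = {p \<in> t. u p \<noteq> 0}"
      using t(2) unfolding M_def by auto
    have injM: "inj_on (monomial_value f) M" by (rule inj_on_subset[OF True]) (auto simp: M_def)
    show thesis
    proof (rule that)
      show "finite M" using E(1) by (simp add: M_def)
      show "M \<noteq> {}" using M t(3) by auto
      show "length m = r" if "m \<in> M" for m using that by (simp add: M_def E_def)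
      show "u (monomial_value f m) \<noteq> 0" if "m \<in> M" for m using that by (simp add: M_def)
      have "(\<Sum>m\<in>M. Const (u (monomial_value f m)) * monomial_value f m) =
        (\<Sum>p\<in>monomial_value f ` M. Const (u p) * p)"
        by (simp add: sum.reindex[OF injM])
      also have "\<dots> = (\<Sum>p\<in>t. Const (u p) * p)"
        unfolding M by (rule sum.mono_neutral_left) (use t(1) in auto)
      finally show "(\<Sum>m\<in>M. Const (u (monomial_value f m)) * monomial_value f m) = 0"
        using t(4) by simp
    qed
  qed
qed

section \<open>Edge ideals restricted to vertex subsets\<close>

definition stable_set :: "(nat \<times> nat) set \<Rightarrow> nat set \<Rightarrow> bool" where
  "stable_set E A \<longleftrightarrow> (\<forall>u\<in>A. \<forall>v\<in>A. (u, v) \<notin> E)"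

text \<open>
  For a loop-free relation this is the sum of the edge ideal and the ideal of the variables outside \<open>U\<close>, described through its monomials;
  dividing by it deletes the vertices outside \<open>U\<close>. For \<open>U = A\<close> it is the edge ideal itself
  (\<open>genideal_edges\<close> below).
\<close>

definition restricted_ideal :: "(nat \<times> nat) set \<Rightarrow> nat set \<Rightarrow> nat set \<Rightarrow> 'k::field mpoly set" where
  "restricted_ideal E A U =
    {p \<in> polys_in A. \<forall>m\<in>Poly_Mapping.keys p. Poly_Mapping.keys m \<subseteq> U \<longrightarrow> \<not> stable_set E (Poly_Mapping.keys m)}"

lemma stable_set_subset: "stable_set E A \<Longrightarrow> B \<subseteq> A \<Longrightarrow> stable_set E B"
  unfolding stable_set_def by blast

lemma keys_monom_mult: "Poly_Mapping.keys (Mon u 1 * g) = (+) u ` Poly_Mapping.keys (g :: 'k::field mpoly)"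
proof -
  have "Poly_Mapping.lookup (Mon u 1 * g) (u + m) = Poly_Mapping.lookup g m" for m
  proof -
    have "Mon u 1 * g = (\<Sum>k\<in>Poly_Mapping.keys g. Mon u 1 * Mon k (Poly_Mapping.lookup g k))"
      by (simp only: sum_distrib_left[symmetric] sum_monom[symmetric])
    also have "\<dots> = (\<Sum>k\<in>Poly_Mapping.keys g. Mon (u + k) (Poly_Mapping.lookup g k))"
      by (simp add: mult_single)
    finally have "Poly_Mapping.lookup (Mon u 1 * g) (u + m) =
      (\<Sum>k\<in>Poly_Mapping.keys g. if k = m then Poly_Mapping.lookup g m else 0)"
      by (simp only: lookup_sum lookup_single when_def) (intro sum.cong refl, simp)
    also have "\<dots> = (if m \<in> Poly_Mapping.keys g then Poly_Mapping.lookup g m else 0)"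
      by (rule sum.delta[OF finite_keys])
    finally show ?thesis by (simp add: not_in_keys_iff_lookup_eq_zero)
  qed
  then have *: "u + m \<in> Poly_Mapping.keys (Mon u 1 * g) \<longleftrightarrow> m \<in> Poly_Mapping.keys g" for m
    unfolding lookup_not_eq_zero_eq_in_keys[symmetric] by simp
  show ?thesis
  proof
    show "Poly_Mapping.keys (Mon u 1 * g) \<subseteq> (+) u ` Poly_Mapping.keys g"
    proof
      fix m assume m: "m \<in> Poly_Mapping.keys (Mon u 1 * g)"
      obtain a b where "m = a + b" "a \<in> Poly_Mapping.keys (Mon u (1::'k))" "b \<in> Poly_Mapping.keys g"
        by (rule keys_mult_obtain[OF m])
      then show "m \<in> (+) u ` Poly_Mapping.keys g" by simp
    qed
  qed (use * in blast)
qed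

lemma restricted_idealD:
  assumes "p \<in> restricted_ideal E A U"
  shows "p \<in> polys_in A"
    "m \<in> Poly_Mapping.keys p \<Longrightarrow> Poly_Mapping.keys m \<subseteq> U \<Longrightarrow> \<not> stable_set E (Poly_Mapping.keys m)"
  using assms unfolding restricted_ideal_def by blast+

lemma restricted_idealI:
  assumes "p \<in> polys_in A"
    "\<And>m. m \<in> Poly_Mapping.keys p \<Longrightarrow> Poly_Mapping.keys m \<subseteq> U \<Longrightarrow> stable_set E (Poly_Mapping.keys m) \<Longrightarrow> False"
  shows "p \<in> restricted_ideal E A U"
  using assms unfolding restricted_ideal_def by blast

lemma ideal_of_restricted_ideal:
  "polys.ideal_of A (restricted_ideal E A U :: 'k::field mpoly set)"
  unfolding polys.ideal_of_def
proof (intro conjI ballI)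
  show "restricted_ideal E A U \<subseteq> (polys_in A :: 'k mpoly set)" using restricted_idealD(1) by blast
  show "(0 :: 'k mpoly) \<in> restricted_ideal E A U"
    by (rule restricted_idealI) (simp_all add: polys.zero_mem)
next
  fix x y :: "'k mpoly" assume xy: "x \<in> restricted_ideal E A U" "y \<in> restricted_ideal E A U"
  show "x + y \<in> restricted_ideal E A U"
  proof (rule restricted_idealI)
    show "x + y \<in> polys_in A" by (intro polys.add_mem restricted_idealD(1)[OF xy(1)] restricted_idealD(1)[OF xy(2)])
    fix m assume "m \<in> Poly_Mapping.keys (x + y)" and m: "Poly_Mapping.keys m \<subseteq> U" "stable_set E (Poly_Mapping.keys m)"
    then have "m \<in> Poly_Mapping.keys x \<or> m \<in> Poly_Mapping.keys y" using keys_add[of x y] by blast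
    then show False using restricted_idealD(2)[OF xy(1) _ m(1)] restricted_idealD(2)[OF xy(2) _ m(1)] m(2) by blast
  qed
next
  fix s x :: "'k mpoly" assume s: "s \<in> polys_in A" and x: "x \<in> restricted_ideal E A U"
  show "s * x \<in> restricted_ideal E A U"
  proof (rule restricted_idealI)
    show "s * x \<in> polys_in A" by (intro polys.mult_mem s restricted_idealD(1)[OF x])
    fix m assume m: "m \<in> Poly_Mapping.keys (s * x)" "Poly_Mapping.keys m \<subseteq> U" "stable_set E (Poly_Mapping.keys m)"
    obtain a b where ab: "m = a + b" "a \<in> Poly_Mapping.keys s" "b \<in> Poly_Mapping.keys x"
      by (rule keys_mult_obtain[OF m(1)])
    then have sub: "Poly_Mapping.keys b \<subseteq> Poly_Mapping.keys m" by (simp add: keys_add_nat)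
    show False
      using restricted_idealD(2)[OF x ab(3)] sub m(2) stable_set_subset[OF m(3) sub] by blast
  qed
qed

lemma monom_mem: "Poly_Mapping.keys m \<subseteq> A \<Longrightarrow> Mon m c \<in> polys_in A"
  by (simp add: polys_in_def)

lemma monom_mem_restricted_ideal:
  assumes "Poly_Mapping.keys m \<subseteq> A" "Poly_Mapping.keys m \<subseteq> U \<Longrightarrow> \<not> stable_set E (Poly_Mapping.keys m)"
  shows "Mon m c \<in> restricted_ideal E A U"
  by (rule restricted_idealI) (use assms in \<open>auto simp: monom_mem split: if_splits\<close>)

lemma mem_ideal_if_monoms:
  assumes "polys.ideal_of A T" "\<And>m. m \<in> Poly_Mapping.keys p \<Longrightarrow> Mon m (Poly_Mapping.lookup p m) \<in> T"
  shows "p \<in> T"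
proof -
  have "(\<Sum>m\<in>Poly_Mapping.keys p. Mon m (Poly_Mapping.lookup p m)) \<in> T"
    by (rule polys.ideal_of_sum[OF assms])
  then show ?thesis by (simp only: sum_monom[symmetric])
qed

lemma monom_split_variable:
  assumes "x \<in> Poly_Mapping.keys m"
  shows "Mon m c = variable x * Mon (m - Poly_Mapping.single x 1) c"
proof -
  have "Poly_Mapping.single x 1 + (m - Poly_Mapping.single x 1) = m"
  proof (rule poly_mapping_eqI)
    fix v show "Poly_Mapping.lookup (Poly_Mapping.single x 1 + (m - Poly_Mapping.single x 1)) v = Poly_Mapping.lookup m v"
      using assms by (cases "v = x") (auto simp: lookup_add lookup_minus lookup_single_not_eq in_keys_iff)
  qed
  then show ?thesis by (simp add: variable_def mult_single)
qed

lemma keys_minus_nat: "Poly_Mapping.keys (m - k) \<subseteq> Poly_Mapping.keys (m :: nat \<Rightarrow>\<^sub>0 nat)"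
  by (auto simp: in_keys_iff lookup_minus)

lemma adjoin_restricted_ideal:
  fixes E :: "(nat \<times> nat) set"
  assumes "x \<in> A"
  shows "polys.adjoin A (restricted_ideal E A U) (variable x) =
    (restricted_ideal E A (U - {x}) :: 'k::field mpoly set)"
proof
  show "polys.adjoin A (restricted_ideal E A U) (variable x) \<subseteq> (restricted_ideal E A (U - {x}) :: 'k mpoly set)"
  proof (rule polys.adjoin_subset[OF ideal_of_restricted_ideal])
    show "restricted_ideal E A U \<subseteq> (restricted_ideal E A (U - {x}) :: 'k mpoly set)"
      unfolding restricted_ideal_def by auto
    show "variable x \<in> (restricted_ideal E A (U - {x}) :: 'k mpoly set)"
      unfolding variable_def by (rule monom_mem_restricted_ideal) (use assms in auto)
  qed
  have T: "polys.ideal_of A (polys.adjoin A (restricted_ideal E A U) (variable x) :: 'k mpoly set)"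
    by (intro polys.ideal_of_adjoin ideal_of_restricted_ideal variable_mem assms)
  show "restricted_ideal E A (U - {x}) \<subseteq> (polys.adjoin A (restricted_ideal E A U) (variable x) :: 'k mpoly set)"
  proof
    fix p :: "'k mpoly" assume p: "p \<in> restricted_ideal E A (U - {x})"
    show "p \<in> polys.adjoin A (restricted_ideal E A U) (variable x)"
    proof (rule mem_ideal_if_monoms[OF T])
      fix m assume m: "m \<in> Poly_Mapping.keys p"
      let ?c = "Poly_Mapping.lookup p m"
      have mA: "Poly_Mapping.keys m \<subseteq> A" using restricted_idealD(1)[OF p] m unfolding polys_in_def by blast
      show "Mon m ?c \<in> polys.adjoin A (restricted_ideal E A U) (variable x)"
      proof (cases "x \<in> Poly_Mapping.keys m")
        case True
        have "Mon (m - Poly_Mapping.single x 1) ?c \<in> polys_in A"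
          using mA keys_minus_nat[of m] by (intro monom_mem) blast
        then have "0 + variable x * Mon (m - Poly_Mapping.single x 1) ?c \<in> polys.adjoin A (restricted_ideal E A U) (variable x)"
          by (intro polys.adjoinI polys.ideal_ofD(1)[OF ideal_of_restricted_ideal])
        then show ?thesis by (simp add: monom_split_variable[OF True])
      next
        case False
        have "Mon m ?c \<in> restricted_ideal E A U"
          using restricted_idealD(2)[OF p m] False by (intro monom_mem_restricted_ideal mA) blast
        then show ?thesis using polys.subset_adjoin by blast
      qed
    qed
  qed
qed

text \<open>
  A monomial times the variable of \<open>x\<close> contains an edge if and only if the monomial contains an edge or a
  neighbour of \<open>x\<close>.
\<close>

lemma colon_restricted_ideal:
  assumes E: "sym E" "(x, x) \<notin> E" and x: "x \<in> A" "x \<in> U"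
  shows "polys.colon A (restricted_ideal E A U) (variable x) =
    (restricted_ideal E A (U - E `` {x}) :: 'k::field mpoly set)"
proof -
  have keys: "Poly_Mapping.keys (variable x * g) = (+) (Poly_Mapping.single x 1) ` Poly_Mapping.keys g" for g :: "'k mpoly"
    unfolding variable_def by (rule keys_monom_mult)
  have ind: "stable_set E (insert x B) \<longleftrightarrow> stable_set E B \<and> B \<inter> E `` {x} = {}" for B
    using E unfolding stable_set_def sym_def by blast
  have "(\<forall>k\<in>Poly_Mapping.keys (variable x * g). Poly_Mapping.keys k \<subseteq> U \<longrightarrow> \<not> stable_set E (Poly_Mapping.keys k)) \<longleftrightarrow>
    (\<forall>m\<in>Poly_Mapping.keys g. Poly_Mapping.keys m \<subseteq> U - E `` {x} \<longrightarrow> \<not> stable_set E (Poly_Mapping.keys m))" for g :: "'k mpoly"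
    unfolding keys ball_simps keys_add_nat using x(2) by (auto simp: ind)
  then show ?thesis
    unfolding polys.colon_def restricted_ideal_def using polys.mult_mem variable_mem[OF x(1)] by blast
qed

section \<open>Vertices with disjoint closed neighbourhoods give a regular sequence\<close>

definition class_sum :: "nat set \<Rightarrow> 'k::field mpoly" where
  "class_sum V = (\<Sum>v\<in>V. variable v)"

lemma class_sum_mem: "V \<subseteq> A \<Longrightarrow> class_sum V \<in> polys_in A"
  unfolding class_sum_def by (intro polys.sum_mem variable_mem) blast

lemma class_sums_mem:
  "(\<And>i. i < k \<Longrightarrow> V i \<subseteq> A) \<Longrightarrow> set (map (\<lambda>i. class_sum (V i) :: 'k::field mpoly) [0..<k]) \<subseteq> polys_in A"
proof
  fix p :: "'k::field mpoly"
  assume "\<And>i. i < k \<Longrightarrow> V i \<subseteq> A" "p \<in> set (map (\<lambda>i. class_sum (V i)) [0..<k])"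
  then obtain i where "p = class_sum (V i)" "V i \<subseteq> A" by auto
  then show "p \<in> polys_in A" by (simp add: class_sum_mem)
qed

lemma class_sum_nonzero:
  assumes "finite V" "v \<in> V"
  shows "class_sum V \<noteq> (0 :: 'k::field mpoly)"
proof -
  have single: "Poly_Mapping.single w (1 :: nat) = Poly_Mapping.single v 1 \<longleftrightarrow> w = v" for w
    by (metis lookup_single_eq lookup_single_not_eq zero_neq_one)
  have "Poly_Mapping.lookup (class_sum V :: 'k mpoly) (Poly_Mapping.single v 1) =
    (\<Sum>w\<in>V. if w = v then 1 else 0)"
    unfolding class_sum_def variable_def lookup_sum lookup_single when_def single ..
  also have "\<dots> = 1" using assms by (simp add: sum.delta)
  finally show ?thesis by auto
qed

text \<open>
  Over an independent set \<open>U\<close> the quotient is the polynomial ring \<open>K[U]\<close>, and setting the first \<open>k\<close> class sums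
  to zero eliminates the variables \<open>s\<^sub>0,\<dots>,s\<^bsub>k-1\<^esub>\<close>. The substitution \<open>\<sigma>\<close> performs this elimination; the
  disjointness of the classes ensures that the expressions substituted contain no eliminated variable.
\<close>

lemma adjoin_list_eq_kernel:
  fixes V :: "nat \<Rightarrow> nat set"
  assumes A: "finite A" "U \<subseteq> A" "\<And>i. i < k \<Longrightarrow> V i \<subseteq> A"
    and indep: "stable_set E U"
    and s: "\<And>i. i < k \<Longrightarrow> s i \<in> U \<inter> V i"
    and disj: "\<And>i j. i < k \<Longrightarrow> j < k \<Longrightarrow> i \<noteq> j \<Longrightarrow> V i \<inter> V j = {}"
    and \<sigma>: "\<And>v. v \<notin> U \<Longrightarrow> \<sigma> v = 0"
      "\<And>i. i < k \<Longrightarrow> \<sigma> (s i) = - class_sum (V i \<inter> U - {s i})"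
      "\<And>v. v \<in> U \<Longrightarrow> (\<And>i. i < k \<Longrightarrow> v \<noteq> s i) \<Longrightarrow> \<sigma> v = variable v"
  shows "polys.adjoin_list A (restricted_ideal E A U) (map (\<lambda>i. class_sum (V i)) [0..<k]) =
    {p \<in> polys_in A. subst \<sigma> p = (0 :: 'k::field mpoly)}"
    (is "?T = ?K")
proof
  let ?I = "restricted_ideal E A U :: 'k mpoly set"
  have mem: "set (map (\<lambda>i. class_sum (V i)) [0..<k]) \<subseteq> (polys_in A :: 'k mpoly set)"
    by (rule class_sums_mem[OF A(3)])
  have T: "polys.ideal_of A ?T"
    by (rule polys.ideal_of_adjoin_list[OF ideal_of_restricted_ideal mem])
  have K: "polys.ideal_of A ?K"
    unfolding polys.ideal_of_def
    by (auto simp: polys.zero_mem polys.add_mem polys.mult_mem subst_add subst_mult)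
  have finV: "finite (V i)" if "i < k" for i using A that finite_subset by blast
  show "?T \<subseteq> ?K"
  proof (rule polys.adjoin_list_subset[OF K])
    show "?I \<subseteq> ?K"
    proof
      fix p assume p: "p \<in> ?I"
      have "subst \<sigma> p = 0"
        unfolding subst_def
      proof (rule sum.neutral, intro ballI)
        fix m assume "m \<in> Poly_Mapping.keys p"
        then have "\<not> Poly_Mapping.keys m \<subseteq> U"
          using restricted_idealD(2)[OF p] stable_set_subset[OF indep] by blast
        then obtain v where v: "v \<in> Poly_Mapping.keys m" "v \<notin> U" by blast
        have "Poly_Mapping.lookup m v \<noteq> 0" using v(1) by (simp add: in_keys_iff)
        then have "\<sigma> v ^ Poly_Mapping.lookup m v = 0" using \<sigma>(1)[OF v(2)] by simp
        then have "subst_monom \<sigma> m = 0"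
          unfolding subst_monom_def using v(1) by (intro prod_zero) auto
        then show "Const (Poly_Mapping.lookup p m) * subst_monom \<sigma> m = 0" by simp
      qed
      then show "p \<in> ?K" using restricted_idealD(1)[OF p] by simp
    qed
    show "set (map (\<lambda>i. class_sum (V i)) [0..<k]) \<subseteq> ?K"
    proof
      fix p :: "'k mpoly" assume "p \<in> set (map (\<lambda>i. class_sum (V i)) [0..<k])"
      then obtain i where i: "i < k" "p = class_sum (V i)" by auto
      have "subst \<sigma> p = (\<Sum>v\<in>V i. \<sigma> v)" by (simp add: i class_sum_def subst_sum)
      also have "\<dots> = (\<Sum>v\<in>V i \<inter> U. \<sigma> v)"
        by (rule sum.mono_neutral_right) (use finV[OF i(1)] \<sigma>(1) in auto)
      also have "\<dots> = \<sigma> (s i) + (\<Sum>v\<in>V i \<inter> U - {s i}. \<sigma> v)"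
        using s[OF i(1)] finV[OF i(1)] by (intro sum.remove) auto
      also have "(\<Sum>v\<in>V i \<inter> U - {s i}. \<sigma> v) = class_sum (V i \<inter> U - {s i})"
        unfolding class_sum_def
      proof (rule sum.cong[OF refl])
        fix v assume v: "v \<in> V i \<inter> U - {s i}"
        have "v \<noteq> s j" if "j < k" for j
          using v s[OF that] disj[OF i(1) that] by (cases "j = i") auto
        then show "\<sigma> v = variable v" using \<sigma>(3) v by blast
      qed
      finally have "subst \<sigma> p = 0" using \<sigma>(2)[OF i(1)] by simp
      then show "p \<in> ?K" using i A(3) class_sum_mem by blast
    qed
  qed
  have I: "?I \<subseteq> ?T" by (rule polys.subset_adjoin_list)
  have outside: "variable v \<in> ?T" if "v \<in> A" "v \<notin> U" for v
  proof -
    have "variable v \<in> ?I"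
      unfolding variable_def by (rule monom_mem_restricted_ideal) (use that in auto)
    then show ?thesis using I by blast
  qed
  have diff: "variable v - \<sigma> v \<in> ?T \<and> \<sigma> v \<in> polys_in A" if v: "v \<in> A" for v
  proof -
    consider "v \<notin> U" | i where "i < k" "v = s i" | "v \<in> U" "\<And>i. i < k \<Longrightarrow> v \<noteq> s i" by blast
    then show ?thesis
    proof cases
      case 1
      then show ?thesis using outside[OF v] \<sigma>(1) polys.zero_mem by simp
    next
      case (2 i)
      have "class_sum (V i) = (\<Sum>v\<in>V i \<inter> U. variable v) + (\<Sum>v\<in>V i - U. variable v)"
        unfolding class_sum_def by (rule sum.Int_Diff[OF finV[OF 2(1)]])
      also have "(\<Sum>v\<in>V i \<inter> U. variable v) = variable (s i) + class_sum (V i \<inter> U - {s i})"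
        unfolding class_sum_def using s[OF 2(1)] finV[OF 2(1)] by (intro sum.remove) auto
      finally have sum: "class_sum (V i) =
        (variable (s i) + class_sum (V i \<inter> U - {s i})) + (\<Sum>v\<in>V i - U. variable v :: 'k mpoly)" .
      have eq: "variable v - \<sigma> v = class_sum (V i) - (\<Sum>v\<in>V i - U. variable v)"
        unfolding sum 2(2) \<sigma>(2)[OF 2(1)] by simp
      have "class_sum (V i) \<in> set (map (\<lambda>i. class_sum (V i) :: 'k mpoly) [0..<k])" using 2(1) by simp
      then have "class_sum (V i) \<in> ?T"
        using polys.set_subset_adjoin_list[OF ideal_of_restricted_ideal mem] by blast
      moreover have "(\<Sum>v\<in>V i - U. variable v) \<in> ?T"
        by (rule polys.ideal_of_sum[OF T]) (use outside A(3)[OF 2(1)] in blast)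
      ultimately have "variable v - \<sigma> v \<in> ?T"
        unfolding eq by (rule polys.ideal_of_diff[OF T])
      moreover have "\<sigma> v \<in> polys_in A"
        unfolding 2(2) \<sigma>(2)[OF 2(1)] using A by (intro polys.uminus_mem class_sum_mem) blast
      ultimately show ?thesis by blast
    next
      case 3
      then show ?thesis using \<sigma>(3)[of v] polys.ideal_ofD(1)[OF T] variable_mem[OF v] by simp
    qed
  qed
  show "?K \<subseteq> ?T"
  proof
    fix p assume p: "p \<in> ?K"
    then have "p - subst \<sigma> p \<in> ?T"
      by (intro minus_subst_mem[of p A] T) (use diff in auto)
    then show "p \<in> ?T" using p by simp
  qed
qed

text \<open>
  Modulo the previous class sums one computes in a polynomial ring, which is a domain, and there the
  next class sum is nonzero as its class meets \<open>U\<close>.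
\<close>

lemma weakly_regular_independent:
  fixes V :: "nat \<Rightarrow> nat set"
  assumes A: "finite A" "U \<subseteq> A" "\<And>i. i < a \<Longrightarrow> V i \<subseteq> A"
    and indep: "stable_set E U"
    and s: "\<And>i. i < a \<Longrightarrow> s i \<in> U \<inter> V i"
    and disj: "\<And>i j. i < a \<Longrightarrow> j < a \<Longrightarrow> i \<noteq> j \<Longrightarrow> V i \<inter> V j = {}"
  shows "polys.weakly_regular A (restricted_ideal E A U :: 'k::field mpoly set) (map (\<lambda>i. class_sum (V i)) [0..<a])"
  unfolding polys.weakly_regular_iff_nth
proof (intro allI impI ballI)
  let ?\<theta> = "map (\<lambda>i. class_sum (V i)) [0..<a] :: 'k mpoly list"
  fix k g assume "k < length ?\<theta>" and g: "g \<in> polys_in A"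
    and mem: "?\<theta> ! k * g \<in> polys.adjoin_list A (restricted_ideal E A U) (take k ?\<theta>)"
  then have k: "k < a" by simp
  \<comment> \<open>the index is unique because the \<open>s i\<close> lie in disjoint classes\<close>
  define \<sigma> :: "nat \<Rightarrow> 'k mpoly" where
    "\<sigma> v = (if v \<notin> U then 0 else if \<exists>i<k. v = s i then - class_sum (V (THE i. i < k \<and> v = s i) \<inter> U - {v}) else variable v)" for v
  have s_neq: "s i \<noteq> s j" if "i < a" "j < a" "i \<noteq> j" for i j
    using s[OF that(1)] s[OF that(2)] disj[OF that] by auto
  have \<sigma>s: "\<sigma> (s i) = - class_sum (V i \<inter> U - {s i})" if "i < k" for i
  proof -
    have "(THE j. j < k \<and> s i = s j) = i"
    proof (rule the_equality)
      fix j assume "j < k \<and> s i = s j"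
      then show "j = i" using s_neq[of i j] that k by fastforce
    qed (use that in simp)
    moreover have "s i \<in> U" using s that k by auto
    ultimately show ?thesis unfolding \<sigma>_def using that by auto
  qed
  have kernel: "polys.adjoin_list A (restricted_ideal E A U) (take k ?\<theta>) = {p \<in> polys_in A. subst \<sigma> p = 0}"
  proof -
    have take: "take k ?\<theta> = map (\<lambda>i. class_sum (V i)) [0..<k]" using k by (simp add: take_map)
    show ?thesis unfolding take
    proof (rule adjoin_list_eq_kernel[OF A(1,2) _ indep])
      show "\<sigma> v = variable v" if "v \<in> U" "\<And>i. i < k \<Longrightarrow> v \<noteq> s i" for v
        unfolding \<sigma>_def using that by auto
      show "\<sigma> v = 0" if "v \<notin> U" for v unfolding \<sigma>_def using that by simp
    qed (use A(3) s disj k \<sigma>s in auto)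
  qed
  have "subst \<sigma> (class_sum (V k)) = (\<Sum>v\<in>V k. \<sigma> v)" by (simp add: class_sum_def subst_sum)
  also have "\<dots> = (\<Sum>v\<in>V k \<inter> U. \<sigma> v)"
    by (rule sum.mono_neutral_right) (use A(1) A(3)[OF k] finite_subset in \<open>auto simp: \<sigma>_def\<close>)
  also have "\<dots> = class_sum (V k \<inter> U)"
    unfolding class_sum_def
  proof (rule sum.cong[OF refl])
    fix v assume v: "v \<in> V k \<inter> U"
    have "v \<noteq> s i" if "i < k" for i using v s[of i] disj[of i k] that k by auto
    then show "\<sigma> v = variable v" unfolding \<sigma>_def using v by auto
  qed
  finally have "subst \<sigma> (class_sum (V k)) \<noteq> 0"
    using class_sum_nonzero[of "V k \<inter> U" "s k"] s[OF k] A(1,2) finite_subset by auto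
  moreover have "subst \<sigma> (class_sum (V k)) * subst \<sigma> g = 0"
    using mem k unfolding kernel by (simp add: subst_mult)
  ultimately have "subst \<sigma> g = 0" by simp
  then show "g \<in> polys.adjoin_list A (restricted_ideal E A U) (take k ?\<theta>)"
    unfolding kernel using g by simp
qed

text \<open>
  Induction on the number of vertices, by deleting either a vertex \<open>x\<close> or its neighbours. The vertex \<open>x\<close> is
  chosen non-isolated and different from all \<open>s\<^sub>i\<close>, which is possible because \<open>s\<^sub>i\<close> and \<open>s\<^sub>j\<close> are never
  adjacent. Deleting \<open>x\<close> keeps every \<open>s\<^sub>i\<close>. Deleting the neighbours of \<open>x\<close> may remove some \<open>s\<^sub>i\<close>, but then \<open>x\<close>
  belongs to the class \<open>V\<^sub>i\<close> and has become isolated, so it takes the place of \<open>s\<^sub>i\<close>.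
\<close>

lemma weakly_regular_packing:
  fixes V :: "nat \<Rightarrow> nat set"
  assumes E: "sym E" "irrefl E"
    and A: "finite A" "\<And>i. i < a \<Longrightarrow> V i \<subseteq> A"
    and disj: "\<And>i j. i < a \<Longrightarrow> j < a \<Longrightarrow> i \<noteq> j \<Longrightarrow> V i \<inter> V j = {}"
  shows "U \<subseteq> A \<Longrightarrow> (\<And>i. i < a \<Longrightarrow> s i \<in> U \<inter> V i \<and> E `` {s i} \<inter> U \<subseteq> V i) \<Longrightarrow>
    polys.weakly_regular A (restricted_ideal E A U :: 'k::field mpoly set) (map (\<lambda>i. class_sum (V i)) [0..<a])"
proof (induction "card U" arbitrary: U s rule: less_induct)
  case less
  let ?\<theta> = "map (\<lambda>i. class_sum (V i)) [0..<a] :: 'k mpoly list"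
  have s: "s i \<in> U" "s i \<in> V i" "E `` {s i} \<inter> U \<subseteq> V i" if "i < a" for i
    using less.prems(2)[OF that] by auto
  have finU: "finite U" using A(1) less.prems(1) finite_subset by blast
  show ?case
  proof (cases "stable_set E U")
    case True
    show ?thesis by (rule weakly_regular_independent[OF A(1) less.prems(1) A(2) True _ disj]) (use s in auto)
  next
    case False
    then obtain x' y' where xy': "x' \<in> U" "y' \<in> U" "(x', y') \<in> E" unfolding stable_set_def by blast
    have "\<exists>x y. x \<in> U \<and> y \<in> U \<and> (x, y) \<in> E \<and> x \<notin> s ` {..<a}"
    proof (cases "x' \<in> s ` {..<a}")
      case True
      then obtain i where i: "i < a" "x' = s i" by auto
      have y: "y' \<in> V i" using s(3)[OF i(1)] xy' i(2) by blast
      have "y' \<notin> s ` {..<a}"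
      proof
        assume "y' \<in> s ` {..<a}"
        then obtain j where j: "j < a" "y' = s j" by auto
        then have "j = i" using disj[OF i(1) j(1)] y s(2)[OF j(1)] by blast
        then show False using xy'(3) i(2) j(2) E(2) unfolding irrefl_def by blast
      qed
      then show ?thesis using xy' E(1) unfolding sym_def by blast
    qed (use xy' in blast)
    then obtain x y where xy: "x \<in> U" "y \<in> U" "(x, y) \<in> E" "x \<notin> s ` {..<a}" by blast
    have xA: "x \<in> A" using xy(1) less.prems(1) by blast
    have xx: "(x, x) \<notin> E" using E(2) unfolding irrefl_def by blast
    have colon: "polys.weakly_regular A (restricted_ideal E A (U - E `` {x}) :: 'k mpoly set) ?\<theta>"
    proof (rule less.hyps[where s = "\<lambda>i. if (x, s i) \<in> E then x else s i"])
      show "card (U - E `` {x}) < card U"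
        using xy(2,3) finU by (intro psubset_card_mono) auto
      fix i assume i: "i < a"
      show "(if (x, s i) \<in> E then x else s i) \<in> (U - E `` {x}) \<inter> V i \<and>
        E `` {if (x, s i) \<in> E then x else s i} \<inter> (U - E `` {x}) \<subseteq> V i"
      proof (cases "(x, s i) \<in> E")
        case True
        then have "(s i, x) \<in> E" using E(1) unfolding sym_def by blast
        then have "x \<in> V i" using s(3)[OF i] xy(1) by blast
        then show ?thesis using True xy(1) xx by auto
      next
        case False
        then show ?thesis using s[OF i] by auto
      qed
    qed (use less.prems(1) in blast)
    have adjoin: "polys.weakly_regular A (restricted_ideal E A (U - {x}) :: 'k mpoly set) ?\<theta>"
    proof (rule less.hyps[where s = s])
      show "card (U - {x}) < card U" using xy(1) finU by (intro psubset_card_mono) auto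
      fix i assume i: "i < a"
      have "s i \<noteq> x" using xy(4) i by blast
      then show "s i \<in> (U - {x}) \<inter> V i \<and> E `` {s i} \<inter> (U - {x}) \<subseteq> V i" using s[OF i] by blast
    qed (use less.prems(1) in blast)
    have "polys.weakly_regular A (polys.colon A (restricted_ideal E A U) (variable x)) ?\<theta>"
      unfolding colon_restricted_ideal[OF E(1) xx xA xy(1)] by (rule colon)
    moreover have "polys.weakly_regular A (polys.adjoin A (restricted_ideal E A U) (variable x)) ?\<theta>"
      unfolding adjoin_restricted_ideal[OF xA] by (rule adjoin)
    moreover have "set ?\<theta> \<subseteq> polys_in A" by (rule class_sums_mem[OF A(2)])
    ultimately show ?thesis
      using polys.weakly_regular_colon_adjoin[OF ideal_of_restricted_ideal variable_mem[OF xA]] by blast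
  qed
qed

section \<open>Quotients of polynomial rings\<close>

lemma carrier_polynomial_ring [simp]: "carrier (polynomial_ring K n) = polys_in {1..n}"
  by (simp add: polynomial_ring_def polys_in_def)

lemma polynomial_ring_ops [simp]:
  "x \<oplus>\<^bsub>polynomial_ring K n\<^esub> y = x + y" "x \<otimes>\<^bsub>polynomial_ring K n\<^esub> y = x * y"
  "\<zero>\<^bsub>polynomial_ring K n\<^esub> = 0" "\<one>\<^bsub>polynomial_ring K n\<^esub> = 1"
  by (simp_all add: polynomial_ring_def)

lemma (in ring) ideal_iff:
  "ideal T R \<longleftrightarrow> T \<subseteq> carrier R \<and> \<zero> \<in> T \<and> (\<forall>x\<in>T. \<forall>y\<in>T. x \<oplus> y \<in> T) \<and>
    (\<forall>s\<in>carrier R. \<forall>x\<in>T. s \<otimes> x \<in> T \<and> x \<otimes> s \<in> T)" (is "?l \<longleftrightarrow> ?r")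
proof
  assume ?l
  then interpret T: ideal T R .
  show ?r by (intro conjI ballI T.a_subset T.zero_closed T.a_closed T.I_l_closed T.I_r_closed)
next
  assume T: ?r
  show ?l
  proof (rule idealI[OF ring_axioms])
    show "subgroup T (add_monoid R)"
    proof (rule group.subgroupI)
      show "group (add_monoid R)" by (rule a_group)
      show "T \<subseteq> carrier (add_monoid R)" "T \<noteq> {}" using T by (simp, blast)
      show "x \<otimes>\<^bsub>add_monoid R\<^esub> y \<in> T" if "x \<in> T" "y \<in> T" for x y using T that by simp
      fix x assume x: "x \<in> T"
      then have xR: "x \<in> carrier R" using T by blast
      have "\<ominus> \<one> \<otimes> x \<in> T" using T x by (meson a_inv_closed one_closed)
      then have "\<ominus> x \<in> T" using xR by (simp add: l_minus)
      then show "inv\<^bsub>add_monoid R\<^esub> x \<in> T" by (simp only: a_inv_def)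
    qed
    show "x \<otimes> a \<in> T" "a \<otimes> x \<in> T" if "a \<in> T" "x \<in> carrier R" for a x using T that by blast+
  qed
qed

lemma (in cring) nonzerodivisor_quotient_iff:
  assumes "ideal T R" "f \<in> carrier R"
  shows "nonzerodivisor (R Quot T) (T +> f) \<longleftrightarrow> (\<forall>g\<in>carrier R. f \<otimes> g \<in> T \<longrightarrow> g \<in> T)"
proof -
  interpret T: ideal T R by fact
  have mult: "(T +> f) \<otimes>\<^bsub>R Quot T\<^esub> (T +> g) = T +> (f \<otimes> g)" if "g \<in> carrier R" for g
    using T.rcoset_mult_add[OF assms(2) that] by (simp add: FactRing_def)
  have zero: "T +> g = \<zero>\<^bsub>R Quot T\<^esub> \<longleftrightarrow> g \<in> T" if g: "g \<in> carrier R" for g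
  proof
    assume "T +> g = \<zero>\<^bsub>R Quot T\<^esub>"
    then show "g \<in> T" using T.a_rcos_self[OF g] by (simp add: FactRing_def)
  next
    assume "g \<in> T"
    then show "T +> g = \<zero>\<^bsub>R Quot T\<^esub>" using T.a_rcos_const by (simp add: FactRing_def)
  qed
  have carrier: "carrier (R Quot T) = (\<lambda>g. T +> g) ` carrier R"
    unfolding FactRing_def A_RCOSETS_def' by auto
  have "nonzerodivisor (R Quot T) (T +> f) \<longleftrightarrow>
    (\<forall>g\<in>carrier R. (T +> f) \<otimes>\<^bsub>R Quot T\<^esub> (T +> g) = \<zero>\<^bsub>R Quot T\<^esub> \<longrightarrow> T +> g = \<zero>\<^bsub>R Quot T\<^esub>)"
    unfolding nonzerodivisor_def carrier using assms(2) by blast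
  also have "\<dots> \<longleftrightarrow> (\<forall>g\<in>carrier R. f \<otimes> g \<in> T \<longrightarrow> g \<in> T)"
    by (intro ball_cong refl) (simp only: mult zero m_closed[OF assms(2)])
  finally show ?thesis .
qed

text \<open>
  The dictionary between the quotient ring \<open>A = K[x\<^sub>1,\<dots>,x\<^sub>n]/I\<close>, in which depth and dimension are defined,
  and the ideals of the polynomial ring above \<open>I\<close>.
\<close>

locale polynomial_quotient =
  fixes K :: "'k::field itself" and n :: nat and I :: "'k mpoly set"
  assumes I: "polys.ideal_of {1..n} I"
begin

abbreviation S :: "'k mpoly set" where "S \<equiv> polys_in {1..n}"

abbreviation A :: "'k mpoly set ring" where "A \<equiv> polynomial_ring K n Quot I"

lemma S_add: "p \<in> S \<Longrightarrow> q \<in> S \<Longrightarrow> p + q \<in> S"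
  and S_mult: "p \<in> S \<Longrightarrow> q \<in> S \<Longrightarrow> p * q \<in> S"
  and S_zero: "0 \<in> S" and S_one: "1 \<in> S"
  by (simp_all only: polys.add_mem polys.mult_mem polys.zero_mem polys.one_mem)

definition \<pi> :: "'k mpoly \<Rightarrow> 'k mpoly set" where "\<pi> p = I +>\<^bsub>polynomial_ring K n\<^esub> p"

sublocale R: cring "polynomial_ring K n"
  by (rule polynomial_ring_cring)

lemma ideal_iff_ideal_of: "ideal T (polynomial_ring K n) \<longleftrightarrow> polys.ideal_of {1..n} T"
proof -
  have "s * x \<in> T \<and> x * s \<in> T \<longleftrightarrow> s * x \<in> T" for s x
    by (simp only: mult.commute[of x s] conj_absorb)
  then show ?thesis
    unfolding R.ideal_iff polys.ideal_of_def carrier_polynomial_ring polynomial_ring_ops by (simp only:)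
qed

sublocale I: ideal I "polynomial_ring K n"
  using I by (simp add: ideal_iff_ideal_of)

sublocale A: cring A
  by (rule I.quotient_is_cring[OF R.cring_axioms])

lemma carrier_A: "carrier A = \<pi> ` S"
  unfolding \<pi>_def FactRing_def A_RCOSETS_def' by auto

lemma \<pi>_eq_iff: "p \<in> S \<Longrightarrow> q \<in> S \<Longrightarrow> \<pi> p = \<pi> q \<longleftrightarrow> p - q \<in> I"
proof -
  assume pq: "p \<in> S" "q \<in> S"
  have \<pi>: "\<pi> x = (\<lambda>i. i + x) ` I" for x
    unfolding \<pi>_def a_r_coset_def' by auto
  show ?thesis
  proof
    assume "\<pi> p = \<pi> q"
    moreover have "p \<in> \<pi> p" unfolding \<pi> using polys.ideal_ofD(1)[OF I] by force
    ultimately show "p - q \<in> I" unfolding \<pi> by auto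
  next
    assume d: "p - q \<in> I"
    have sub: "(\<lambda>i. i + x) ` I \<subseteq> (\<lambda>i. i + y) ` I" if "x - y \<in> I" for x y
    proof
      fix z assume "z \<in> (\<lambda>i. i + x) ` I"
      then obtain i where i: "i \<in> I" "z = i + x" by blast
      then have "z = (i + (x - y)) + y" "i + (x - y) \<in> I"
        using polys.ideal_ofD(2)[OF I i(1) that] by (simp, blast)
      then show "z \<in> (\<lambda>i. i + y) ` I" by blast
    qed
    have "q - p \<in> I" using polys.ideal_of_uminus[OF I d] by simp
    then show "\<pi> p = \<pi> q" unfolding \<pi> using sub[OF d] sub[of q p] by blast
  qed
qed

lemma \<pi>_mult: "p \<in> S \<Longrightarrow> q \<in> S \<Longrightarrow> \<pi> p \<otimes>\<^bsub>A\<^esub> \<pi> q = \<pi> (p * q)"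
  unfolding \<pi>_def using I.rcoset_mult_add[of p q] by (simp add: FactRing_def)

lemma \<pi>_add: "p \<in> S \<Longrightarrow> q \<in> S \<Longrightarrow> \<pi> p \<oplus>\<^bsub>A\<^esub> \<pi> q = \<pi> (p + q)"
  unfolding \<pi>_def using I.a_rcos_sum[of p q] by (simp add: FactRing_def)

lemma \<pi>_zero: "\<zero>\<^bsub>A\<^esub> = \<pi> 0"
  unfolding \<pi>_def using I.a_rcos_const[of 0] polys.ideal_ofD(1)[OF I] by (simp add: FactRing_def)

lemma \<pi>_mem_image_iff:
  assumes T: "polys.ideal_of {1..n} T" "I \<subseteq> T" and p: "p \<in> S"
  shows "\<pi> p \<in> \<pi> ` T \<longleftrightarrow> p \<in> T"
proof
  assume "\<pi> p \<in> \<pi> ` T"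
  then obtain q where q: "q \<in> T" "\<pi> p = \<pi> q" by blast
  have "q \<in> S" using q(1) polys.ideal_of_subset[OF T(1)] by blast
  then have "p - q \<in> T" using \<pi>_eq_iff[OF p] q(2) T(2) by blast
  then have "p - q + q \<in> T" using polys.ideal_ofD(2)[OF T(1)] q(1) by blast
  then show "p \<in> T" by simp
qed blast

lemma ideal_image:
  assumes T: "polys.ideal_of {1..n} T"
  shows "ideal (\<pi> ` T) A"
proof -
  have TS: "p \<in> S" if "p \<in> T" for p using that polys.ideal_of_subset[OF T] by blast
  show ?thesis
    unfolding A.ideal_iff
  proof (intro conjI ballI)
    show "\<pi> ` T \<subseteq> carrier A" unfolding carrier_A using TS by blast
    show "\<zero>\<^bsub>A\<^esub> \<in> \<pi> ` T" unfolding \<pi>_zero using polys.ideal_ofD(1)[OF T] by blast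
    show "x \<oplus>\<^bsub>A\<^esub> y \<in> \<pi> ` T" if xy: "x \<in> \<pi> ` T" "y \<in> \<pi> ` T" for x y
    proof -
      obtain p q where pq: "x = \<pi> p" "y = \<pi> q" "p \<in> T" "q \<in> T" using xy by blast
      then show ?thesis using \<pi>_add[of p q] TS polys.ideal_ofD(2)[OF T] by simp
    qed
    have mult: "s \<otimes>\<^bsub>A\<^esub> x \<in> \<pi> ` T" if sx: "s \<in> carrier A" "x \<in> \<pi> ` T" for s x
    proof -
      obtain p q where pq: "s = \<pi> p" "x = \<pi> q" "p \<in> S" "q \<in> T" using sx unfolding carrier_A by blast
      then show ?thesis using \<pi>_mult[of p q] TS polys.ideal_ofD(3)[OF T] by simp
    qed
    show "s \<otimes>\<^bsub>A\<^esub> x \<in> \<pi> ` T" if "s \<in> carrier A" "x \<in> \<pi> ` T" for s x by (rule mult[OF that])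
    show "x \<otimes>\<^bsub>A\<^esub> s \<in> \<pi> ` T" if sx: "s \<in> carrier A" "x \<in> \<pi> ` T" for s x
    proof -
      have "x \<in> carrier A" using sx(2) TS unfolding carrier_A by blast
      then show ?thesis using mult[OF sx] A.m_comm[OF sx(1)] by metis
    qed
  qed
qed

definition pullback :: "'k mpoly set set \<Rightarrow> 'k mpoly set" where
  "pullback P = {p \<in> S. \<pi> p \<in> P}"

lemma ideal_of_pullback:
  assumes P: "ideal P A"
  shows "polys.ideal_of {1..n} (pullback P)" "I \<subseteq> pullback P"
proof -
  note P' = P[unfolded A.ideal_iff]
  have P_add: "x \<oplus>\<^bsub>A\<^esub> y \<in> P" if "x \<in> P" "y \<in> P" for x y using P' that by blast
  have P_mult: "s \<otimes>\<^bsub>A\<^esub> x \<in> P" if "s \<in> carrier A" "x \<in> P" for s x using P' that by blast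
  have P_zero: "\<pi> 0 \<in> P" using P' unfolding \<pi>_zero by blast
  show "polys.ideal_of {1..n} (pullback P)"
    unfolding polys.ideal_of_def pullback_def
  proof (intro conjI ballI)
    fix x y assume "x \<in> {p \<in> S. \<pi> p \<in> P}" "y \<in> {p \<in> S. \<pi> p \<in> P}"
    then show "x + y \<in> {p \<in> S. \<pi> p \<in> P}"
      using P_add[of "\<pi> x" "\<pi> y"] \<pi>_add[of x y] S_add[of x y] by simp
  next
    fix s x assume "s \<in> S" "x \<in> {p \<in> S. \<pi> p \<in> P}"
    then show "s * x \<in> {p \<in> S. \<pi> p \<in> P}"
      using P_mult[of "\<pi> s" "\<pi> x"] \<pi>_mult[of s x] S_mult[of s x] carrier_A by simp
  qed (use P_zero S_zero in auto)
  show "I \<subseteq> pullback P"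
  proof
    fix p assume p: "p \<in> I"
    then have "p \<in> S" using polys.ideal_of_subset[OF I] by blast
    then have "\<pi> p = \<pi> 0" using \<pi>_eq_iff[of p 0] p S_zero by simp
    then show "p \<in> pullback P" unfolding pullback_def using P_zero \<open>p \<in> S\<close> by simp
  qed
qed

lemma genideal_image:
  assumes ps: "set ps \<subseteq> S"
  shows "Idl\<^bsub>A\<^esub> (\<pi> ` set ps) = \<pi> ` polys.adjoin_list {1..n} I ps"
proof
  let ?T = "polys.adjoin_list {1..n} I ps"
  have T: "polys.ideal_of {1..n} ?T" by (rule polys.ideal_of_adjoin_list[OF I ps])
  show "Idl\<^bsub>A\<^esub> (\<pi> ` set ps) \<subseteq> \<pi> ` ?T"
    by (rule A.genideal_minimal[OF ideal_image[OF T]])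
      (use polys.set_subset_adjoin_list[OF I ps] in blast)
  have sub: "\<pi> ` set ps \<subseteq> carrier A" unfolding carrier_A using ps by blast
  let ?J = "Idl\<^bsub>A\<^esub> (\<pi> ` set ps)"
  have J: "ideal ?J A" by (rule A.genideal_ideal[OF sub])
  have "set ps \<subseteq> pullback ?J"
    unfolding pullback_def using ps A.genideal_self[OF sub] by blast
  then have "?T \<subseteq> pullback ?J"
    by (intro polys.adjoin_list_subset ideal_of_pullback[OF J])
  then show "\<pi> ` ?T \<subseteq> ?J" unfolding pullback_def by blast
qed

lemma regular_sequence_iff:
  assumes ps: "set ps \<subseteq> S"
  shows "regular_sequence A (map \<pi> ps) \<longleftrightarrow>
    polys.weakly_regular {1..n} I ps \<and> polys.adjoin_list {1..n} I ps \<noteq> S"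
proof -
  let ?T = "\<lambda>i. polys.adjoin_list {1..n} I (take i ps)"
  have take: "set (take i ps) \<subseteq> S" for i using ps set_take_subset by fast
  have T: "polys.ideal_of {1..n} (?T i)" "I \<subseteq> ?T i" for i
    by (rule polys.ideal_of_adjoin_list[OF I take], rule polys.subset_adjoin_list)
  have sub: "set (map \<pi> ps) \<subseteq> carrier A" unfolding carrier_A using ps by auto
  have idl: "Idl\<^bsub>A\<^esub> (set (take i (map \<pi> ps))) = \<pi> ` ?T i" for i
    using genideal_image[OF take] by (simp add: take_map)
  have nzd: "nonzerodivisor (A Quot (\<pi> ` ?T i)) (\<pi> ` ?T i +>\<^bsub>A\<^esub> \<pi> (ps ! i)) \<longleftrightarrow>
    (\<forall>g\<in>S. ps ! i * g \<in> ?T i \<longrightarrow> g \<in> ?T i)" if i: "i < length ps" for i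
  proof -
    have f: "ps ! i \<in> S" using ps i nth_mem by blast
    then have fA: "\<pi> (ps ! i) \<in> carrier A" unfolding carrier_A by blast
    have mult: "\<pi> (ps ! i) \<otimes>\<^bsub>A\<^esub> \<pi> g \<in> \<pi> ` ?T i \<longleftrightarrow> ps ! i * g \<in> ?T i" if "g \<in> S" for g
      unfolding \<pi>_mult[OF f that] by (rule \<pi>_mem_image_iff[OF T S_mult[OF f that]])
    have mem: "\<pi> g \<in> \<pi> ` ?T i \<longleftrightarrow> g \<in> ?T i" if "g \<in> S" for g
      by (rule \<pi>_mem_image_iff[OF T that])
    show ?thesis
      unfolding A.nonzerodivisor_quotient_iff[OF ideal_image[OF T(1)] fA] carrier_A ball_simps(9)
      by (intro ball_cong refl) (simp only: mult mem)
  qed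
  have "Idl\<^bsub>A\<^esub> (set (map \<pi> ps)) \<noteq> carrier A \<longleftrightarrow> polys.adjoin_list {1..n} I ps \<noteq> S"
  proof -
    have T': "polys.ideal_of {1..n} (polys.adjoin_list {1..n} I ps)" "I \<subseteq> polys.adjoin_list {1..n} I ps"
      by (rule polys.ideal_of_adjoin_list[OF I ps], rule polys.subset_adjoin_list)
    have "\<pi> ` polys.adjoin_list {1..n} I ps = \<pi> ` S \<longleftrightarrow> polys.adjoin_list {1..n} I ps = S"
      (is "?l = ?r")
    proof
      assume ?l
      then have "p \<in> polys.adjoin_list {1..n} I ps" if "p \<in> S" for p
        using \<pi>_mem_image_iff[OF T' that] that by blast
      then show ?r using polys.ideal_of_subset[OF T'(1)] by blast
    qed simp
    then show ?thesis unfolding carrier_A set_map genideal_image[OF ps] by simp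
  qed
  then show ?thesis
    unfolding regular_sequence_def Let_def idl polys.weakly_regular_iff_nth length_map
    using sub nzd nth_map[of _ ps \<pi>] by metis
qed

lemma prime_of_pullback:
  assumes "primeideal P A"
  shows "polys.prime_of {1..n} (pullback P)"
proof -
  interpret P: primeideal P A by fact
  note T = ideal_of_pullback[OF P.is_ideal]
  have "1 \<notin> pullback P"
  proof
    assume "1 \<in> pullback P"
    then have "s * 1 \<in> pullback P" if "s \<in> S" for s by (rule polys.ideal_ofD(3)[OF T(1) that])
    then have "S \<subseteq> pullback P" by auto
    then have "carrier A \<subseteq> P" unfolding carrier_A pullback_def by blast
    then show False using P.I_notcarr P.a_subset by blast
  qed
  moreover have "x \<in> pullback P \<or> y \<in> pullback P" if "x \<in> S" "y \<in> S" "x * y \<in> pullback P" for x y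
  proof -
    have "\<pi> x \<otimes>\<^bsub>A\<^esub> \<pi> y \<in> P" unfolding \<pi>_mult[OF that(1,2)] using that(3) unfolding pullback_def by blast
    moreover have "\<pi> x \<in> carrier A" "\<pi> y \<in> carrier A" using that(1,2) unfolding carrier_A by blast+
    ultimately have "\<pi> x \<in> P \<or> \<pi> y \<in> P" using P.I_prime by blast
    then show ?thesis using that(1,2) unfolding pullback_def by blast
  qed
  ultimately show ?thesis unfolding polys.prime_of_def using T(1) by blast
qed

lemma primeideal_image:
  assumes T: "polys.prime_of {1..n} T" "I \<subseteq> T"
  shows "primeideal (\<pi> ` T) A"
proof -
  have T': "polys.ideal_of {1..n} T" "1 \<notin> T" using T(1) unfolding polys.prime_of_def by blast+
  note mem = \<pi>_mem_image_iff[OF T'(1) T(2)]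
  show ?thesis
  proof (rule primeidealI[OF ideal_image[OF T'(1)] A.cring_axioms])
    have "\<pi> 1 \<in> carrier A" "\<pi> 1 \<notin> \<pi> ` T"
      using mem[OF S_one] T'(2) S_one unfolding carrier_A by blast+
    then show "carrier A \<noteq> \<pi> ` T" by blast
    fix a b assume ab: "a \<in> carrier A" "b \<in> carrier A" "a \<otimes>\<^bsub>A\<^esub> b \<in> \<pi> ` T"
    obtain p q where pq: "a = \<pi> p" "b = \<pi> q" "p \<in> S" "q \<in> S" using ab(1,2) unfolding carrier_A by blast
    then have "p * q \<in> T" using ab(3) \<pi>_mult[OF pq(3,4)] mem[OF S_mult[OF pq(3,4)]] by simp
    then have "p \<in> T \<or> q \<in> T" using T(1) pq(3,4) unfolding polys.prime_of_def by blast
    then show "a \<in> \<pi> ` T \<or> b \<in> \<pi> ` T" using pq(1,2) by blast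
  qed
qed

end

section \<open>Depth and dimension of edge rings\<close>

locale edge_relation =
  fixes n :: nat and E :: "(nat \<times> nat) set"
  assumes sym_E: "sym E" and irrefl_E: "irrefl E" and E_subset: "E \<subseteq> {1..n} \<times> {1..n}"
begin

abbreviation edge_polys :: "'k::field mpoly set" where
  "edge_polys \<equiv> restricted_ideal E {1..n} {1..n}"

lemma edge_generators_subset:
  "{variable u * variable v | u v. (u, v) \<in> E} \<subseteq> (polys_in {1..n} :: 'k::field mpoly set)"
proof
  fix x :: "'k mpoly" assume "x \<in> {variable u * variable v | u v. (u, v) \<in> E}"
  then obtain u v where uv: "x = variable u * variable v" "u \<in> {1..n}" "v \<in> {1..n}"
    using E_subset by blast
  show "x \<in> polys_in {1..n}"
    unfolding uv(1) by (intro polys.mult_mem variable_mem uv(2,3))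
qed

text \<open>
  A monomial whose support contains an edge is a multiple of the generator of this edge.
\<close>

lemma genideal_edges:
  "Idl\<^bsub>polynomial_ring K n\<^esub> {variable u * variable v | u v. (u, v) \<in> E} = (edge_polys :: 'k::field mpoly set)"
  (is "Idl\<^bsub>_\<^esub> ?G = _")
proof
  interpret polynomial_quotient K n "edge_polys :: 'k mpoly set"
    by unfold_locales (rule ideal_of_restricted_ideal)
  have G: "?G \<subseteq> carrier (polynomial_ring K n)"
    unfolding carrier_polynomial_ring by (rule edge_generators_subset)
  show "Idl\<^bsub>polynomial_ring K n\<^esub> ?G \<subseteq> edge_polys"
  proof (rule R.genideal_minimal[OF I.is_ideal], safe)
    fix u v assume uv: "(u, v) \<in> E"
    have "Mon (Poly_Mapping.single u 1 + Poly_Mapping.single v 1) (1::'k) \<in> edge_polys"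
    proof (rule monom_mem_restricted_ideal)
      show "Poly_Mapping.keys (Poly_Mapping.single u (1::nat) + Poly_Mapping.single v 1) \<subseteq> {1..n}"
        using uv E_subset by (auto simp: keys_add_nat)
      show "\<not> stable_set E (Poly_Mapping.keys (Poly_Mapping.single u (1::nat) + Poly_Mapping.single v 1))"
        using uv by (auto simp: keys_add_nat stable_set_def)
    qed
    then show "variable u * variable v \<in> (edge_polys :: 'k mpoly set)"
      by (simp add: variable_def mult_single)
  qed
  let ?J = "Idl\<^bsub>polynomial_ring K n\<^esub> ?G"
  have J: "polys.ideal_of {1..n} ?J"
    using R.genideal_ideal[OF G] unfolding ideal_iff_ideal_of .
  show "edge_polys \<subseteq> ?J"
  proof
    fix p :: "'k mpoly" assume p: "p \<in> edge_polys"
    show "p \<in> ?J"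
    proof (rule mem_ideal_if_monoms[OF J])
      fix m assume m: "m \<in> Poly_Mapping.keys p"
      let ?c = "Poly_Mapping.lookup p m"
      have mA: "Poly_Mapping.keys m \<subseteq> {1..n}" using restricted_idealD(1)[OF p] m unfolding polys_in_def by blast
      obtain u v where uv: "u \<in> Poly_Mapping.keys m" "v \<in> Poly_Mapping.keys m" "(u, v) \<in> E"
        using restricted_idealD(2)[OF p m mA] unfolding stable_set_def by blast
      have "u \<noteq> v" using uv(3) irrefl_E unfolding irrefl_def by blast
      then have v: "v \<in> Poly_Mapping.keys (m - Poly_Mapping.single u 1)"
        using uv(2) by (simp add: in_keys_iff lookup_minus lookup_single_not_eq)
      let ?q = "Mon (m - Poly_Mapping.single u 1 - Poly_Mapping.single v 1) ?c"
      have "Mon m ?c = variable u * (variable v * ?q)"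
        by (simp only: monom_split_variable[OF uv(1)] monom_split_variable[OF v])
      moreover have "?q \<in> polys_in {1..n}"
        using mA keys_minus_nat[of m] keys_minus_nat[of "m - Poly_Mapping.single u 1"] by (intro monom_mem) blast
      moreover have "variable u * variable v \<in> ?J"
        using R.genideal_self[OF G] uv(3) by blast
      ultimately show "Mon m ?c \<in> ?J"
        using polys.ideal_ofD(4)[OF J, of ?q "variable u * variable v"] by (simp only: mult.assoc)
    qed
  qed
qed

end

locale edge_quotient = edge_relation n E + polynomial_quotient K n "edge_polys :: 'k::field mpoly set"
  for n E and K :: "'k::field itself"
begin

declare One_nat_def [simp del]

definition irrelevant :: "'k mpoly set set" where
  "irrelevant = Idl\<^bsub>A\<^esub> (\<pi> ` variable ` {1..n})"

lemma ideal_irrelevant: "ideal irrelevant A" and variable_irrelevant: "\<pi> ` variable ` {1..n} \<subseteq> irrelevant"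
proof -
  have "\<pi> ` variable ` {1..n} \<subseteq> carrier A"
    unfolding carrier_A using variable_mem by blast
  then show "ideal irrelevant A" "\<pi> ` variable ` {1..n} \<subseteq> irrelevant"
    unfolding irrelevant_def by (rule A.genideal_ideal, rule A.genideal_self)
qed

definition total_degree :: "(nat \<Rightarrow>\<^sub>0 nat) \<Rightarrow> nat" where
  "total_degree m = (\<Sum>v\<in>{1..n}. Poly_Mapping.lookup m v)"

lemma total_degree_add: "total_degree (m + m') = total_degree m + total_degree m'"
  by (simp add: total_degree_def lookup_add sum.distrib)

text \<open>
  Polynomials of order at least \<open>s\<close> modulo the edge ideal: monomials inside the edge ideal have
  infinite order. Powers of an ideal generated by elements of order \<open>1\<close> lie in this filtration, and a
  monomial with independent support escapes it beyond its degree.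
\<close>

definition order_ge :: "nat \<Rightarrow> 'k mpoly set" where
  "order_ge s = {p \<in> S. \<forall>m\<in>Poly_Mapping.keys p. stable_set E (Poly_Mapping.keys m) \<longrightarrow> s \<le> total_degree m}"

lemma order_ge_mult:
  assumes "p \<in> order_ge s" "q \<in> order_ge t"
  shows "p * q \<in> order_ge (s + t)"
proof -
  have "s + t \<le> total_degree m" if m: "m \<in> Poly_Mapping.keys (p * q)" "stable_set E (Poly_Mapping.keys m)" for m
  proof -
    obtain a b where ab: "m = a + b" "a \<in> Poly_Mapping.keys p" "b \<in> Poly_Mapping.keys q"
      by (rule keys_mult_obtain[OF m(1)])
    have "stable_set E (Poly_Mapping.keys a)" "stable_set E (Poly_Mapping.keys b)"
      using stable_set_subset[OF m(2)] by (simp_all add: ab(1) keys_add_nat)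
    then have "s \<le> total_degree a" "t \<le> total_degree b" using assms ab unfolding order_ge_def by blast+
    then show ?thesis by (simp add: ab(1) total_degree_add)
  qed
  then show ?thesis using assms S_mult unfolding order_ge_def by blast
qed

lemma ideal_of_order_ge: "polys.ideal_of {1..n} (order_ge s)"
  unfolding polys.ideal_of_def
proof (intro conjI ballI)
  show "order_ge s \<subseteq> S" unfolding order_ge_def by blast
  show "0 \<in> order_ge s" unfolding order_ge_def using S_zero by simp
next
  fix x y assume xy: "x \<in> order_ge s" "y \<in> order_ge s"
  then show "x + y \<in> order_ge s"
    using keys_add[of x y] S_add unfolding order_ge_def by blast
next
  fix q x assume q: "q \<in> S" and x: "x \<in> order_ge s"
  have "q \<in> order_ge 0" using q unfolding order_ge_def by simp
  then show "q * x \<in> order_ge s" using order_ge_mult[of q 0 x s] x by simp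
qed

lemma edge_polys_order_ge: "edge_polys \<subseteq> order_ge s"
proof
  fix p :: "'k mpoly" assume p: "p \<in> edge_polys"
  have "Poly_Mapping.keys m \<subseteq> {1..n}" if "m \<in> Poly_Mapping.keys p" for m
    using restricted_idealD(1)[OF p] that unfolding polys_in_def by blast
  then show "p \<in> order_ge s" using restricted_idealD[OF p] unfolding order_ge_def by blast
qed

lemma irrelevant_subset: "irrelevant \<subseteq> \<pi> ` order_ge 1"
  unfolding irrelevant_def
proof (rule A.genideal_minimal[OF ideal_image[OF ideal_of_order_ge]], rule image_mono, rule subsetI)
  fix x :: "'k mpoly" assume "x \<in> variable ` {1..n}"
  then obtain v where v: "v \<in> {1..n}" "x = variable v" by blast
  have "total_degree (Poly_Mapping.single v 1) = (\<Sum>w\<in>{1..n}. if w = v then 1 else 0)"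
    unfolding total_degree_def by (intro sum.cong refl) (simp add: lookup_single when_def)
  also have "\<dots> = 1" using v(1) by (simp add: sum.delta)
  finally show "x \<in> order_ge 1"
    using v variable_mem[OF v(1)] unfolding order_ge_def by (simp add: variable_def)
qed

lemma depth_ge:
  fixes V :: "nat \<Rightarrow> nat set"
  assumes reg: "polys.weakly_regular {1..n} edge_polys (map (\<lambda>i. class_sum (V i) :: 'k mpoly) [0..<a])"
    and V: "\<And>i. i < a \<Longrightarrow> V i \<subseteq> {1..n}"
  shows "enat a \<le> depth A irrelevant"
proof -
  let ?\<theta> = "map (\<lambda>i. class_sum (V i)) [0..<a] :: 'k mpoly list"
  have \<theta>: "set ?\<theta> \<subseteq> S" by (rule class_sums_mem[OF V])
  have P: "polys.ideal_of {1..n} (pullback irrelevant)"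
    by (rule ideal_of_pullback(1)[OF ideal_irrelevant])
  have irr: "class_sum (V i) \<in> pullback irrelevant" if "i < a" for i
    unfolding class_sum_def
  proof (rule polys.ideal_of_sum[OF P])
    fix v assume "v \<in> V i"
    then have "v \<in> {1..n}" using V[OF that] by blast
    then show "variable v \<in> pullback irrelevant"
      unfolding pullback_def using variable_irrelevant variable_mem by blast
  qed
  have order: "class_sum (V i) \<in> order_ge 1" if i: "i < a" for i
  proof -
    obtain q where q: "q \<in> order_ge 1" "\<pi> (class_sum (V i)) = \<pi> q"
      using irr[OF i] irrelevant_subset unfolding pullback_def by blast
    have "\<pi> (class_sum (V i)) \<in> \<pi> ` order_ge 1" using q by simp
    moreover have "class_sum (V i) \<in> S" by (rule class_sum_mem[OF V[OF i]])
    ultimately show ?thesis using \<pi>_mem_image_iff[OF ideal_of_order_ge edge_polys_order_ge] by blast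
  qed
  have "polys.adjoin_list {1..n} edge_polys ?\<theta> \<subseteq> order_ge 1"
    by (rule polys.adjoin_list_subset[OF ideal_of_order_ge edge_polys_order_ge]) (use order in auto)
  moreover have "1 \<notin> order_ge 1"
    unfolding order_ge_def by (simp add: stable_set_def total_degree_def)
  ultimately have "polys.adjoin_list {1..n} edge_polys ?\<theta> \<noteq> S" using S_one by blast
  then have "regular_sequence A (map \<pi> ?\<theta>)"
    using regular_sequence_iff[OF \<theta>] reg by blast
  moreover have "set (map \<pi> ?\<theta>) \<subseteq> irrelevant"
    using irr unfolding pullback_def by auto
  ultimately have "enat (length (map \<pi> ?\<theta>)) \<le> depth A irrelevant"
    unfolding depth_def by (intro SUP_upper) blast
  then show ?thesis by simp
qed

text \<open>
  For a maximal independent set \<open>W\<close> the squarefree monomial \<open>u\<close> with support \<open>W\<close> has order exactly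
  \<open>card W\<close>, and it is killed modulo the edge ideal by every polynomial whose restriction to the
  variables in \<open>W\<close> is zero. A regular sequence with more than \<open>card W\<close> entries would have a nontrivial
  polynomial combination of this kind.
\<close>

lemma regular_sequence_length_le:
  assumes W: "W \<subseteq> {1..n}" "stable_set E W" "\<And>v. v \<in> {1..n} - W \<Longrightarrow> \<exists>w\<in>W. (v, w) \<in> E"
    and ps: "set ps \<subseteq> order_ge 1" "polys.weakly_regular {1..n} edge_polys ps"
  shows "length ps \<le> card W"
proof (rule ccontr)
  assume "\<not> length ps \<le> card W"
  define r where "r = length ps"
  have r: "card W < r" using \<open>\<not> length ps \<le> card W\<close> by (simp add: r_def)
  have finW: "finite W" using W(1) finite_subset by blast
  \<comment> \<open>padded by \<open>0\<close> to a sequence indexed by all natural numbers\<close>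
  define f where "f i = (if i < r then ps ! i else 0)" for i
  have f_order: "f i \<in> order_ge 1" for i
    using ps(1) nth_mem[of i ps] polys.ideal_ofD(1)[OF ideal_of_order_ge] unfolding f_def r_def by auto
  then have f_S: "f i \<in> S" for i unfolding order_ge_def by blast
  interpret f: element_sequence S "edge_polys :: 'k mpoly set" f
    by unfold_locales (rule ideal_of_restricted_ideal, rule f_S)
  have J: "f.J i = polys.adjoin_list {1..n} edge_polys (take i ps)" if "i \<le> r" for i
    using that
  proof (induction i)
    case (Suc i)
    then have "take (Suc i) ps = take i ps @ [f i]"
      by (simp add: take_Suc_conv_app_nth r_def f_def)
    then show ?case using Suc by (simp add: polys.adjoin_list_append)
  qed simp
  have reg: "f.regular_at j" if "j < r" for j
  proof -
    have "\<forall>g\<in>S. ps ! j * g \<in> polys.adjoin_list {1..n} edge_polys (take j ps) \<longrightarrow>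
        g \<in> polys.adjoin_list {1..n} edge_polys (take j ps)"
      using ps(2) that unfolding polys.weakly_regular_iff_nth r_def by blast
    moreover have "f j = ps ! j" using that by (simp add: f_def)
    moreover have "f.J j = polys.adjoin_list {1..n} edge_polys (take j ps)" using J that by simp
    ultimately show ?thesis unfolding f.regular_at_def by (simp only:)
  qed
  obtain M c where M: "finite M" "M \<noteq> {}" "\<And>m. m \<in> M \<Longrightarrow> length m = r" "\<And>m. m \<in> M \<Longrightarrow> c m \<noteq> (0::'k)"
    "(\<Sum>m\<in>M. Const (c m) * monomial_value (\<lambda>i. restrict_vars W (f i)) m) = 0"
    using polynomial_relation[OF finW r, of "\<lambda>i. restrict_vars W (f i)"] restrict_vars_mem by blast
  \<comment> \<open>the restrictions are related, so the restriction of \<open>F\<close> is zero\<close>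
  define F where "F = (\<Sum>m\<in>M. Const (c m) * monomial_value f m)"
  have "restrict_vars W F = 0"
    using M(5) unfolding F_def restrict_vars_def subst_sum subst_mult subst_monomial_value subst_constant .
  then have F_keys: "\<not> Poly_Mapping.keys m \<subseteq> W" if "m \<in> Poly_Mapping.keys F" for m
    using that unfolding restrict_vars_eq_0_iff by blast
  have F_S: "F \<in> S"
    unfolding F_def by (intro polys.sum_mem S_mult constant_mem f.monomial_value_mem)
  define w where "w = (\<Sum>v\<in>W. Poly_Mapping.single v (1::nat))"
  have lookup_w: "Poly_Mapping.lookup w v = (if v \<in> W then 1 else 0)" for v
  proof -
    have "Poly_Mapping.lookup w v = (\<Sum>x\<in>W. if x = v then 1 else 0)"
      unfolding w_def lookup_sum lookup_single when_def ..
    then show ?thesis using finW by (simp add: sum.delta)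
  qed
  have keys_w: "Poly_Mapping.keys w = W"
    unfolding set_eq_iff in_keys_iff[of _ w] lookup_w by simp
  define u :: "'k mpoly" where "u = Mon w 1"
  have u_S: "u \<in> S" unfolding u_def using W(1) keys_w by (intro monom_mem) simp
  have Fu: "F * u \<in> edge_polys"
  proof (rule restricted_idealI)
    show "F * u \<in> S" by (rule S_mult[OF F_S u_S])
    fix m assume "m \<in> Poly_Mapping.keys (F * u)" and ind: "stable_set E (Poly_Mapping.keys m)"
    then obtain k where k: "k \<in> Poly_Mapping.keys F" "m = w + k"
      using keys_monom_mult[of w F] unfolding u_def by (auto simp: mult.commute)
    obtain v where v: "v \<in> Poly_Mapping.keys k" "v \<notin> W" using F_keys[OF k(1)] by blast
    have "v \<in> {1..n}" using F_S k(1) v(1) unfolding polys_in_def by blast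
    then obtain x where "x \<in> W" "(v, x) \<in> E" using W(3) v(2) by blast
    then show False using ind v(1) keys_w unfolding k(2) keys_add_nat stable_set_def by blast
  qed
  have unit: "Const (c m) \<in> S \<and> (\<exists>d\<in>S. d * Const (c m) = 1)" if "m \<in> M" for m
    using M(4)[OF that] constant_mem by (intro conjI bexI[of _ "Const (inverse (c m))"]) (simp_all add: mult_single)
  have uN: "u \<in> f.N r s" for s
    by (rule f.annihilator_of_relation[OF _ M(1,2) _ _ u_S Fu[unfolded F_def]]) (fact reg M(3) unit)+
  have N_order: "f.N i s \<subseteq> order_ge s" for i s
  proof (induction "i + s" arbitrary: i s rule: less_induct)
    case less
    have S0: "S \<subseteq> order_ge 0" unfolding order_ge_def by simp
    show ?case
    proof (cases s)
      case 0
      then show ?thesis using S0 by simp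
    next
      case (Suc t)
      show ?thesis
      proof (cases i)
        case 0
        then show ?thesis using edge_polys_order_ge Suc by simp
      next
        case (Suc k)
        have IH: "f.N k (Suc t) \<subseteq> order_ge (Suc t)" "f.N (Suc k) t \<subseteq> order_ge t"
          using less[of k "Suc t"] less[of "Suc k" t] \<open>i = Suc k\<close> \<open>s = Suc t\<close> by simp_all
        show ?thesis
        proof
          fix x assume "x \<in> f.N i s"
          then obtain v y where x: "x = v + f k * y" "v \<in> f.N k (Suc t)" "y \<in> f.N (Suc k) t"
            unfolding \<open>i = Suc k\<close> \<open>s = Suc t\<close> by (elim f.forms_SucE)
          have "f k * y \<in> order_ge (1 + t)"
            by (rule order_ge_mult[OF f_order]) (use x(3) IH(2) in blast)
          then have "f k * y \<in> order_ge (Suc t)" by (simp only: plus_1_eq_Suc)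
          then show "x \<in> order_ge s"
            unfolding x(1) \<open>s = Suc t\<close> using x(2) IH(1) by (intro polys.ideal_ofD(2)[OF ideal_of_order_ge]) blast
        qed
      qed
    qed
  qed
  have "u \<in> order_ge (Suc (card W))" using uN N_order by blast
  then have "Suc (card W) \<le> total_degree w"
    unfolding order_ge_def u_def using keys_w W(2) by simp
  also have "total_degree w = card W"
    using W(1) finW by (simp add: total_degree_def lookup_w sum.If_cases Int_absorb1)
  finally show False by simp
qed

lemma depth_le:
  assumes W: "W \<subseteq> {1..n}" "stable_set E W" "\<And>v. v \<in> {1..n} - W \<Longrightarrow> \<exists>w\<in>W. (v, w) \<in> E"
  shows "depth A irrelevant \<le> enat (card W)"
  unfolding depth_def
proof (rule SUP_least)
  fix fs assume "fs \<in> {fs. regular_sequence A fs \<and> set fs \<subseteq> irrelevant}"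
  then have fs: "regular_sequence A fs" "set fs \<subseteq> irrelevant" by blast+
  have "fs \<in> lists (\<pi> ` order_ge 1)" using fs(2) irrelevant_subset by blast
  then obtain ps where ps: "fs = map \<pi> ps" "set ps \<subseteq> order_ge 1"
    unfolding lists_image by auto
  have "set ps \<subseteq> S" using ps(2) unfolding order_ge_def by blast
  then have "polys.weakly_regular {1..n} edge_polys ps"
    using fs(1) regular_sequence_iff unfolding ps(1) by blast
  then show "enat (length fs) \<le> enat (card W)"
    using regular_sequence_length_le[OF W ps(2)] ps(1) by simp
qed

text \<open>
  The variables outside the smallest prime of a chain form an independent set \<open>W\<close>, because a prime over the
  edge ideal contains one end of each edge. If the chain is too long, the elements chosen along it are related
  in \<open>K[W]\<close>, hence modulo the smallest prime.
\<close>

lemma krull_dim_le: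
  assumes "\<And>W. W \<subseteq> {1..n} \<Longrightarrow> stable_set E W \<Longrightarrow> card W \<le> d"
  shows "krull_dim A \<le> enat d"
  unfolding krull_dim_def
proof (rule SUP_least)
  fix k assume "k \<in> {k. \<exists>P. (\<forall>i\<le>k. primeideal (P i) A) \<and> (\<forall>i<k. P i \<subset> P (Suc i))}"
  then obtain P where P: "\<And>i. i \<le> k \<Longrightarrow> primeideal (P i) A" "\<And>i. i < k \<Longrightarrow> P i \<subset> P (Suc i)" by blast
  have P_sub: "P i \<subseteq> carrier A" if "i \<le> k" for i
    using ideal.Icarr[OF primeideal.axioms(1)[OF P(1)[OF that]]] by blast
  have "k \<le> d"
  proof (rule ccontr)
    assume "\<not> k \<le> d"
    \<comment> \<open>reversed, so that \<open>Q k\<close> is the smallest prime of the chain\<close>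
    define Q where "Q j = pullback (P (k - j))" for j
    have Q: "polys.prime_of {1..n} (Q j)" for j
      unfolding Q_def by (rule prime_of_pullback[OF P(1)]) simp
    have Q_step: "Q (Suc j) \<subseteq> Q j \<and> (\<exists>x\<in>S. x \<in> Q j \<and> x \<notin> Q (Suc j))" if j: "j < k" for j
    proof -
      have less: "P (k - Suc j) \<subset> P (k - j)"
        using P(2)[of "k - Suc j"] j by (simp add: Suc_diff_Suc)
      then obtain y where y: "y \<in> P (k - j)" "y \<notin> P (k - Suc j)" by blast
      have "y \<in> carrier A" using y(1) P_sub[of "k - j"] by auto
      then obtain x where "x \<in> S" "y = \<pi> x" unfolding carrier_A by blast
      then show ?thesis using y less unfolding Q_def pullback_def by blast
    qed
    define f where "f j = (if j < k then SOME x. x \<in> S \<and> x \<in> Q j \<and> x \<notin> Q (Suc j) else 0)" for j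
    have f: "f j \<in> S \<and> f j \<in> Q j \<and> f j \<notin> Q (Suc j)" if "j < k" for j
    proof -
      have "\<exists>x. x \<in> S \<and> x \<in> Q j \<and> x \<notin> Q (Suc j)" using Q_step[OF that] by blast
      then have "(SOME x. x \<in> S \<and> x \<in> Q j \<and> x \<notin> Q (Suc j)) \<in> S \<and>
        (SOME x. x \<in> S \<and> x \<in> Q j \<and> x \<notin> Q (Suc j)) \<in> Q j \<and>
        (SOME x. x \<in> S \<and> x \<in> Q j \<and> x \<notin> Q (Suc j)) \<notin> Q (Suc j)" by (rule someI_ex)
      then show ?thesis using that by (simp add: f_def)
    qed
    have f_S: "f j \<in> S" for j using f[of j] S_zero by (cases "j < k") (simp_all add: f_def)
    have Qk: "polys.ideal_of {1..n} (Q k)" using Q unfolding polys.prime_of_def by blast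
    have I_Q: "edge_polys \<subseteq> Q k"
      unfolding Q_def by (rule ideal_of_pullback(2)[OF primeideal.axioms(1)[OF P(1)]]) simp
    define W where "W = {v \<in> {1..n}. variable v \<notin> Q k}"
    have "stable_set E W"
      unfolding stable_set_def
    proof (intro ballI notI)
      fix u v assume uv: "u \<in> W" "v \<in> W" "(u, v) \<in> E"
      have "variable u * variable v \<in> Idl\<^bsub>polynomial_ring K n\<^esub> {variable u * variable v | u v. (u, v) \<in> E}"
      proof (rule R.genideal_self[THEN subsetD])
        show "{variable u * variable v | u v. (u, v) \<in> E} \<subseteq> carrier (polynomial_ring K n)"
          unfolding carrier_polynomial_ring by (rule edge_generators_subset)
      qed (use uv in blast)
      then have "variable u * variable v \<in> Q k" using genideal_edges I_Q by blast
      moreover have "variable u \<in> S" "variable v \<in> S" using uv variable_mem unfolding W_def by blast+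
      ultimately have "variable u \<in> Q k \<or> variable v \<in> Q k" using Q unfolding polys.prime_of_def by blast
      then show False using uv unfolding W_def by blast
    qed
    then have "card W \<le> d" by (intro assms) (auto simp: W_def)
    then have cardW: "card W < k" using \<open>\<not> k \<le> d\<close> by simp
    have finW: "finite W" unfolding W_def by simp
    obtain M c where M: "finite M" "M \<noteq> {}" "\<And>m. m \<in> M \<Longrightarrow> length m = k" "\<And>m. m \<in> M \<Longrightarrow> c m \<noteq> (0::'k)"
      "(\<Sum>m\<in>M. Const (c m) * monomial_value (\<lambda>i. restrict_vars W (f i)) m) = 0"
      using polynomial_relation[OF finW cardW, of "\<lambda>i. restrict_vars W (f i)"] restrict_vars_mem by blast
    define F where "F = (\<Sum>m\<in>M. Const (c m) * monomial_value f m)"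
    have "restrict_vars W F = 0"
      using M(5) unfolding F_def restrict_vars_def subst_sum subst_mult subst_monomial_value subst_constant .
    then have F_keys: "\<not> Poly_Mapping.keys m \<subseteq> W" if "m \<in> Poly_Mapping.keys F" for m
      using that unfolding restrict_vars_eq_0_iff by blast
    have mv: "monomial_value f m \<in> S" for m
      by (induction m) (simp_all only: monomial_value.simps S_one S_mult polys.power_mem f_S)
    have F_S: "F \<in> S"
      unfolding F_def by (intro polys.sum_mem S_mult constant_mem mv)
    have "F \<in> Q k"
    proof (rule mem_ideal_if_monoms[OF Qk])
      fix m assume m: "m \<in> Poly_Mapping.keys F"
      have mA: "Poly_Mapping.keys m \<subseteq> {1..n}" using F_S m unfolding polys_in_def by blast
      obtain v where v: "v \<in> Poly_Mapping.keys m" "v \<notin> W" using F_keys[OF m] by blast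
      then have "variable v \<in> Q k" using mA unfolding W_def by blast
      moreover have "Mon (m - Poly_Mapping.single v 1) (Poly_Mapping.lookup F m) \<in> S"
        using mA keys_minus_nat[of m] by (intro monom_mem) blast
      ultimately show "Mon m (Poly_Mapping.lookup F m) \<in> Q k"
        unfolding monom_split_variable[OF v(1)] by (intro polys.ideal_ofD(4)[OF Qk])
    qed
    moreover have "F \<notin> Q k"
      unfolding F_def
    proof (rule polys.relation_not_in_prime_chain[where A = "{1..n}"])
      show "Const (c m) \<in> S \<and> (\<exists>d\<in>S. d * Const (c m) = 1)" if "m \<in> M" for m
        using M(4)[OF that] constant_mem by (intro conjI bexI[of _ "Const (inverse (c m))"]) (simp_all add: mult_single)
      show "Q (Suc j) \<subseteq> Q j" if "j < k" for j using Q_step[OF that] by blast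
      show "f j \<in> Q j" "f j \<notin> Q (Suc j)" if "j < k" for j using f[OF that] by blast+
    qed (simp_all add: Q f_S M(1-3))
    ultimately show False by blast
  qed
  then show "enat k \<le> enat d" by simp
qed

text \<open>
  Setting the variables of \<open>W\<close> to zero one after the other gives a chain of primes, the kernels of the
  restrictions to the shrinking subsets of \<open>W\<close>.
\<close>

lemma krull_dim_ge:
  assumes W: "W \<subseteq> {1..n}" "stable_set E W"
  shows "enat (card W) \<le> krull_dim A"
proof -
  have finW: "finite W" using W(1) finite_subset by blast
  obtain h where h: "bij_betw h {0..<card W} W" using ex_bij_betw_nat_finite[OF finW] by blast
  define U where "U j = W - h ` {0..<j}" for j
  define Q :: "nat \<Rightarrow> 'k mpoly set" where "Q j = {p \<in> S. restrict_vars (U j) p = 0}" for j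
  have Q: "polys.prime_of {1..n} (Q j)" for j
  proof -
    have "polys.ideal_of {1..n} (Q j)"
      unfolding polys.ideal_of_def Q_def restrict_vars_def
      by (intro conjI ballI subsetI CollectI) (simp_all add: subst_mult subst_add S_add S_mult S_zero)
    moreover have "1 \<notin> Q j" unfolding Q_def restrict_vars_def by simp
    moreover have "x \<in> Q j \<or> y \<in> Q j" if "x \<in> S" "y \<in> S" "x * y \<in> Q j" for x y
      using that unfolding Q_def restrict_vars_def by (simp add: subst_mult)
    ultimately show ?thesis unfolding polys.prime_of_def by blast
  qed
  have I_Q: "edge_polys \<subseteq> Q j" for j
  proof
    fix p :: "'k mpoly" assume p: "p \<in> edge_polys"
    have "\<not> Poly_Mapping.keys m \<subseteq> U j" if m: "m \<in> Poly_Mapping.keys p" for m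
    proof
      assume "Poly_Mapping.keys m \<subseteq> U j"
      then have "Poly_Mapping.keys m \<subseteq> W" unfolding U_def by blast
      then show False using restricted_idealD(2)[OF p m] stable_set_subset[OF W(2)] W(1) by blast
    qed
    then show "p \<in> Q j" unfolding Q_def restrict_vars_eq_0_iff using restricted_idealD(1)[OF p] by blast
  qed
  have step: "\<pi> ` Q j \<subset> \<pi> ` Q (Suc j)" if j: "j < card W" for j
  proof -
    have "U (Suc j) \<subseteq> U j" unfolding U_def by auto
    then have "Q j \<subseteq> Q (Suc j)" unfolding Q_def restrict_vars_eq_0_iff by blast
    have hj: "h j \<in> W" using h j unfolding bij_betw_def by auto
    have "h j \<notin> h ` {0..<j}"
    proof
      assume "h j \<in> h ` {0..<j}"
      then obtain i where "i < j" "h j = h i" by auto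
      then show False using h j inj_onD[of h "{0..<card W}" j i] unfolding bij_betw_def by auto
    qed
    then have "h j \<in> U j" "h j \<notin> U (Suc j)" unfolding U_def using hj by auto
    then have x: "variable (h j) \<in> Q (Suc j)" "variable (h j) \<notin> Q j" "variable (h j) \<in> S"
      unfolding Q_def restrict_vars_eq_0_iff using hj W(1) variable_mem[of "h j" "{1..n}"] by (auto simp: variable_def)
    have "polys.ideal_of {1..n} (Q j)" using Q unfolding polys.prime_of_def by blast
    then have "\<pi> (variable (h j)) \<notin> \<pi> ` Q j" using \<pi>_mem_image_iff[OF _ I_Q x(3)] x(2) by blast
    then show ?thesis using x(1) \<open>Q j \<subseteq> Q (Suc j)\<close> by blast
  qed
  have "card W \<in> {k. \<exists>P. (\<forall>i\<le>k. primeideal (P i) A) \<and> (\<forall>i<k. P i \<subset> P (Suc i))}"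
    using primeideal_image[OF Q I_Q] step by (intro CollectI exI[of _ "\<lambda>j. \<pi> ` Q j"]) blast
  then show ?thesis unfolding krull_dim_def by (rule SUP_upper)
qed

end

section \<open>Bounds for connected graphs\<close>

lemma (in edge_quotient) edge_ring_eq:
  assumes "parcs G = E"
  shows "edge_ring K n G = A" "edge_ring_maximal_ideal K n G = irrelevant"
proof -
  have ideal: "edge_ideal K n G = edge_polys"
    unfolding edge_ideal_def assms by (rule genideal_edges)
  then show "edge_ring K n G = A" by (simp add: edge_ring_def)
  then show "edge_ring_maximal_ideal K n G = irrelevant"
    unfolding edge_ring_maximal_ideal_def irrelevant_def ideal image_image by (simp only: \<pi>_def)
qed

lemma connected_graphs_edge_relation:
  assumes "G \<in> connected_graphs n"
  shows "edge_relation n (parcs G)"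
proof -
  have G: "pair_graph G" "pverts G = {1..n}" using assms by (auto simp: connected_graphs_def)
  interpret G: pair_graph G by fact
  show ?thesis
  proof
    show "sym (parcs G)" using G.pair_sym_arcs by (simp add: symmetric_def)
    show "irrefl (parcs G)" using G.pair_no_loops by (fastforce simp: irrefl_def)
    show "parcs G \<subseteq> {1..n} \<times> {1..n}"
    proof (rule subrelI)
      fix u v assume "(u, v) \<in> parcs G"
      then show "(u, v) \<in> {1..n} \<times> {1..n}"
        using G.in_arcsD1[of u v] G.in_arcsD2[of u v] G(2) by simp
    qed
  qed
qed

lemma connected_graphs_iff:
  assumes "edge_relation n (parcs G)" "pverts G = {1..n}"
  shows "G \<in> connected_graphs n \<longleftrightarrow>
    {1..n} \<noteq> {} \<and> (\<forall>u\<in>{1..n}. \<forall>v\<in>{1..n}. (u, v) \<in> rtrancl_on {1..n} (parcs G))"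
proof -
  interpret edge_relation n "parcs G" by fact
  have graph: "pair_graph G"
  proof
    show "finite (pverts G)" using assms(2) by simp
    show "finite (parcs G)" using E_subset by (rule finite_subset) simp
    show "symmetric (with_proj G)" using sym_E by (simp add: symmetric_def)
    show "fst e \<in> pverts G" "snd e \<in> pverts G" if "e \<in> parcs G" for e
      using that E_subset assms(2) by auto
    show "fst e \<noteq> snd e" if "e \<in> parcs G" for e
      using that irrefl_E unfolding irrefl_def by (metis prod.collapse)
  qed
  have "(parcs G)\<^sup>s = parcs G"
    using sym_E unfolding symcl_def sym_def by auto
  then show ?thesis
    unfolding connected_graphs_def using graph assms(2) by (simp add: connected_conv)
qed

lemma exists_maximal_independent:
  assumes "edge_relation n E"
  obtains W where "W \<subseteq> {1..n}" "stable_set E W"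
    "\<And>v. v \<in> {1..n} - W \<Longrightarrow> \<exists>w\<in>W. (v, w) \<in> E"
    "\<And>W'. W' \<subseteq> {1..n} \<Longrightarrow> stable_set E W' \<Longrightarrow> card W' \<le> card W"
proof -
  interpret edge_relation n E by fact
  let ?F = "{W. W \<subseteq> {1..n} \<and> stable_set E W}"
  have fin: "finite ?F" by (rule finite_subset[of _ "Pow {1..n}"]) auto
  moreover have "{} \<in> ?F" by (simp add: stable_set_def)
  ultimately have "Max (card ` ?F) \<in> card ` ?F" by (intro Max_in) auto
  then obtain W where W: "W \<in> ?F" "card W = Max (card ` ?F)" by auto
  have W_max: "card W' \<le> card W" if "W' \<in> ?F" for W'
    unfolding W(2) using fin that by (intro Max_ge) auto
  have "\<exists>w\<in>W. (v, w) \<in> E" if v: "v \<in> {1..n} - W" for v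
  proof (rule ccontr)
    assume no: "\<not> (\<exists>w\<in>W. (v, w) \<in> E)"
    then have "\<not> (\<exists>w\<in>W. (w, v) \<in> E)" using sym_E unfolding sym_def by blast
    moreover have "(v, v) \<notin> E" using irrefl_E unfolding irrefl_def by blast
    ultimately have "insert v W \<in> ?F" using W(1) v no unfolding stable_set_def by blast
    then have "card (insert v W) \<le> card W" by (rule W_max)
    moreover have "finite W" using W(1) finite_subset by blast
    ultimately show False using v by simp
  qed
  then show thesis using that W(1) W_max by blast
qed

text \<open>
  An independent set of largest size is maximal, so its size bounds the depth and equals the dimension.
  The depth is positive because the whole vertex set is an admissible class for any single vertex.
\<close>

theorem graph_depth_dim_subset:
  assumes n: "n \<ge> 2"
  shows "graph_depth_dim TYPE('k::field) n \<subseteq> map_prod enat enat ` C_plus n"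
proof
  fix x assume "x \<in> graph_depth_dim TYPE('k) n"
  then obtain G where G: "G \<in> connected_graphs n"
    and x: "x = (depth (edge_ring TYPE('k) n G) (edge_ring_maximal_ideal TYPE('k) n G), krull_dim (edge_ring TYPE('k) n G))"
    unfolding graph_depth_dim_def by blast
  have E: "edge_relation n (parcs G)" by (rule connected_graphs_edge_relation[OF G])
  interpret edge_relation n "parcs G" by (rule E)
  interpret edge_quotient n "parcs G" "TYPE('k)"
    by unfold_locales (rule ideal_of_restricted_ideal)
  obtain W where W: "W \<subseteq> {1..n}" "stable_set (parcs G) W"
    "\<And>v. v \<in> {1..n} - W \<Longrightarrow> \<exists>w\<in>W. (v, w) \<in> parcs G"
    "\<And>W'. W' \<subseteq> {1..n} \<Longrightarrow> stable_set (parcs G) W' \<Longrightarrow> card W' \<le> card W"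
    by (rule exists_maximal_independent[OF E]) blast
  have dim: "krull_dim A = enat (card W)"
    by (rule antisym[OF krull_dim_le krull_dim_ge]) (use W in auto)
  have le: "depth A irrelevant \<le> enat (card W)" by (rule depth_le[OF W(1-3)])
  have "polys.weakly_regular {1..n} (edge_polys :: 'k mpoly set) (map (\<lambda>i. class_sum {1..n}) [0..<1])"
    by (rule weakly_regular_packing[OF sym_E irrefl_E, where s = "\<lambda>_. 1"]) (use n in auto)
  then have ge: "enat 1 \<le> depth A irrelevant"
    by (rule depth_ge) simp
  obtain d where d: "depth A irrelevant = enat d" using le by (cases "depth A irrelevant") auto
  have "pverts G = {1..n}" using G by (simp add: connected_graphs_def)
  then have conn: "(1, 2) \<in> rtrancl_on {1..n} (parcs G)"
    using connected_graphs_iff[OF E] G n by force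
  have "parcs G \<noteq> {}"
    using rtrancl_on_rtranclI[OF conn] by auto
  then have "\<not> stable_set (parcs G) {1..n}" using E_subset unfolding stable_set_def by auto
  then have "W \<subset> {1..n}" using W(1,2) by blast
  then have "card W < card {1..n}" by (intro psubset_card_mono) simp_all
  then have "(d, card W) \<in> C_plus n" using le ge d by (simp add: C_plus_def)
  then have "map_prod enat enat (d, card W) \<in> map_prod enat enat ` C_plus n" by (rule imageI)
  then show "x \<in> map_prod enat enat ` C_plus n"
    unfolding x edge_ring_eq[OF refl] dim d by simp
qed

section \<open>Graphs with prescribed depth and dimension\<close>

text \<open>
  The vertices are \<open>Y = {1..<a}\<close>, the vertices \<open>z\<^sub>j = a - 1 + j\<close> for \<open>j = 1,\<dots>,n - a\<close>, and the centre \<open>c = n\<close>.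
  The centre is joined to all \<open>z\<^sub>j\<close>, so that \<open>c\<close> and \<open>Y\<close> form a maximal independent set of size \<open>a\<close>. With
  \<open>q = n - 1 - b\<close>, the vertex \<open>y \<in> Y\<close> is joined to \<open>z\<^sub>j\<close> for \<open>j = min y q\<close>, and the vertices
  \<open>z\<^sub>a,\<dots>,z\<^bsub>q+1\<^esub>\<close> form a clique, which has at most one vertex unless \<open>q \<ge> a\<close>. Without the centre the graph is
  thus a disjoint union of stars with leaves in \<open>Y\<close>, a clique, and isolated vertices. Choosing all
  leaves, one vertex of the clique (if it is nonempty) and all isolated vertices loses exactly \<open>q\<close> of the \<open>n - 1\<close> vertices.
  For \<open>a = 1\<close> and \<open>b = n - 1\<close> the graph is a star.
\<close>

locale prescribed_invariants =
  fixes n a b :: nat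
  assumes a_pos: "1 \<le> a" and a_le_b: "a \<le> b" and b_le: "b \<le> n - 1" and a_le: "2 * a \<le> n"
    and b_le': "2 \<le> a \<Longrightarrow> b \<le> n - 2"
begin

definition q :: nat where "q = n - 1 - b"

definition arc :: "nat \<Rightarrow> nat \<Rightarrow> bool" where
  "arc u v \<longleftrightarrow> v = n \<and> a \<le> u \<and> u < n \<or> 1 \<le> u \<and> u < a \<and> v = a - 1 + min u q
    \<or> 2 * a - 1 \<le> u \<and> u < v \<and> v \<le> a + q"

definition E :: "(nat \<times> nat) set" where
  "E = {(u, v). arc u v \<or> arc v u}"

lemma q_bounds: "a + q \<le> n - 1" "2 \<le> a \<Longrightarrow> 1 \<le> q" "b + q = n - 1"
  using a_pos a_le_b b_le a_le b_le' by (auto simp: q_def)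

lemma arc_bounds: "arc u v \<Longrightarrow> 1 \<le> u \<and> u < v \<and> v \<le> n"
  using a_pos a_le q_bounds by (auto simp: arc_def min_def split: if_splits)

lemma edge_relation_E: "edge_relation n E"
proof
  show "sym E" by (auto simp: E_def sym_def)
  show "irrefl E" using arc_bounds by (fastforce simp: E_def irrefl_def)
  show "E \<subseteq> {1..n} \<times> {1..n}" using arc_bounds unfolding E_def by fastforce
qed

sublocale edge_relation n E by (rule edge_relation_E)

definition G :: "nat pair_pre_digraph" where
  "G = \<lparr>pverts = {1..n}, parcs = E\<rparr>"

lemma G_simps [simp]: "pverts G = {1..n}" "parcs G = E"
  by (simp_all add: G_def)

lemma arc_to_centre: "a \<le> u \<Longrightarrow> u < n \<Longrightarrow> (u, n) \<in> E"
  by (simp add: E_def arc_def)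

lemma connected_G: "G \<in> connected_graphs n"
proof -
  have to_centre: "(v, n) \<in> rtrancl_on {1..n} E" if v: "v \<in> {1..n}" for v
  proof -
    have upper: "(w, n) \<in> rtrancl_on {1..n} E" if "a \<le> w" "w \<le> n" for w
    proof (cases "w = n")
      case True
      then show ?thesis using v by auto
    next
      case False
      then show ?thesis
        using arc_to_centre[of w] that a_pos v
        by (intro converse_rtrancl_on_into_rtrancl_on[of w n]) auto
    qed
    show ?thesis
    proof (cases "a \<le> v")
      case True
      then show ?thesis using upper v by simp
    next
      case False
      let ?w = "a - 1 + min v q"
      have "(v, ?w) \<in> E" using False v by (simp add: E_def arc_def)
      moreover have "a \<le> ?w" using q_bounds(2) False v by (auto simp: min_def)
      moreover have "?w \<le> n" using q_bounds(1) by (auto simp: min_def)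
      ultimately show ?thesis
        using upper[of ?w] v by (intro converse_rtrancl_on_into_rtrancl_on[of v ?w]) auto
    qed
  qed
  have from_centre: "(n, v) \<in> rtrancl_on {1..n} E" if "v \<in> {1..n}" for v
    using rtrancl_on_sym[OF sym_E, of "{1..n}"] to_centre[OF that] unfolding sym_def by blast
  show ?thesis
    using connected_graphs_iff[of n G] edge_relation_E a_pos a_le rtrancl_on_trans[OF to_centre from_centre]
    by simp
qed

lemma large_independent:
  "stable_set E ({1..<a} \<union> {a + q..<n})" "card ({1..<a} \<union> {a + q..<n}) = b"
proof -
  have "\<not> arc u v" if "u \<in> {1..<a} \<union> {a + q..<n}" "v \<in> {1..<a} \<union> {a + q..<n}" for u v
    using that a_pos q_bounds(2) by (auto simp: arc_def min_def)
  then show "stable_set E ({1..<a} \<union> {a + q..<n})"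
    unfolding stable_set_def E_def by blast
  have "card ({1..<a} \<union> {a + q..<n}) = card {1..<a} + card {a + q..<n}"
    by (rule card_Un_disjoint) auto
  then show "card ({1..<a} \<union> {a + q..<n}) = b"
    using q_bounds(1,3) a_pos by simp
qed

text \<open>
  The number of a clique in a partition of all vertices except the centre into \<open>b\<close> cliques: the pairs
  \<open>y, z\<^sub>y\<close> for \<open>y \<le> min q (a - 1)\<close>, the remaining \<open>y\<close> as singletons, the clique \<open>z\<^sub>a,\<dots>,z\<^bsub>q+1\<^esub>\<close> or else the
  single vertex \<open>z\<^bsub>q+1\<^esub>\<close> with the number \<open>a\<close>, and the later \<open>z\<^sub>j\<close> as singletons. An independent set meets
  each clique at most once.
\<close>

definition clique_index :: "nat \<Rightarrow> nat" where
  "clique_index v = (if v < a then v else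
    if v - (a - 1) \<le> min q (a - 1) then v - (a - 1) else a - 1 + max 1 (v - (a - 1) - q))"

lemma clique_index_range: "1 \<le> v \<Longrightarrow> v < n \<Longrightarrow> clique_index v \<in> {1..b}"
  using a_pos a_le_b q_bounds unfolding clique_index_def by (auto simp: max_def min_def)

lemma clique_index_eq:
  assumes "1 \<le> u" "u < v" "v < n" "clique_index u = clique_index v"
  shows "arc u v"
proof -
  have index: "clique_index (a - 1 + k) = (if k \<le> min q (a - 1) then k else a - 1 + max 1 (k - q))"
    if "1 \<le> k" for k
  proof -
    have "\<not> a - 1 + k < a" "a - 1 + k - (a - 1) = k" using that a_pos by linarith+
    then show ?thesis by (simp only: clique_index_def if_False)
  qed
  have "a \<le> v"
  proof (rule ccontr)
    assume "\<not> a \<le> v"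
    then show False using assms by (simp add: clique_index_def)
  qed
  define j where "j = v - (a - 1)"
  have j: "v = a - 1 + j" "1 \<le> j" using \<open>a \<le> v\<close> a_pos by (simp_all add: j_def)
  note index_v = index[OF j(2), folded j(1)]
  show ?thesis
  proof (cases "u < a")
    case True
    then have u: "clique_index u = u" by (simp add: clique_index_def)
    have "j \<le> min q (a - 1)"
    proof (rule ccontr)
      assume "\<not> j \<le> min q (a - 1)"
      then have "a - 1 + 1 \<le> clique_index v" using index_v by simp
      then show False using u assms(4) True by simp
    qed
    then have "j = u" "j \<le> q" using index_v u assms(4) by simp_all
    then show ?thesis using True assms(1) j(1) by (simp add: arc_def)
  next
    case False
    define i where "i = u - (a - 1)"
    have i: "u = a - 1 + i" "1 \<le> i" using False a_pos by (simp_all add: i_def)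
    note index_u = index[OF i(2), folded i(1)]
    have ij: "i < j" using assms(2) i(1) j(1) by simp
    have i': "\<not> i \<le> min q (a - 1)"
    proof
      assume le: "i \<le> min q (a - 1)"
      show False
      proof (cases "j \<le> min q (a - 1)")
        case True
        then show False using index_u index_v le assms(4) ij by simp
      next
        case False
        then have "a - 1 + 1 \<le> clique_index v" using index_v by simp
        moreover have "clique_index u \<le> a - 1" using index_u le by simp
        ultimately show False using assms(4) by simp
      qed
    qed
    then have j': "\<not> j \<le> min q (a - 1)" using ij by linarith
    have "a - 1 + max 1 (i - q) = a - 1 + max 1 (j - q)"
      using index_u index_v assms(4) by (simp only: i' j' if_False)
    then have "max 1 (i - q) = max 1 (j - q)" by linarith
    then have "j \<le> q + 1" using ij by (simp add: max_def split: if_splits)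
    moreover have "a \<le> i" using i' \<open>j \<le> q + 1\<close> ij a_pos by (simp add: min_def split: if_splits)
    ultimately have "2 * a - 1 \<le> u" "v \<le> a + q" using i(1) j(1) a_pos by linarith+
    then show ?thesis using assms(2) by (simp add: arc_def)
  qed
qed

lemma independent_card_le:
  assumes W: "W \<subseteq> {1..n}" "stable_set E W"
  shows "card W \<le> b"
proof (cases "n \<in> W")
  case True
  have "W \<subseteq> insert n {1..<a}"
  proof
    fix v assume v: "v \<in> W"
    then have "(v, n) \<notin> E" using W(2) True unfolding stable_set_def by blast
    then show "v \<in> insert n {1..<a}" using arc_to_centre[of v] v W(1) by force
  qed
  then have "card W \<le> card (insert n {1..<a})" by (rule card_mono[rotated]) simp
  also have "\<dots> \<le> a" using card_insert_le_m1[of a "{1..<a}" n] a_pos by simp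
  finally show ?thesis using a_le_b by simp
next
  case False
  then have W': "1 \<le> v \<and> v < n" if "v \<in> W" for v
    using W(1) that by (metis atLeastAtMost_iff le_neq_implies_less subsetD)
  have "inj_on clique_index W"
  proof (rule inj_onI)
    fix u v assume uv: "u \<in> W" "v \<in> W" "clique_index u = clique_index v"
    have "(u, v) \<notin> E" using W(2) uv unfolding stable_set_def by blast
    then have "\<not> arc u v" "\<not> arc v u" by (simp_all add: E_def)
    then show "u = v"
      using clique_index_eq[of u v] clique_index_eq[of v u] uv W'[OF uv(1)] W'[OF uv(2)]
      by (metis nat_neq_iff)
  qed
  then have "card W \<le> card {1..b}"
    by (rule card_inj_on_le) (use clique_index_range W' in auto)
  then show ?thesis by simp
qed

lemma small_maximal_independent:
  "insert n {1..<a} \<subseteq> {1..n}" "stable_set E (insert n {1..<a})" "card (insert n {1..<a}) = a"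
  "\<And>v. v \<in> {1..n} - insert n {1..<a} \<Longrightarrow> \<exists>w\<in>insert n {1..<a}. (v, w) \<in> E"
proof -
  show "insert n {1..<a} \<subseteq> {1..n}" using a_pos a_le by auto
  have "\<not> arc u v" if "u \<in> insert n {1..<a}" "v \<in> insert n {1..<a}" for u v
  proof
    assume "arc u v"
    then have "a \<le> v" "v = n \<Longrightarrow> a \<le> u \<and> u < n"
      using a_pos a_le q_bounds(1,2) unfolding arc_def by linarith+
    then show False using that by auto
  qed
  then show "stable_set E (insert n {1..<a})" unfolding stable_set_def E_def by blast
  show "card (insert n {1..<a}) = a" using a_pos a_le by (simp add: card_insert_if)
  show "\<exists>w\<in>insert n {1..<a}. (v, w) \<in> E" if "v \<in> {1..n} - insert n {1..<a}" for v
    using that arc_to_centre[of v] by auto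
qed

text \<open>
  The classes \<open>{y, z\<^sub>y}\<close> for \<open>y \<in> Y\<close> (with \<open>y = i + 1\<close>), and one class for the centre and all later \<open>z\<^sub>j\<close>.
\<close>

definition V :: "nat \<Rightarrow> nat set" where
  "V i = (if i < a - 1 then {i + 1, a + i} else {2 * a - 1..n})"

lemma neighbours:
  shows "1 \<le> u \<Longrightarrow> u < a \<Longrightarrow> (u, v) \<in> E \<Longrightarrow> v = a - 1 + min u q"
    and "q < u \<Longrightarrow> u < a \<Longrightarrow> (a - 1 + u, v) \<in> E \<Longrightarrow> v = n"
    and "(2 * a - 1, v) \<in> E \<Longrightarrow> 2 * a - 1 \<le> v"
  using a_pos a_le q_bounds(1,2) unfolding E_def arc_def mem_Collect_eq case_prod_conv
  by (elim disjE conjE; simp add: min_def split: if_splits)+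

text \<open>
  One splitting at the centre suffices. After deleting the centre, the closed neighbourhood of \<open>y\<close> is the
  class \<open>{y, z\<^sub>y}\<close> if \<open>y \<le> q\<close>, while for \<open>y > q\<close> the vertex \<open>z\<^sub>y\<close> is isolated; the neighbours of
  \<open>z\<^sub>a = 2a - 1\<close> form the rest of its clique. After deleting the neighbours of the centre, the independent
  set of \<open>c\<close> and \<open>Y\<close> remains, with one vertex in each class.
\<close>

lemma weakly_regular_V:
  "polys.weakly_regular {1..n} (edge_polys :: 'k::field mpoly set) (map (\<lambda>i. class_sum (V i)) [0..<a])"
    (is "polys.weakly_regular _ _ ?\<theta>")
proof -
  have V_sub: "V i \<subseteq> {1..n}" if "i < a" for i using that a_pos a_le by (auto simp: V_def)
  have disj: "V i \<inter> V j = {}" if "i < a" "j < a" "i \<noteq> j" for i j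
    using that a_le by (auto simp: V_def)
  note packing = weakly_regular_packing[OF sym_E irrefl_E _ V_sub disj]
  have nn: "(n, n) \<notin> E" using irrefl_E unfolding irrefl_def by blast
  have n: "n \<in> {1..n}" using a_pos a_le by simp
  have del: "polys.weakly_regular {1..n} (restricted_ideal E {1..n} ({1..n} - {n}) :: 'k mpoly set) ?\<theta>"
  proof (rule packing)
    let ?s = "\<lambda>i. if i < a - 1 then if i + 1 \<le> q then i + 1 else a - 1 + (i + 1) else 2 * a - 1"
    fix i assume i: "i < a"
    consider "i < a - 1" "i + 1 \<le> q" | "i < a - 1" "q < i + 1" | "\<not> i < a - 1" by linarith
    then show "?s i \<in> ({1..n} - {n}) \<inter> V i \<and> E `` {?s i} \<inter> ({1..n} - {n}) \<subseteq> V i"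
    proof cases
      case 1
      then have "E `` {i + 1} \<subseteq> {a + i}" using neighbours(1)[of "i + 1"] by auto
      then show ?thesis using 1 a_le by (auto simp: V_def)
    next
      case 2
      have "x = n" if "(a - 1 + (i + 1), x) \<in> E" for x
        by (rule neighbours(2)[OF _ _ that]) (use 2 in simp_all)
      then have "E `` {a - 1 + (i + 1)} \<subseteq> {n}" by blast
      then show ?thesis using 2 a_le a_pos by (auto simp: V_def)
    next
      case 3
      then show ?thesis using neighbours(3) a_le a_pos by (auto simp: V_def)
    qed
  qed auto
  have link: "polys.weakly_regular {1..n} (restricted_ideal E {1..n} ({1..n} - E `` {n}) :: 'k mpoly set) ?\<theta>"
  proof (rule packing)
    let ?s = "\<lambda>i. if i < a - 1 then i + 1 else n"
    have U: "{1..n} - E `` {n} \<subseteq> insert n {1..<a}"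
    proof
      fix v assume v: "v \<in> {1..n} - E `` {n}"
      then have "(v, n) \<notin> E" using sym_E unfolding sym_def by blast
      then show "v \<in> insert n {1..<a}" using arc_to_centre[of v] v by force
    qed
    fix i assume i: "i < a"
    have s: "?s i \<in> insert n {1..<a}" using i by auto
    have "E `` {?s i} \<inter> ({1..n} - E `` {n}) = {}"
      using small_maximal_independent(2) s U unfolding stable_set_def by blast
    moreover have "?s i \<notin> E `` {n}"
      using small_maximal_independent(2) s unfolding stable_set_def by blast
    moreover have "?s i \<in> V i" "?s i \<in> {1..n}" using i a_pos a_le by (auto simp: V_def)
    ultimately show "?s i \<in> ({1..n} - E `` {n}) \<inter> V i \<and> E `` {?s i} \<inter> ({1..n} - E `` {n}) \<subseteq> V i" by blast
  qed auto
  have "polys.weakly_regular {1..n} (polys.colon {1..n} edge_polys (variable n)) ?\<theta>"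
    unfolding colon_restricted_ideal[OF sym_E nn n n] by (rule link)
  moreover have "polys.weakly_regular {1..n} (polys.adjoin {1..n} edge_polys (variable n)) ?\<theta>"
    unfolding adjoin_restricted_ideal[OF n] by (rule del)
  moreover have "set ?\<theta> \<subseteq> polys_in {1..n}" by (rule class_sums_mem[OF V_sub])
  ultimately show ?thesis
    using polys.weakly_regular_colon_adjoin[OF ideal_of_restricted_ideal variable_mem[OF n]] by blast
qed

lemma graph_depth_dim_mem: "(enat a, enat b) \<in> graph_depth_dim TYPE('k::field) n"
proof -
  interpret edge_quotient n E "TYPE('k)"
    by unfold_locales (rule ideal_of_restricted_ideal)
  have "krull_dim A = enat b"
  proof (rule antisym)
    show "krull_dim A \<le> enat b" by (rule krull_dim_le[OF independent_card_le])
    have "{1..<a} \<union> {a + q..<n} \<subseteq> {1..n}" using a_pos a_le by auto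
    from krull_dim_ge[OF this large_independent(1)] show "enat b \<le> krull_dim A"
      by (simp only: large_independent(2))
  qed
  moreover have "depth A irrelevant = enat a"
  proof (rule antisym)
    show "depth A irrelevant \<le> enat a"
      using depth_le[OF small_maximal_independent(1,2,4)] by (simp only: small_maximal_independent(3))
    show "enat a \<le> depth A irrelevant"
      by (rule depth_ge[OF weakly_regular_V]) (use a_pos a_le in \<open>auto simp: V_def\<close>)
  qed
  ultimately show ?thesis
    unfolding graph_depth_dim_def using connected_G edge_ring_eq[of G] by (intro image_eqI[of _ _ G]) simp_all
qed

end

theorem theorem2p9:
  fixes n :: nat
  assumes "n \<ge> 3"
  shows "map_prod enat enat ` C_minus n \<subseteq> graph_depth_dim TYPE('k::field) n
    \<and> graph_depth_dim TYPE('k) n \<subseteq> map_prod enat enat ` C_plus n"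
proof
  show "graph_depth_dim TYPE('k) n \<subseteq> map_prod enat enat ` C_plus n"
    using assms by (intro graph_depth_dim_subset) simp
  show "map_prod enat enat ` C_minus n \<subseteq> graph_depth_dim TYPE('k) n"
  proof
    fix x assume "x \<in> map_prod enat enat ` C_minus n"
    then obtain a b where ab: "x = (enat a, enat b)" "(a, b) \<in> C_minus n" by auto
    have "prescribed_invariants n a b"
      using ab(2) assms unfolding C_minus_def by unfold_locales auto
    then show "x \<in> graph_depth_dim TYPE('k) n"
      unfolding ab(1) by (rule prescribed_invariants.graph_depth_dim_mem)
  qed
qed

end
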